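(* Consider the gradient descent algorithm with noise injection $$X_{k+1}^S=X_k^S-\eta\nabla\widehat{\mathcal R}_S(X_k^S+\sigma\xi_k),\qquad X_0^S\sim\mu_0,$$ with $\eta,\sigma>0$ and $(\xi_k)_{k\in\mathbb N}$ i.i.d. $\mathcal N(0,I_d)$, $\xi_k$ independent of $X_k^S$. Assume that for all $z\in\mathcal Z$, $\ell(\cdot,z)\in\mathcal C^2(\mathbb R^d)$ is $\gamma$-strongly convex (with $\gamma>0$, $\gamma\eta<1$) and has Lipschitz gradient, and that $\ell(w,z)$ is $\Sigma^2$-subgaussian with respect to $z\sim\mu_z$. Let $\pi=\mathcal N\left(0,\frac{\sigma^2\gamma\eta}{2-\gamma\eta}I_d\right)$ and $\zeta\in(0,1)$. Then, with probability at least $1-\zeta$ over $S\sim\mu_z^{\otimes n}$, for all $T>0$, $$\mathbb E\left[G_S(Y_T^S)\mid S\right]\le\frac{2\Sigma}{\sqrt n}\left\{\int_0^Te^{-\eta\gamma(T-t)}\,\mathbb E_{\bar\rho_t^S}\left[2\Delta\widehat L_S+\frac1{\sigma^2}\|\nabla\widehat L_S\|^2\right]dt+K_T+\log\frac3\zeta\right\}^{1/2},$$ where $\widehat L_S(y)=\gamma^{-1}\widehat{\mathcal R}_S(y)-\|y\|^2/2$, $\Delta$ is the Laplacian, and $K_T=e^{-\gamma\eta T}\,\mathrm{KL}(\mu_0\|\pi)$.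
   Context: $(\mathcal Z,\mathcal F)$ is a measurable space with a probability measure $\mu_z$, $n\ge1$, $\ell:\mathbb R^d\times\mathcal Z\to\mathbb R_+$ is a loss. For $S=(z_1,\dots,z_n)\in\mathcal Z^n$: $\mathcal R(w)=\int\ell(w,z)\,d\mu_z(z)$, $\widehat{\mathcal R}_S(w)=\frac1n\sum_i\ell(w,z_i)$, $G_S=\mathcal R-\widehat{\mathcal R}_S$. The loss is $\Sigma^2$-subgaussian if for all $w\in\mathbb R^d$ and all $\lambda\in\mathbb R$, $\mathbb E_{Z\sim\mu_z}[e^{\lambda(\ell(w,Z)-\mathcal R(w))}]\le e^{\lambda^2\Sigma^2/2}$. $(N_t)_{t\ge0}$ is a Poisson process of intensity $1$ independent of all other random variables; $Y_t^S:=X_{N_t}^S$, $\rho_t^S$ is the law of $Y_t^S$ given $S$, and $\bar\rho_t^S:=\rho_t^S\ast\mathcal N(0,\sigma^2I_d)$. The initial law $\mu_0$ does not depend on $S$ and it is assumed that $\mu_0\ll\pi$. *)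

theory Defs
  imports "HOL-Probability.Probability"
begin

section \<open>Calculus\<close>

definition grad :: "('a::real_inner \<Rightarrow> real) \<Rightarrow> 'a \<Rightarrow> 'a" where
  "grad f x = (THE D. GDERIV f x :> D)"

definition laplacian :: "('a::euclidean_space \<Rightarrow> real) \<Rightarrow> 'a \<Rightarrow> real" where
  "laplacian f x = (\<Sum>b\<in>Basis. (deriv ^^ 2) (\<lambda>t. f (x + t *\<^sub>R b)) 0)"

definition C2 :: "('a::euclidean_space \<Rightarrow> real) \<Rightarrow> bool" where
  "C2 f \<longleftrightarrow> (\<forall>x. f differentiable (at x)) \<and>
    (\<exists>H :: 'a \<Rightarrow> 'a \<Rightarrow>\<^sub>L 'a.
      (\<forall>x. (grad f has_derivative blinfun_apply (H x)) (at x)) \<and> continuous_on UNIV H)"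

definition strongly_convex :: "real \<Rightarrow> ('a::real_inner \<Rightarrow> real) \<Rightarrow> bool" where
  "strongly_convex c f \<longleftrightarrow> (\<forall>x y. \<forall>t\<in>{0..1}.
    f ((1 - t) *\<^sub>R x + t *\<^sub>R y)
      \<le> (1 - t) * f x + t * f y - c / 2 * t * (1 - t) * (norm (x - y))\<^sup>2)"

text \<open>Square root on the extended reals, used only for nonnegative arguments.\<close>

definition ereal_sqrt :: "ereal \<Rightarrow> ereal" where
  "ereal_sqrt x = (if x = \<infinity> then \<infinity> else ereal (sqrt (real_of_ereal x)))"

section \<open>Probability\<close>

text \<open>The centred Gaussian with covariance \<open>v\<close> times the identity; the parameter \<open>v\<close> is the
  variance, whereas \<^const>\<open>normal_density\<close> takes a standard deviation.\<close>

definition gaussian :: "real \<Rightarrow> 'a::euclidean_space measure" where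
  "gaussian v = density lborel (\<lambda>x. ennreal (\<Prod>b\<in>Basis. normal_density 0 (sqrt v) (x \<bullet> b)))"

text \<open>\<open>kl \<mu> \<nu>\<close> is the divergence of \<open>\<mu>\<close> from \<open>\<nu>\<close>; note the argument order of
  \<^const>\<open>KL_divergence\<close>. For probability measures the negative part of the log-density is
  always integrable with respect to \<open>\<mu>\<close>, so that the absence of integrability means that the
  integral is infinite.\<close>

definition kl :: "'a measure \<Rightarrow> 'a measure \<Rightarrow> ereal" where
  "kl \<mu> \<nu> =
    (if absolutely_continuous \<nu> \<mu> \<and> integrable \<mu> (entropy_density (exp 1) \<nu> \<mu>)
     then ereal (KL_divergence (exp 1) \<nu> \<mu>) else \<infinity>)"

text \<open>\<^const>\<open>prob_space.indep_var\<close> only covers two random variables of the same type.\<close>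

definition (in prob_space) indep_rvs ::
    "'b measure \<Rightarrow> ('a \<Rightarrow> 'b) \<Rightarrow> 'c measure \<Rightarrow> ('a \<Rightarrow> 'c) \<Rightarrow> bool" where
  "indep_rvs A X B Y \<longleftrightarrow> random_variable A X \<and> random_variable B Y \<and>
    indep_set {X -` U \<inter> space M | U. U \<in> sets A} {Y -` V \<inter> space M | V. V \<in> sets B}"

text \<open>Subtraction in the increments is the one on natural numbers, which is harmless because the
  paths are almost surely nondecreasing. Independence of the increments along a nondecreasing
  sequence of times is, by definition, independence of all finite subfamilies.\<close>

definition (in prob_space) poisson_process :: "real \<Rightarrow> (real \<Rightarrow> 'a \<Rightarrow> nat) \<Rightarrow> bool" where
  "poisson_process r N \<longleftrightarrow>
    (\<forall>t\<ge>0. random_variable (count_space UNIV) (N t)) \<and>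
    (AE \<omega> in M. N 0 \<omega> = 0 \<and> mono_on {0..} (\<lambda>t. N t \<omega>) \<and>
       (\<forall>t\<ge>0. continuous (at_right t) (\<lambda>u. N u \<omega>))) \<and>
    (\<forall>\<tau> :: nat \<Rightarrow> real. 0 \<le> \<tau> 0 \<longrightarrow> mono \<tau> \<longrightarrow>
       indep_vars (\<lambda>_. count_space UNIV) (\<lambda>i \<omega>. N (\<tau> (Suc i)) \<omega> - N (\<tau> i) \<omega>) UNIV) \<and>
    (\<forall>s t. 0 \<le> s \<longrightarrow> s < t \<longrightarrow>
       distr M (count_space UNIV) (\<lambda>\<omega>. N t \<omega> - N s \<omega>) = measure_pmf (poisson_pmf (r * (t - s))))"

section \<open>Statistical learning\<close>

text \<open>A data set of size \<open>n\<close> is a function on \<open>{..<n}\<close>.\<close>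

definition risk :: "'z measure \<Rightarrow> ('a \<Rightarrow> 'z \<Rightarrow> real) \<Rightarrow> 'a \<Rightarrow> real" where
  "risk \<mu>z loss w = (\<integral>z. loss w z \<partial>\<mu>z)"

definition emp_risk :: "('a \<Rightarrow> 'z \<Rightarrow> real) \<Rightarrow> nat \<Rightarrow> (nat \<Rightarrow> 'z) \<Rightarrow> 'a \<Rightarrow> real" where
  "emp_risk loss n S w = 1 / real n * (\<Sum>i<n. loss w (S i))"

definition gen_gap ::
    "'z measure \<Rightarrow> ('a \<Rightarrow> 'z \<Rightarrow> real) \<Rightarrow> nat \<Rightarrow> (nat \<Rightarrow> 'z) \<Rightarrow> 'a \<Rightarrow> real" where
  "gen_gap \<mu>z loss n S w = risk \<mu>z loss w - emp_risk loss n S w"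

text \<open>The exponential moment is an extended nonnegative integral, so that the inequality includes
  its finiteness and, in particular, the integrability of \<open>loss w\<close>.\<close>

definition subgaussian :: "'z measure \<Rightarrow> ('a \<Rightarrow> 'z \<Rightarrow> real) \<Rightarrow> real \<Rightarrow> bool" where
  "subgaussian \<mu>z loss v \<longleftrightarrow> (\<forall>w. \<forall>s :: real.
    (\<integral>\<^sup>+z. ennreal (exp (s * (loss w z - risk \<mu>z loss w))) \<partial>\<mu>z) \<le> ennreal (exp (s\<^sup>2 * v / 2)))"

definition Lhat ::
    "('a::real_inner \<Rightarrow> 'z \<Rightarrow> real) \<Rightarrow> nat \<Rightarrow> real \<Rightarrow> (nat \<Rightarrow> 'z) \<Rightarrow> 'a \<Rightarrow> real" where
  "Lhat loss n \<gamma> S y = emp_risk loss n S y / \<gamma> - (norm y)\<^sup>2 / 2"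

section \<open>Nonnegativity of the Laplacian term\<close>

lemma GDERIV_grad:
  fixes f :: "'a::euclidean_space \<Rightarrow> real"
  assumes "f differentiable (at x)"
  shows "GDERIV f x :> grad f x"
proof -
  obtain f' where f': "(f has_derivative f') (at x)"
    using assms by (auto simp: differentiable_def)
  interpret linear f' using f' by (rule has_derivative_linear)
  have f'_eq: "f' h = h \<bullet> (\<Sum>b\<in>Basis. f' b *\<^sub>R b)" for h
  proof -
    have "f' h = f' (\<Sum>b\<in>Basis. (h \<bullet> b) *\<^sub>R b)" by (simp add: euclidean_representation)
    also have "\<dots> = (\<Sum>b\<in>Basis. (h \<bullet> b) * f' b)" by (simp add: sum scale)
    also have "\<dots> = h \<bullet> (\<Sum>b\<in>Basis. f' b *\<^sub>R b)" by (simp add: inner_sum_right mult.commute)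
    finally show ?thesis .
  qed
  have "GDERIV f x :> (\<Sum>b\<in>Basis. f' b *\<^sub>R b)"
    unfolding gderiv_def by (rule has_derivative_eq_rhs[OF f']) (rule ext, rule f'_eq)
  moreover have "D = D'" if "GDERIV f x :> D" "GDERIV f x :> D'" for D D'
  proof -
    have "(\<lambda>h. h \<bullet> D) = (\<lambda>h. h \<bullet> D')"
      using that unfolding gderiv_def by (rule has_derivative_unique)
    then have "(D - D') \<bullet> D = (D - D') \<bullet> D'" by metis
    then have "(D - D') \<bullet> (D - D') = 0" by (simp add: inner_diff_right)
    then show ?thesis by simp
  qed
  ultimately show ?thesis unfolding grad_def by (metis theI)
qed

lemma C2_on_line:
  fixes f :: "'a::euclidean_space \<Rightarrow> real"
  assumes "C2 f"
  obtains f1 f2 where "\<And>t. ((\<lambda>t. f (x + t *\<^sub>R b)) has_real_derivative f1 t) (at t)"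
    and "\<And>t. (f1 has_real_derivative f2 t) (at t)"
proof -
  from assms obtain H :: "'a \<Rightarrow> 'a \<Rightarrow>\<^sub>L 'a"
    where f: "\<And>x. f differentiable (at x)"
      and H: "\<And>x. (grad f has_derivative blinfun_apply (H x)) (at x)"
    unfolding C2_def by auto
  have line: "((\<lambda>t. x + t *\<^sub>R b) has_derivative (\<lambda>h. h *\<^sub>R b)) (at t)" for t
    by (auto intro!: derivative_eq_intros)
  have "((\<lambda>t. f (x + t *\<^sub>R b)) has_real_derivative b \<bullet> grad f (x + t *\<^sub>R b)) (at t)" for t
    unfolding has_field_derivative_def
    by (rule has_derivative_eq_rhs
        [OF has_derivative_compose[OF line[of t] GDERIV_grad[OF f, unfolded gderiv_def]]])
      (simp add: fun_eq_iff)
  moreover have "((\<lambda>t. b \<bullet> grad f (x + t *\<^sub>R b)) has_real_derivative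
      b \<bullet> blinfun_apply (H (x + t *\<^sub>R b)) b) (at t)" for t
    unfolding has_field_derivative_def
    by (rule has_derivative_eq_rhs
        [OF has_derivative_inner_right[OF has_derivative_compose[OF line[of t] H], of b]])
      (simp add: fun_eq_iff blinfun.scaleR_right)
  ultimately show ?thesis by (rule that)
qed

lemma second_deriv_nonneg:
  fixes g :: "real \<Rightarrow> real"
  assumes g1: "\<And>t. (g has_real_derivative g1 t) (at t)"
    and g2: "\<And>t. (g1 has_real_derivative g2 t) (at t)"
    and cvx: "convex_on UNIV g"
  shows "(deriv ^^ 2) g t \<ge> 0"
proof -
  have "g1 s \<le> g1 t" if "s \<le> t" for s t
  proof -
    have "g t - g s \<ge> g1 s * (t - s)" "g s - g t \<ge> g1 t * (s - t)"
      using g1 by (auto intro!: convex_on_imp_above_tangent[OF cvx])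
    then have "(g1 t - g1 s) * (t - s) \<ge> 0" by (simp add: algebra_simps)
    then show ?thesis using that by (cases "s = t") (auto simp: zero_le_mult_iff)
  qed
  then have "mono_on UNIV g1" by (auto simp: mono_on_def)
  then have "g2 t \<ge> 0" using g2 by (intro mono_on_imp_deriv_nonneg) auto
  moreover have "deriv g = g1" "deriv g1 = g2" using g1 g2 by (auto intro!: DERIV_imp_deriv)
  ultimately show ?thesis by (simp add: numeral_2_eq_2)
qed

text \<open>Hence the integrand of the bound is nonnegative, and its conversion to \<^typ>\<open>ennreal\<close> does not
  truncate it.\<close>

lemma laplacian_Lhat_nonneg:
  fixes loss :: "'a::euclidean_space \<Rightarrow> 'z \<Rightarrow> real"
  assumes "\<gamma> > 0" "n \<ge> 1"
    and C2: "\<And>i. i < n \<Longrightarrow> C2 (\<lambda>w. loss w (S i))"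
    and sc: "\<And>i. i < n \<Longrightarrow> strongly_convex \<gamma> (\<lambda>w. loss w (S i))"
  shows "laplacian (Lhat loss n \<gamma> S) y \<ge> 0"
  unfolding laplacian_def
proof (rule sum_nonneg)
  fix b :: 'a assume b: "b \<in> Basis"
  let ?h = "\<lambda>i t. loss (y + t *\<^sub>R b) (S i)"
  let ?q = "\<lambda>t. (norm (y + t *\<^sub>R b))\<^sup>2"
  let ?g = "\<lambda>t. Lhat loss n \<gamma> S (y + t *\<^sub>R b)"
  have "\<exists>f1 f2. (\<forall>t. (?h i has_real_derivative f1 t) (at t)) \<and>
      (\<forall>t. (f1 has_real_derivative f2 t) (at t))" if "i < n" for i
    using C2_on_line[OF C2[OF that], of y b] by metis
  then obtain f1 f2
    where f1: "\<And>i t. i < n \<Longrightarrow> (?h i has_real_derivative f1 i t) (at t)"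
      and f2: "\<And>i t. i < n \<Longrightarrow> (f1 i has_real_derivative f2 i t) (at t)" by metis
  have q: "?q t = (norm y)\<^sup>2 + 2 * t * (y \<bullet> b) + t\<^sup>2" for t
    using b unfolding power2_norm_eq_inner
    by (simp add: inner_simps inner_commute[of b y] power2_eq_square algebra_simps)
  have g: "?g = (\<lambda>t. (1 / real n * (\<Sum>i<n. ?h i t)) / \<gamma> - ?q t / 2)"
    by (simp add: Lhat_def emp_risk_def fun_eq_iff)
  let ?g1 = "\<lambda>t. (1 / real n * (\<Sum>i<n. f1 i t)) / \<gamma> - (y \<bullet> b + t)"
  let ?g2 = "\<lambda>t. (1 / real n * (\<Sum>i<n. f2 i t)) / \<gamma> - 1"
  show "(deriv ^^ 2) ?g 0 \<ge> 0"
  proof (rule second_deriv_nonneg)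
    show "(?g has_real_derivative ?g1 t) (at t)" for t
    proof -
      have "((\<lambda>t. \<Sum>i<n. ?h i t) has_real_derivative (\<Sum>i<n. f1 i t)) (at t)"
        by (intro DERIV_sum f1) auto
      then have "((\<lambda>t. (1 / real n * (\<Sum>i<n. ?h i t)) / \<gamma>) has_real_derivative
          (1 / real n * (\<Sum>i<n. f1 i t)) / \<gamma>) (at t)"
        by (intro DERIV_cdivide DERIV_cmult)
      moreover have "((\<lambda>t. ((norm y)\<^sup>2 + 2 * t * (y \<bullet> b) + t\<^sup>2) / 2) has_real_derivative
          (y \<bullet> b + t)) (at t)"
        by (auto intro!: derivative_eq_intros)
      ultimately show ?thesis unfolding g q by (rule DERIV_diff)
    qed
    show "(?g1 has_real_derivative ?g2 t) (at t)" for t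
      using assms(1,2) by (auto intro!: derivative_eq_intros f2)
    show "convex_on UNIV ?g"
    proof (rule convex_onI)
      fix r s t :: real assume t: "0 < t" "t < 1"
      let ?m = "(1 - t) * r + t * s"
      have avg: "((1 - t) * p + t * q - n * (\<gamma> / 2 * t * (1 - t) * e)) / (n * \<gamma>)
          = (1 - t) * (p / (n * \<gamma>)) + t * (q / (n * \<gamma>)) - 1 / 2 * t * (1 - t) * e" for p q e
        using assms(1,2) by (simp add: field_simps)
      have "?h i ?m \<le> (1 - t) * ?h i r + t * ?h i s - \<gamma> / 2 * t * (1 - t) * (r - s)\<^sup>2" if "i < n" for i
      proof -
        have "(1 - t) *\<^sub>R (y + r *\<^sub>R b) + t *\<^sub>R (y + s *\<^sub>R b) = y + ?m *\<^sub>R b"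
          by (simp add: algebra_simps)
        moreover have "norm ((y + r *\<^sub>R b) - (y + s *\<^sub>R b)) = \<bar>r - s\<bar>"
          using b by (simp flip: scaleR_left_diff_distrib)
        ultimately show ?thesis
          using sc[OF that, unfolded strongly_convex_def, rule_format, of t "y + r *\<^sub>R b" "y + s *\<^sub>R b"] t
          by simp
      qed
      then have "(\<Sum>i<n. ?h i ?m) \<le>
          (\<Sum>i<n. (1 - t) * ?h i r + t * ?h i s - \<gamma> / 2 * t * (1 - t) * (r - s)\<^sup>2)"
        by (intro sum_mono) auto
      also have "\<dots> = (1 - t) * (\<Sum>i<n. ?h i r) + t * (\<Sum>i<n. ?h i s)
          - n * (\<gamma> / 2 * t * (1 - t) * (r - s)\<^sup>2)"
        by (simp add: sum.distrib sum_subtractf sum_distrib_left)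
      finally have "(\<Sum>i<n. ?h i ?m) / (n * \<gamma>) \<le> ((1 - t) * (\<Sum>i<n. ?h i r) + t * (\<Sum>i<n. ?h i s)
          - n * (\<gamma> / 2 * t * (1 - t) * (r - s)\<^sup>2)) / (n * \<gamma>)"
        using assms by (intro divide_right_mono) auto
      also have "\<dots> = (1 - t) * ((\<Sum>i<n. ?h i r) / (n * \<gamma>)) + t * ((\<Sum>i<n. ?h i s) / (n * \<gamma>))
          - 1 / 2 * t * (1 - t) * (r - s)\<^sup>2"
        by (rule avg)
      finally have H: "(\<Sum>i<n. ?h i ?m) / (n * \<gamma>) \<le> (1 - t) * ((\<Sum>i<n. ?h i r) / (n * \<gamma>))
          + t * ((\<Sum>i<n. ?h i s) / (n * \<gamma>)) - 1 / 2 * t * (1 - t) * (r - s)\<^sup>2" .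
      have g': "?g u = (\<Sum>i<n. ?h i u) / (n * \<gamma>) - ((norm y)\<^sup>2 + 2 * u * (y \<bullet> b) + u\<^sup>2) / 2" for u
        unfolding q[symmetric] by (simp add: Lhat_def emp_risk_def)
      have ineq: "am - (c + 2 * ((1 - t) * r + t * s) * d + ((1 - t) * r + t * s)\<^sup>2) / 2
          \<le> (1 - t) * (ar - (c + 2 * r * d + r\<^sup>2) / 2) + t * (as - (c + 2 * s * d + s\<^sup>2) / 2)"
        if "am \<le> (1 - t) * ar + t * as - 1 / 2 * t * (1 - t) * (r - s)\<^sup>2" for am ar as c d :: real
      proof -
        have "(1 - t) * (ar - (c + 2 * r * d + r\<^sup>2) / 2) + t * (as - (c + 2 * s * d + s\<^sup>2) / 2)
            - (am - (c + 2 * ((1 - t) * r + t * s) * d + ((1 - t) * r + t * s)\<^sup>2) / 2)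
            = (1 - t) * ar + t * as - 1 / 2 * t * (1 - t) * (r - s)\<^sup>2 - am"
          by (simp add: field_simps power2_eq_square)
        then show ?thesis using that by linarith
      qed
      have "?g ?m \<le> (1 - t) * ?g r + t * ?g s"
        unfolding g' by (rule ineq[OF H])
      then show "?g ((1 - t) *\<^sub>R r + t *\<^sub>R s) \<le> (1 - t) * ?g r + t * ?g s"
        by (simp only: real_scaleR_def)
    qed simp
  qed
qed

end

theory Submission
  imports Defs
begin

text \<open>
  Write \<open>\<alpha> = \<gamma> \<eta>\<close>, \<open>r = 1 - \<alpha>\<close>, \<open>V = \<nabla>L\<close>, so that a step is \<open>x \<mapsto> r x - \<alpha> (y + V (x + y))\<close> with Gaussian
  \<open>y\<close>. For \<open>V = 0\<close> this is an autoregression which preserves \<open>\<pi>\<close>. As \<open>L\<close> is convex, \<open>y \<mapsto> y + V (x + y)\<close> is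
  expanding, so that a change of variables and Stein's identity bound the relative entropy of its law
  with respect to that of \<open>y\<close> by the expectation of \<open>\<Delta>L + \<parallel>\<nabla>L\<parallel>\<^sup>2 / (2 \<sigma>\<^sup>2)\<close>. Hypercontractivity of the
  autoregression from \<open>L\<^sup>p\<close> to its dual, for \<open>p = 1 + r\<close>, combines this with the entropy of the state: one
  step maps an entropy bound \<open>B\<close> to \<open>r B + J\<close>, where \<open>J\<close> is the integral of \<open>2 \<Delta>L + \<parallel>\<nabla>L\<parallel>\<^sup>2 / \<sigma>\<^sup>2\<close>. Averaging
  this recursion over a Poisson number of steps gives exactly the time integral of the theorem.
  Entropy bounds are used in Donsker--Varadhan form, and applied to the square of the generalization
  gap, whose exponential moment under \<open>\<pi>\<close> is controlled with high probability by subgaussianity.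
\<close>

section \<open>Gaussian measures\<close>

text \<open>The exponent \<open>p = 1 + r\<close> fixes the constants. For general \<open>p\<close>
  the entropy of the noise would be weighted by \<open>p\<close> and that of the state by
  \<open>p / q\<close>, where \<open>q - 1 = (p - 1) / r\<^sup>2\<close> is the limit of
  hypercontractivity: \<open>p = 1\<close> gives no contraction, whereas \<open>p = 1 + r\<close>
  gives the weights \<open>1 + r \<le> 2\<close> and \<open>r\<close>. The bound 2 is the factor by
  which \<open>J\<close> exceeds twice-halved energy in the overview, and
  \<open>r = 1 - \<alpha>\<close> is what a Poisson number of steps turns into an exponential decay
  of rate \<open>\<alpha>\<close>. The laws of the iterates come with no density and no a priori
  finite entropy. Using the square of the gap as test function leaves no parameter to optimise, and
  the event of high probability involves \<open>\<pi>\<close> alone. This is why a single event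
  serves all \<open>T\<close>.\<close>

lemma prod_normal_density:
  fixes x :: "'a::euclidean_space"
  assumes "v > 0"
  shows "(\<Prod>b\<in>Basis. normal_density 0 (sqrt v) (x \<bullet> b))
    = (1 / sqrt (2 * pi * v)) ^ DIM('a) * exp (- (norm x)\<^sup>2 / (2 * v))"
proof -
  have "(\<Prod>b\<in>Basis. normal_density 0 (sqrt v) (x \<bullet> b))
      = (\<Prod>b\<in>(Basis::'a set). 1 / sqrt (2 * pi * v)) * (\<Prod>b\<in>Basis. exp (- (x \<bullet> b)\<^sup>2 / (2 * v)))"
    using assms unfolding prod.distrib[symmetric] by (simp add: normal_density_def)
  also have "(\<Prod>b\<in>Basis. exp (- (x \<bullet> b)\<^sup>2 / (2 * v))) = exp (- (norm x)\<^sup>2 / (2 * v))"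
  proof -
    have "(\<Sum>b\<in>Basis. - (x \<bullet> b)\<^sup>2 / (2 * v)) = - (norm x)\<^sup>2 / (2 * v)"
      unfolding power2_norm_eq_inner euclidean_inner[of x x]
      by (simp add: sum_divide_distrib[symmetric] sum_negf power2_eq_square)
    then show ?thesis by (metis exp_sum finite_Basis)
  qed
  finally show ?thesis by simp
qed

definition gaussian_density :: "real \<Rightarrow> 'a::euclidean_space \<Rightarrow> real" where
  "gaussian_density v x = (1 / sqrt (2 * pi * v)) ^ DIM('a) * exp (- (norm x)\<^sup>2 / (2 * v))"

lemma gaussian_density_prod: "v > 0 \<Longrightarrow> gaussian_density v x = (\<Prod>b\<in>Basis. normal_density 0 (sqrt v) (x \<bullet> b))"
  by (simp add: prod_normal_density gaussian_density_def)

lemma gaussian_density_pos: "v > 0 \<Longrightarrow> gaussian_density v x > 0"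
  by (simp add: gaussian_density_def)

lemma gaussian_density_nonneg: "v > 0 \<Longrightarrow> gaussian_density v x \<ge> 0"
  by (simp add: gaussian_density_def)

lemma continuous_on_gaussian_density: "v > 0 \<Longrightarrow> continuous_on UNIV (gaussian_density v)"
  unfolding gaussian_density_def by (intro continuous_intros) auto

lemma borel_measurable_gaussian_density [measurable]: "gaussian_density v \<in> borel_measurable borel"
  unfolding gaussian_density_def by measurable

lemma gaussian_eq: "v > 0 \<Longrightarrow> gaussian v = density lborel (\<lambda>x. ennreal (gaussian_density v x))"
  by (simp add: gaussian_def prod_normal_density gaussian_density_def)

lemma sets_gaussian [simp, measurable_cong]: "sets (gaussian v) = sets borel"
  by (simp add: gaussian_def)

lemma space_gaussian [simp]: "space (gaussian v) = UNIV"
  by (simp add: gaussian_def)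

lemma prob_space_gaussian:
  assumes "v > 0" shows "prob_space (gaussian v :: 'a::euclidean_space measure)"
proof
  have "(\<integral>\<^sup>+x. (\<Prod>b\<in>Basis. ennreal (normal_density 0 (sqrt v) (x \<bullet> b))) \<partial>(lborel::'a measure))
      = (\<Prod>b\<in>(Basis::'a set). \<integral>\<^sup>+x. ennreal (normal_density 0 (sqrt v) x) \<partial>lborel)"
    by (rule nn_integral_lborel_prod) auto
  also have "\<dots> = 1"
    using prob_space.emeasure_space_1[OF prob_space_normal_density[of "sqrt v" 0]] assms
    by (simp add: emeasure_density)
  finally show "emeasure (gaussian v :: 'a measure) (space (gaussian v)) = 1"
    by (simp add: gaussian_def emeasure_density prod_ennreal)
qed

lemma nn_integral_gaussian:
  assumes "v > 0" and [measurable]: "f \<in> borel_measurable borel"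
  shows "(\<integral>\<^sup>+x. f x \<partial>gaussian v) = (\<integral>\<^sup>+x. ennreal (gaussian_density v x) * f x \<partial>lborel)"
  using assms by (simp add: gaussian_eq nn_integral_density)

lemma integral_gaussian:
  fixes f :: "'a::euclidean_space \<Rightarrow> real"
  assumes "v > 0" and [measurable]: "f \<in> borel_measurable borel"
  shows "(\<integral>x. f x \<partial>gaussian v) = (\<integral>x. gaussian_density v x * f x \<partial>lborel)"
  using assms by (subst gaussian_eq) (auto simp: integral_density gaussian_density_nonneg)

lemma integrable_gaussian_iff:
  fixes f :: "'a::euclidean_space \<Rightarrow> real"
  assumes "v > 0" and [measurable]: "f \<in> borel_measurable borel"
  shows "integrable (gaussian v) f \<longleftrightarrow> integrable lborel (\<lambda>x. gaussian_density v x * f x)"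
  using assms by (subst gaussian_eq) (auto simp: integrable_density gaussian_density_nonneg)

lemma gaussian_scale:
  assumes "v > 0" "c \<noteq> 0"
  shows "distr (gaussian v) borel (\<lambda>x. c *\<^sub>R x) = (gaussian (c\<^sup>2 * v) :: 'a::euclidean_space measure)"
proof (rule measure_eqI)
  fix A assume "A \<in> sets (distr (gaussian v) borel (\<lambda>x::'a. c *\<^sub>R x))"
  then have [measurable]: "A \<in> sets borel" by simp
  have v': "c\<^sup>2 * v > 0" using assms by simp
  have lb: "(lborel::'a measure) = density (distr lborel borel (\<lambda>x. 0 + c *\<^sub>R x)) (\<lambda>_. (\<bar>c\<bar>^DIM('a)))"
    using assms lborel_affine[of c "0::'a"] by simp
  have gdc: "\<bar>c\<bar>^DIM('a) * gaussian_density (c\<^sup>2 * v) (c *\<^sub>R x) = gaussian_density v x" for x :: 'a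
    using assms by (simp add: gaussian_density_def real_sqrt_mult power_mult_distrib power_divide)
  have "emeasure (gaussian (c\<^sup>2 * v)) A = (\<integral>\<^sup>+x. ennreal (gaussian_density (c\<^sup>2 * v) x) * indicator A x \<partial>lborel)"
    by (simp add: gaussian_eq[OF v'] emeasure_density)
  also have "\<dots> = (\<integral>\<^sup>+x. ennreal (\<bar>c\<bar>^DIM('a)) * (ennreal (gaussian_density (c\<^sup>2 * v) (c *\<^sub>R x)) * indicator A (c *\<^sub>R x)) \<partial>lborel)"
    by (subst lb) (simp add: nn_integral_density nn_integral_distr)
  also have "\<dots> = (\<integral>\<^sup>+x. ennreal (gaussian_density v x) * indicator A (c *\<^sub>R x) \<partial>lborel)"
    using gaussian_density_nonneg[OF v'] by (simp add: mult.assoc[symmetric] ennreal_mult'[symmetric] gdc)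
  also have "\<dots> = (\<integral>\<^sup>+x. ennreal (gaussian_density v x) * indicator ((\<lambda>x. c *\<^sub>R x) -` A) x \<partial>lborel)"
    by (simp add: indicator_vimage)
  also have "\<dots> = emeasure (distr (gaussian v) borel (\<lambda>x. c *\<^sub>R x)) A"
    using assms by (simp add: emeasure_distr gaussian_eq emeasure_density measurable_sets_borel[of "\<lambda>x. c *\<^sub>R x" borel])
  finally show "emeasure (distr (gaussian v) borel (\<lambda>x. c *\<^sub>R x)) A = emeasure (gaussian (c\<^sup>2 * v)) A" ..
qed simp

lemma nn_integral_lborel_shift:
  fixes f :: "'a::euclidean_space \<Rightarrow> ennreal"
  assumes [measurable]: "f \<in> borel_measurable borel"
  shows "(\<integral>\<^sup>+x. f (x + a) \<partial>lborel) = (\<integral>\<^sup>+x. f x \<partial>lborel)"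
  by (subst lborel_distr_plus[of a, symmetric]) (simp add: nn_integral_distr add.commute)

text \<open>The densities factor over coordinates, which reduces their convolution to the
  one-dimensional one. Nonnegative integrals avoid any integrability condition on
  \<open>f\<close>.\<close>

lemma nn_integral_gaussian_add:
  fixes f :: "'a::euclidean_space \<Rightarrow> ennreal"
  assumes st: "s > 0" "t > 0" and [measurable]: "f \<in> borel_measurable borel"
  shows "(\<integral>\<^sup>+x. \<integral>\<^sup>+y. f (x + y) \<partial>gaussian t \<partial>gaussian s) = (\<integral>\<^sup>+x. f x \<partial>gaussian (s + t))"
proof -
  have conv: "(\<integral>\<^sup>+y. ennreal (gaussian_density s y) * ennreal (gaussian_density t (z - y)) \<partial>lborel) = ennreal (gaussian_density (s + t) z)" for z :: 'a
  proof -
    have "(\<integral>\<^sup>+y. ennreal (gaussian_density s y) * ennreal (gaussian_density t (z - y)) \<partial>lborel)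
      = (\<integral>\<^sup>+y. (\<Prod>b\<in>(Basis::'a set). (\<lambda>u. ennreal (normal_density 0 (sqrt t) (z \<bullet> b - u) * normal_density 0 (sqrt s) u)) (y \<bullet> b)) \<partial>lborel)"
      using st by (intro nn_integral_cong)
        (simp add: gaussian_density_prod prod_ennreal prod.distrib inner_diff_left ennreal_mult'[symmetric] mult.commute prod_nonneg)
    also have "\<dots> = (\<Prod>b\<in>(Basis::'a set). \<integral>\<^sup>+u. ennreal (normal_density 0 (sqrt t) (z \<bullet> b - u) * normal_density 0 (sqrt s) u) \<partial>lborel)"
      by (rule nn_integral_lborel_prod) auto
    also have "\<dots> = (\<Prod>b\<in>(Basis::'a set). ennreal (normal_density 0 (sqrt (s + t)) (z \<bullet> b)))"
      using st conv_normal_density_zero_mean[of "sqrt t" "sqrt s"]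
      by (intro prod.cong refl) (simp add: fun_eq_iff add.commute)
    also have "\<dots> = ennreal (gaussian_density (s + t) z)"
      using st by (simp add: prod_ennreal gaussian_density_prod)
    finally show ?thesis .
  qed
  have "(\<integral>\<^sup>+x. \<integral>\<^sup>+y. f (x + y) \<partial>gaussian t \<partial>gaussian s)
      = (\<integral>\<^sup>+x. ennreal (gaussian_density s x) * (\<integral>\<^sup>+y. ennreal (gaussian_density t y) * f (x + y) \<partial>lborel) \<partial>lborel)"
    using st by (simp add: nn_integral_gaussian gaussian_eq nn_integral_density)
  also have "\<dots> = (\<integral>\<^sup>+x. ennreal (gaussian_density s x) * (\<integral>\<^sup>+y. ennreal (gaussian_density t (y - x)) * f y \<partial>lborel) \<partial>lborel)"
  proof -
    have "(\<integral>\<^sup>+y. ennreal (gaussian_density t y) * f (x + y) \<partial>lborel) = (\<integral>\<^sup>+y. ennreal (gaussian_density t (y - x)) * f y \<partial>lborel)" for x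
      using nn_integral_lborel_shift[of "\<lambda>y. ennreal (gaussian_density t (y - x)) * f y" x] by (simp add: add.commute)
    then show ?thesis by simp
  qed
  also have "\<dots> = (\<integral>\<^sup>+x. (\<integral>\<^sup>+y. ennreal (gaussian_density s x) * ennreal (gaussian_density t (y - x)) * f y \<partial>lborel) \<partial>lborel)"
    by (simp add: nn_integral_cmult[symmetric] mult.assoc)
  also have "\<dots> = (\<integral>\<^sup>+y. (\<integral>\<^sup>+x. ennreal (gaussian_density s x) * ennreal (gaussian_density t (y - x)) * f y \<partial>lborel) \<partial>lborel)"
    by (rule lborel_pair.Fubini') measurable
  also have "\<dots> = (\<integral>\<^sup>+y. ennreal (gaussian_density (s + t) y) * f y \<partial>lborel)"
    by (simp add: nn_integral_multc conv)
  also have "\<dots> = (\<integral>\<^sup>+x. f x \<partial>gaussian (s + t))"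
    using st by (simp add: nn_integral_gaussian)
  finally show ?thesis .
qed

text \<open>The heat flow behind hypercontractivity runs on pairs, so the Gaussian of the product
  type is integrated there; iterated integrals need it as a product measure.\<close>

lemma gaussian_pair:
  assumes v: "v > 0"
  shows "(gaussian v :: ('a::euclidean_space \<times> 'b::euclidean_space) measure) = gaussian v \<Otimes>\<^sub>M gaussian v"
proof -
  have "(gaussian v \<Otimes>\<^sub>M gaussian v :: ('a \<times> 'b) measure)
      = density (lborel \<Otimes>\<^sub>M lborel) (\<lambda>(x, y). ennreal (gaussian_density v x) * ennreal (gaussian_density v y))"
    unfolding gaussian_eq[OF v]
    using prob_space_gaussian[OF v, where 'a = 'b] unfolding gaussian_eq[OF v]
    by (intro pair_measure_density) (auto intro: prob_space_imp_sigma_finite sigma_finite_lborel)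
  also have "\<dots> = density lborel (\<lambda>x. ennreal (gaussian_density v x))"
  proof -
    have "exp (- (norm (x, y))\<^sup>2 / (2 * v)) = exp (- (norm x)\<^sup>2 / (2 * v)) * exp (- (norm y)\<^sup>2 / (2 * v))"
      for x :: 'a and y :: 'b
      by (simp add: norm_Pair add_divide_distrib exp_add[symmetric] diff_divide_distrib)
    then have "gaussian_density v (x, y) = gaussian_density v x * gaussian_density v y" for x :: 'a and y :: 'b
      by (simp add: gaussian_density_def power_add mult_ac)
    then have "(\<lambda>(x, y). ennreal (gaussian_density v x) * ennreal (gaussian_density v y)) = (\<lambda>x::'a \<times> 'b. ennreal (gaussian_density v x))"
      by (auto simp: fun_eq_iff ennreal_mult' gaussian_density_nonneg v)
    then show ?thesis by (simp add: lborel_prod)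
  qed
  finally show ?thesis by (simp add: gaussian_eq v)
qed


section \<open>Integrability under Gaussian measures and Stein's identity\<close>

lemma
  fixes f :: "'a::euclidean_space \<Rightarrow> 'b::{banach, second_countable_topology}"
  assumes [measurable]: "f \<in> borel_measurable borel"
  shows integral_lborel_shift: "(\<integral>x. f (x + a) \<partial>lborel) = (\<integral>x. f x \<partial>lborel)"
    and integrable_lborel_shift: "integrable lborel (\<lambda>x. f (x + a)) \<longleftrightarrow> integrable lborel f"
   apply (subst (2) lborel_distr_plus[of a, symmetric], simp add: integral_distr add.commute)
  apply (subst (2) lborel_distr_plus[of a, symmetric], simp add: integrable_distr_eq add.commute)
  done

text \<open>Completing the square. The coefficient \<open>1 / (4 * v)\<close> is half of that in the
  Gaussian exponent, so that this factor turns variance \<open>v\<close> into variance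
  \<open>2 * v\<close> and leaves something integrable.\<close>

lemma exp_linear_le_exp_square:
  fixes b r v :: real
  assumes "v > 0"
  shows "exp (b * r) \<le> exp (b\<^sup>2 * v) * exp (r\<^sup>2 / (4 * v))"
proof -
  have "0 \<le> (b * sqrt v - r / (2 * sqrt v))\<^sup>2" by simp
  also have "\<dots> = b\<^sup>2 * v - b * r + r\<^sup>2 / (4 * v)"
    using assms by (simp add: power2_diff power_mult_distrib power_divide)
  finally show ?thesis by (simp add: exp_add[symmetric])
qed

lemma integrable_gaussian_exp:
  assumes v: "v > 0"
  shows "integrable (gaussian v) (\<lambda>x::'a::euclidean_space. exp (b * norm x))"
proof -
  have v2: "2 * v > 0" using v by simp
  have eq: "gaussian_density v x * exp ((norm x)\<^sup>2 / (4 * v)) = sqrt 2 ^ DIM('a) * gaussian_density (2 * v) x" for x :: 'a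
  proof -
    have "exp (- (norm x)\<^sup>2 / (2 * v)) * exp ((norm x)\<^sup>2 / (4 * v)) = exp (- (norm x)\<^sup>2 / (4 * v))"
      by (simp add: exp_add[symmetric] field_simps)
    moreover have "(1 / sqrt (2 * pi * v)) ^ DIM('a) = sqrt 2 ^ DIM('a) * (1 / sqrt (2 * pi * (2 * v))) ^ DIM('a)"
    proof -
      have "sqrt (2 * pi * (2 * v)) = sqrt 2 * sqrt (2 * pi * v)"
        unfolding real_sqrt_mult[symmetric] by (simp add: mult_ac)
      then show ?thesis by (simp add: power_mult_distrib[symmetric])
    qed
    ultimately show ?thesis by (simp add: gaussian_density_def mult.assoc)
  qed
  have "integrable (gaussian (2 * v)) (\<lambda>x::'a. 1::real)"
    using prob_space_gaussian[OF v2] by (auto intro: finite_measure.integrable_const simp: prob_space_def)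
  then have "integrable lborel (gaussian_density (2 * v) :: 'a \<Rightarrow> real)"
    using v2 by (simp add: integrable_gaussian_iff)
  then have int: "integrable lborel (\<lambda>x::'a. exp (b\<^sup>2 * v) * (sqrt 2 ^ DIM('a) * gaussian_density (2 * v) x))" by simp
  have "integrable lborel (\<lambda>x::'a. gaussian_density v x * exp (b * norm x))"
  proof (rule Bochner_Integration.integrable_bound[OF int])
    show "AE x in lborel. norm (gaussian_density v x * exp (b * norm x)) \<le> norm (exp (b\<^sup>2 * v) * (sqrt 2 ^ DIM('a) * gaussian_density (2 * v) (x::'a)))"
    proof (rule AE_I2)
      fix x :: 'a
      have "gaussian_density v x * exp (b * norm x) \<le> gaussian_density v x * (exp (b\<^sup>2 * v) * exp ((norm x)\<^sup>2 / (4 * v)))"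
        using gaussian_density_nonneg[OF v, of x] by (intro mult_left_mono exp_linear_le_exp_square v)
      also have "\<dots> = exp (b\<^sup>2 * v) * (sqrt 2 ^ DIM('a) * gaussian_density (2 * v) x)"
        unfolding eq[symmetric] by (simp only: mult_ac)
      finally show "norm (gaussian_density v x * exp (b * norm x)) \<le> norm (exp (b\<^sup>2 * v) * (sqrt 2 ^ DIM('a) * gaussian_density (2 * v) x))"
        using gaussian_density_nonneg[OF v, of x] gaussian_density_nonneg[OF v2, of x] by simp
    qed
  qed measurable
  then show ?thesis using v by (simp add: integrable_gaussian_iff)
qed

lemma integrable_gaussian_bound:
  fixes f :: "'a::euclidean_space \<Rightarrow> 'b::{banach, second_countable_topology}"
  assumes "v > 0" and [measurable]: "f \<in> borel_measurable borel"
    and "\<And>x. norm (f x) \<le> K * exp (b * norm x)"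
  shows "integrable (gaussian v) f"
proof (rule Bochner_Integration.integrable_bound)
  show "integrable (gaussian v) (\<lambda>x::'a. K * exp (b * norm x))"
    by (intro integrable_mult_right integrable_gaussian_exp assms(1))
  show "AE x in gaussian v. norm (f x) \<le> norm (K * exp (b * norm x))"
    using assms(3) by (auto intro!: AE_I2 order_trans[OF _ abs_ge_self] simp del: abs_mult)
qed simp

lemma power_le_exp:
  fixes r :: real
  shows "r \<ge> 0 \<Longrightarrow> (1 + r) ^ k \<le> exp (real k * r)"
  using power_mono[OF exp_ge_add_one_self[of r], of k] by (simp add: exp_of_nat_mult)

lemma integrable_gaussian_bound_power:
  fixes f :: "'a::euclidean_space \<Rightarrow> 'b::{banach, second_countable_topology}"
  assumes "v > 0" and "f \<in> borel_measurable borel"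
    and f: "\<And>x. norm (f x) \<le> K * (1 + norm x) ^ k" and K: "K \<ge> 0"
  shows "integrable (gaussian v) f"
  using assms(1,2)
proof (rule integrable_gaussian_bound)
  show "norm (f x) \<le> K * exp (real k * norm x)" for x
    using f[of x] mult_left_mono[OF power_le_exp[of "norm x" k] K] by simp
qed

text \<open>Stein's identity: the directional derivative of the Gaussian density times \<open>F\<close> has integral zero,
  since by translation invariance its integral over a unit step in direction \<open>e\<close> vanishes.\<close>

lemma gaussian_stein:
  fixes F F' :: "'a::euclidean_space \<Rightarrow> real"
  assumes v: "v > 0"
    and der: "\<And>x. ((\<lambda>t. F (x + t *\<^sub>R e)) has_real_derivative F' x) (at 0)"
    and cont: "continuous_on UNIV F" "continuous_on UNIV F'"
    and bnd: "\<And>x. \<bar>F x\<bar> \<le> K * exp (b * norm x)" "\<And>x. \<bar>F' x\<bar> \<le> K * exp (b * norm x)"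
  shows "(\<integral>x. (x \<bullet> e) * F x \<partial>gaussian v) = v * (\<integral>x. F' x \<partial>gaussian v)"
proof -
  have [measurable]: "F \<in> borel_measurable borel" "F' \<in> borel_measurable borel"
    using cont by (auto intro: borel_measurable_continuous_onI)
  have iF': "integrable (gaussian v) F'"
    using v bnd by (intro integrable_gaussian_bound[where K = K and b = b]) auto
  have ixF: "integrable (gaussian v) (\<lambda>x. (x \<bullet> e) * F x)"
  proof (rule integrable_gaussian_bound[where K = "norm e * K" and b = "1 + b"])
    fix x :: 'a
    have "norm ((x \<bullet> e) * F x) \<le> (norm x * norm e) * (K * exp (b * norm x))"
      using Cauchy_Schwarz_ineq2[of x e] bnd(1)[of x] by (auto simp: abs_mult intro!: mult_mono)
    also have "\<dots> \<le> (exp (norm x) * norm e) * (K * exp (b * norm x))"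
    proof (intro mult_right_mono)
      show "norm x \<le> exp (norm x)" using exp_ge_add_one_self[of "norm x"] by linarith
      show "0 \<le> K * exp (b * norm x)" using bnd(1)[of x] by linarith
    qed auto
    also have "\<dots> = norm e * K * exp ((1 + b) * norm x)"
      by (simp add: distrib_right exp_add)
    finally show "norm ((x \<bullet> e) * F x) \<le> norm e * K * exp ((1 + b) * norm x)" .
  qed (use v in auto)
  define G where "G x = gaussian_density v x * F x" for x
  \<comment> \<open>\<open>G'\<close> is the derivative of \<open>G\<close> along \<open>e\<close>;
    the term with \<open>(x \<bullet> e) / v\<close> comes from the logarithmic derivative of the
    density.\<close>
  define G' where "G' x = gaussian_density v x * (F' x - (x \<bullet> e) / v * F x)" for x
  have [measurable]: "G \<in> borel_measurable borel" "G' \<in> borel_measurable borel"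
    unfolding G_def G'_def by measurable
  have contG': "continuous_on UNIV G'"
    unfolding G'_def using v by (intro continuous_intros cont continuous_on_gaussian_density) auto
  have iG: "integrable lborel G"
    unfolding G_def using v bnd
    by (subst integrable_gaussian_iff[symmetric]) (auto intro!: integrable_gaussian_bound[where K = K and b = b])
  have "integrable (gaussian v) (\<lambda>x. F' x - (x \<bullet> e) * F x / v)"
    using iF' ixF by (intro Bochner_Integration.integrable_diff) auto
  then have iG': "integrable lborel G'"
    unfolding G'_def using v by (subst integrable_gaussian_iff[symmetric]) (auto simp: mult_ac)
  have derF: "((\<lambda>t. F (x + t *\<^sub>R e)) has_real_derivative F' (x + s *\<^sub>R e)) (at s)" for x s
    using DERIV_shift[of "\<lambda>t. F (x + t *\<^sub>R e)" "F' (x + s *\<^sub>R e)" 0 s] der[of "x + s *\<^sub>R e"]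
    by (simp add: algebra_simps)
  have derg: "((\<lambda>t. gaussian_density v (x + t *\<^sub>R e)) has_real_derivative - gaussian_density v (x + s *\<^sub>R e) * ((x + s *\<^sub>R e) \<bullet> e) / v) (at s)" for x s
    unfolding gaussian_density_def power2_norm_eq_inner using v
    by (auto intro!: derivative_eq_intros simp: inner_simps inner_commute field_simps)
  have derG: "((\<lambda>t. G (x + t *\<^sub>R e)) has_real_derivative G' (x + s *\<^sub>R e)) (at s)" for x s
    unfolding G_def
    by (rule DERIV_cong[OF DERIV_mult[OF derg derF]]) (simp add: G'_def right_diff_distrib mult_ac)
  have FTC: "(\<integral>s. G' (x + s *\<^sub>R e) * indicator {0..1} s \<partial>lborel) = G (x + e) - G x" for x
    using integral_FTC_Icc_real[of 0 1 "\<lambda>t. G (x + t *\<^sub>R e)" "\<lambda>t. G' (x + t *\<^sub>R e)"] derG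
      continuous_on_compose2[OF contG', of UNIV "\<lambda>s. x + s *\<^sub>R e"]
    by (auto simp: continuous_on_eq_continuous_at intro!: continuous_intros)
  let ?f = "\<lambda>(s::real, x). G' (x + s *\<^sub>R e) * indicator {0..1} s"
  have int: "integrable (lborel \<Otimes>\<^sub>M lborel) ?f"
  proof (rule lborel_pair.Fubini_integrable)
    have nn: "(\<integral>y. norm (?f (s, y)) \<partial>lborel) = (\<integral>y. norm (G' y) \<partial>lborel) * indicator {0..1} s" for s
      using integral_lborel_shift[of "\<lambda>y. norm (G' y)" "s *\<^sub>R e"] by (simp add: abs_mult)
    show "integrable lborel (\<lambda>s. \<integral>y. norm (?f (s, y)) \<partial>lborel)"
      unfolding nn by simp
    show "AE s in lborel. integrable lborel (\<lambda>y. ?f (s, y))"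
      using integrable_lborel_shift[of G'] iG' by auto
  qed measurable
  have "0 = (\<integral>x. G (x + e) - G x \<partial>lborel)"
    using iG integral_lborel_shift[of G e] integrable_lborel_shift[of G e] by simp
  also have "\<dots> = (\<integral>x. (\<integral>s. ?f (s, x) \<partial>lborel) \<partial>lborel)"
    by (simp add: FTC)
  also have "\<dots> = (\<integral>s. (\<integral>x. ?f (s, x) \<partial>lborel) \<partial>lborel)"
    using lborel_pair.Fubini_integral[of "\<lambda>s x. ?f (s, x)"] int by simp
  also have "\<dots> = (\<integral>s. (\<integral>x. G' x \<partial>lborel) * indicator {0..1} s \<partial>(lborel::real measure))"
    using integral_lborel_shift[of G'] by simp
  also have "\<dots> = (\<integral>x. G' x \<partial>lborel)" by simp
  also have "\<dots> = (\<integral>x. F' x - (x \<bullet> e) * F x / v \<partial>gaussian v)"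
    using v by (subst integral_gaussian) (auto simp: G'_def[abs_def])
  also have "\<dots> = (\<integral>x. F' x \<partial>gaussian v) - (\<integral>x. (x \<bullet> e) * F x \<partial>gaussian v) / v"
    using iF' ixF by simp
  finally show ?thesis using v by (simp add: field_simps)
qed

lemma gaussian_mean:
  assumes "v > 0"
  shows "(\<integral>x. x \<bullet> e \<partial>gaussian v) = 0"
  using gaussian_stein[OF assms, of "\<lambda>_. 1" e "\<lambda>_. 0" 1 0] by simp

lemma gaussian_covariance:
  assumes "v > 0"
  shows "(\<integral>x. (x \<bullet> e) * (x \<bullet> u) \<partial>gaussian v) = v * (e \<bullet> u)"
proof -
  interpret prob_space "gaussian v :: 'a measure" by (rule prob_space_gaussian[OF assms])
  have "\<bar>x \<bullet> u\<bar> \<le> norm u * exp (norm x)" for x :: 'a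
    using Cauchy_Schwarz_ineq2[of x u] exp_ge_add_one_self[of "norm x"]
    by (smt (verit, best) mult.commute mult_left_mono norm_ge_zero)
  moreover have "\<bar>e \<bullet> u\<bar> \<le> norm e * norm u" by (rule Cauchy_Schwarz_ineq2)
  ultimately have "(\<integral>x. (x \<bullet> e) * (x \<bullet> u) \<partial>gaussian v) = v * (\<integral>x. e \<bullet> u \<partial>(gaussian v :: 'a measure))"
    apply (intro gaussian_stein[where K = "norm u + norm e * norm u" and b = 1])
    subgoal by (rule assms)
    subgoal by (auto intro!: derivative_eq_intros simp: inner_simps)
    subgoal by (intro continuous_intros)
    subgoal by (intro continuous_intros)
    subgoal for x by (smt (verit) distrib_right mult_nonneg_nonneg norm_ge_zero exp_ge_zero)
    subgoal for x using mult_left_mono[of 1 "exp (norm x)" "norm e * norm u"]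
      by (smt (verit) distrib_right mult_nonneg_nonneg norm_ge_zero exp_ge_zero one_le_exp_iff mult_1 mult_cancel_left2)
    done
  then show ?thesis using prob_space by simp
qed

section \<open>Expanding maps and Lebesgue measure\<close>

lemma expanding_inj:
  assumes "\<And>x y. dist x y \<le> dist (T x) (T y)"
  shows "inj T"
proof (rule injI)
  fix x y assume "T x = T y"
  then have "dist x y \<le> 0" using assms[of x y] by simp
  then show "x = y" by simp
qed

text \<open>The range is open by invariance of domain. It is closed because an expanding map pulls
  Cauchy sequences back to Cauchy sequences. Connectedness of the space does the rest.\<close>

lemma expanding_surj:
  fixes T :: "'a::euclidean_space \<Rightarrow> 'a"
  assumes cont: "continuous_on UNIV T"
    and exp: "\<And>x y. dist x y \<le> dist (T x) (T y)"
  shows "surj T"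
proof -
  have "open (T ` UNIV)"
    by (rule invariance_of_domain[OF cont open_UNIV expanding_inj[OF exp]])
  moreover have "closed (range T)"
    unfolding closed_sequential_limits
  proof (intro allI impI, elim conjE)
    fix f l assume f: "\<forall>n. f n \<in> range T" "f \<longlonglongrightarrow> l"
    define g where "g n = inv T (f n)" for n
    have g: "f n = T (g n)" for n
      unfolding g_def using f(1) by (intro f_inv_into_f[symmetric]) auto
    have "Cauchy f" using f(2) by (rule LIMSEQ_imp_Cauchy)
    then have "Cauchy g"
      unfolding Cauchy_def g by (meson exp le_less_trans)
    then obtain a where "g \<longlonglongrightarrow> a"
      unfolding Cauchy_convergent_iff convergent_def by auto
    then have "(\<lambda>n. T (g n)) \<longlonglongrightarrow> T a"
      using cont by (intro continuous_on_tendsto_compose[OF cont]) auto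
    then have "T a = l" using f(2) LIMSEQ_unique unfolding g[symmetric] by blast
    then show "l \<in> range T" by auto
  qed
  ultimately show "surj T"
    using clopen[of "range T"] by auto
qed

text \<open>The inverse is 1-Lipschitz and so should not increase volume. For balls this is
  immediate, and balls suffice: by Vitali's theorem disjoint balls exhaust an open set up to a null
  set, and outer regularity passes to Borel sets. The lemma stands for a Jacobian determinant that
  is at least 1, without differentiating \<open>T\<close>.\<close>

lemma emeasure_expanding_vimage_le:
  fixes T :: "'a::euclidean_space \<Rightarrow> 'a"
  assumes cont: "continuous_on UNIV T"
    and exp: "\<And>x y. dist x y \<le> dist (T x) (T y)"
    and B: "B \<in> sets borel"
  shows "emeasure lborel (T -` B) \<le> emeasure lborel B"
proof -
  have [measurable]: "T \<in> borel_measurable borel"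
    using cont by (rule borel_measurable_continuous_onI)
  define g where "g = inv T"
  have gT: "g (T x) = x" for x
    unfolding g_def by (rule inv_f_f[OF expanding_inj[OF exp]])
  have Tg: "T (g y) = y" for y
    unfolding g_def using expanding_surj[OF cont exp] by (simp add: surj_f_inv_f)
  have lip: "norm (g x - g y) \<le> norm (x - y)" for x y
    using exp[of "g x" "g y"] by (simp add: Tg dist_norm)
  have opn: "emeasure lborel (T -` U) \<le> emeasure lborel U" if U: "open U" for U
  proof -
    define K where "K = {(c, r). r > 0 \<and> ball c r \<subseteq> U}"
    obtain C where C: "countable C" "C \<subseteq> K"
        and disj: "pairwise (\<lambda>i j. disjnt (ball (fst i) (snd i)) (ball (fst j) (snd j))) C"
        and neg: "negligible (U - (\<Union>i\<in>C. ball (fst i) (snd i)))"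
    proof (rule Vitali_covering_theorem_balls[of U K fst snd])
      fix x and d :: real assume "x \<in> U" "0 < d"
      then obtain e where e: "e > 0" "ball x e \<subseteq> U" using U openE by blast
      have "ball x (min e (d/2)) \<subseteq> ball x e" by (intro subset_ball) simp
      then show "\<exists>i. i \<in> K \<and> x \<in> ball (fst i) (snd i) \<and> snd i < d"
        using e \<open>0 < d\<close> by (intro exI[of _ "(x, min e (d/2))"]) (auto simp: K_def)
    qed
    define N where "N = U - (\<Union>i\<in>C. ball (fst i) (snd i))"
    have [measurable]: "N \<in> sets borel"
      unfolding N_def using U C by (intro sets.Diff sets.countable_UN') auto
    \<comment> \<open>Preimages under \<open>T\<close> are images under its Lipschitz inverse, and
      these preserve null sets.\<close>
    have "negligible (g ` N)"
      using neg[folded N_def] lip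
      by (intro negligible_locally_Lipschitz_image) (auto intro!: exI[of _ UNIV] exI[of _ 1])
    moreover have gN: "g ` N = T -` N"
    proof (intro set_eqI iffI)
      fix x assume "x \<in> T -` N"
      then have "g (T x) \<in> g ` N" by auto
      then show "x \<in> g ` N" by (simp add: gT)
    qed (auto simp: Tg)
    ultimately have null: "emeasure lborel (T -` N) = 0"
      by (simp add: negligible_iff_emeasure0 measurable_sets_borel[of T borel] sets_completionI_sets)
    have "T -` U \<subseteq> T -` N \<union> (\<Union>i\<in>C. T -` ball (fst i) (snd i))"
      by (auto simp: N_def)
    then have "emeasure lborel (T -` U) \<le> emeasure lborel (T -` N \<union> (\<Union>i\<in>C. T -` ball (fst i) (snd i)))"
      using C by (intro emeasure_mono) (auto intro!: sets.Un sets.countable_UN' measurable_sets_borel[of T borel])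
    also have "\<dots> \<le> emeasure lborel (T -` N) + emeasure lborel (\<Union>i\<in>C. T -` ball (fst i) (snd i))"
      using C by (intro emeasure_subadditive) (auto intro!: sets.countable_UN' measurable_sets_borel[of T borel])
    also have "\<dots> = emeasure lborel (\<Union>i\<in>C. T -` ball (fst i) (snd i))"
      by (simp add: null)
    also have "\<dots> = (\<integral>\<^sup>+i. emeasure lborel (T -` ball (fst i) (snd i)) \<partial>count_space C)"
    proof (rule emeasure_UN_countable)
      have "T -` ball (fst i) (snd i) \<inter> T -` ball (fst j) (snd j) = {}" if "i \<in> C" "j \<in> C" "i \<noteq> j" for i j
        using pairwiseD[OF disj that] by (auto simp: disjnt_def)
      then show "disjoint_family_on (\<lambda>i. T -` ball (fst i) (snd i)) C"
        unfolding disjoint_family_on_def by blast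
    qed (use C in \<open>auto intro!: measurable_sets_borel[of T borel]\<close>)
    also have "\<dots> \<le> (\<integral>\<^sup>+i. emeasure lborel (ball (fst i) (snd i)) \<partial>count_space C)"
    proof (rule nn_integral_mono)
      fix i
      \<comment> \<open>Expansion keeps the preimage of a ball within the ball of the same radius
        about the preimage of the centre.\<close>
      have "T -` ball (fst i) (snd i) \<subseteq> ball (g (fst i)) (snd i)"
      proof
        fix x assume "x \<in> T -` ball (fst i) (snd i)"
        then have "dist (T (g (fst i))) (T x) < snd i" by (simp add: Tg)
        then show "x \<in> ball (g (fst i)) (snd i)" using exp[of "g (fst i)" x] by simp
      qed
      then have "emeasure lborel (T -` ball (fst i) (snd i)) \<le> emeasure lborel (ball (g (fst i)) (snd i))"
        by (intro emeasure_mono) auto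
      also have "\<dots> = emeasure lborel (ball (fst i) (snd i))"
        by (cases "snd i \<ge> 0") (simp_all add: emeasure_ball ball_empty)
      finally show "emeasure lborel (T -` ball (fst i) (snd i)) \<le> emeasure lborel (ball (fst i) (snd i))" .
    qed
    also have "\<dots> = emeasure lborel (\<Union>i\<in>C. ball (fst i) (snd i))"
    proof (rule emeasure_UN_countable[symmetric])
      show "disjoint_family_on (\<lambda>i. ball (fst i) (snd i)) C"
        unfolding disjoint_family_on_def using pairwiseD[OF disj] unfolding disjnt_def by blast
    qed (use C in auto)
    also have "\<dots> \<le> emeasure lborel U"
    proof (intro emeasure_mono UN_least)
      fix i assume "i \<in> C"
      then show "ball (fst i) (snd i) \<subseteq> U" using C(2) unfolding K_def case_prod_beta by blast
    qed (use U in simp)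
    finally show ?thesis .
  qed
  show ?thesis
  proof (rule ennreal_le_epsilon)
    fix e :: real assume "0 < e"
    then obtain U where U: "open U" "B \<subseteq> U" "emeasure lborel (U - B) < e"
      using outer_regular_lborel[OF B] by blast
    have "emeasure lborel (T -` B) \<le> emeasure lborel (T -` U)"
      using U by (intro emeasure_mono) (auto intro!: measurable_sets_borel[of T borel])
    also have "\<dots> \<le> emeasure lborel U" by (rule opn[OF U(1)])
    also have "\<dots> = emeasure lborel (B \<union> (U - B))" using U by (simp add: Un_absorb1)
    also have "\<dots> \<le> emeasure lborel B + emeasure lborel (U - B)"
      using B U by (intro emeasure_subadditive) auto
    also have "\<dots> \<le> emeasure lborel B + e" using U by (intro add_left_mono) simp
    finally show "emeasure lborel (T -` B) \<le> emeasure lborel B + ennreal e" .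
  qed
qed

lemma nn_integral_expanding_le:
  fixes T :: "'a::euclidean_space \<Rightarrow> 'a"
  assumes cont: "continuous_on UNIV T"
    and exp: "\<And>x y. dist x y \<le> dist (T x) (T y)"
    and [measurable]: "f \<in> borel_measurable borel"
  shows "(\<integral>\<^sup>+x. f (T x) \<partial>lborel) \<le> (\<integral>\<^sup>+x. f x \<partial>lborel)"
proof -
  have [measurable]: "T \<in> borel_measurable borel"
    using cont by (rule borel_measurable_continuous_onI)
  have "(\<integral>\<^sup>+x. f (T x) \<partial>lborel) = (\<integral>\<^sup>+x. f x \<partial>distr lborel borel T)"
    by (simp add: nn_integral_distr)
  also have "\<dots> \<le> (\<integral>\<^sup>+x. f x \<partial>lborel)"
    using emeasure_expanding_vimage_le[OF cont exp]
    by (intro nn_integral_mono_measure) (auto simp: le_fun_def le_measure emeasure_distr)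
  finally show ?thesis .
qed

section \<open>Gaussian hypercontractivity\<close>

lemma distr_gaussian_add:
  assumes "s > 0" "t > 0"
  shows "distr (gaussian s \<Otimes>\<^sub>M gaussian t) borel (\<lambda>(x, y). x + y) = (gaussian (s + t) :: 'a::euclidean_space measure)"
proof (rule measure_eqI)
  interpret gt: prob_space "gaussian t :: 'a measure" by (rule prob_space_gaussian) fact
  fix A assume "A \<in> sets (distr (gaussian s \<Otimes>\<^sub>M gaussian t) borel (\<lambda>(x, y). x + y :: 'a))"
  then have [measurable]: "A \<in> sets borel" by simp
  have "emeasure (distr (gaussian s \<Otimes>\<^sub>M gaussian t) borel (\<lambda>(x, y). x + y :: 'a)) A
      = (\<integral>\<^sup>+x. indicator A x \<partial>distr (gaussian s \<Otimes>\<^sub>M gaussian t) borel (\<lambda>(x, y). x + y :: 'a))"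
    by simp
  also have "\<dots> = (\<integral>\<^sup>+x. \<integral>\<^sup>+y. indicator A (x + y) \<partial>gaussian t \<partial>gaussian s)"
    by (subst nn_integral_distr) (auto simp: gt.nn_integral_fst[symmetric] case_prod_beta)
  also have "\<dots> = emeasure (gaussian (s + t)) A"
    using assms by (subst nn_integral_gaussian_add) auto
  finally show "emeasure (distr (gaussian s \<Otimes>\<^sub>M gaussian t) borel (\<lambda>(x, y). x + y :: 'a)) A = emeasure (gaussian (s + t)) A" .
qed simp

text \<open>The heat semigroup. Scaling a fixed Gaussian, instead of integrating against
  \<open>gaussian t\<close>, gives the right value at \<open>t = 0\<close> and keeps the dependence
  on \<open>t\<close> inside the integrand.\<close>

definition smooth :: "real \<Rightarrow> ('a::euclidean_space \<Rightarrow> real) \<Rightarrow> 'a \<Rightarrow> real" where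
  "smooth t H p = (\<integral>q. H (p + sqrt t *\<^sub>R q) \<partial>gaussian 1)"

lemma prob_gaussian1: "prob_space (gaussian 1)"
  by (rule prob_space_gaussian) simp

lemma smooth_0: "smooth 0 H p = H p"
  using prob_space.prob_space[OF prob_gaussian1, where 'a1 = 'a] by (simp add: smooth_def)

lemma smooth_gaussian:
  assumes "t > 0" and [measurable]: "H \<in> borel_measurable borel"
  shows "smooth t H p = (\<integral>y. H (p + y) \<partial>gaussian t)"
proof -
  have "(\<integral>y. H (p + y) \<partial>gaussian t) = (\<integral>y. H (p + y) \<partial>distr (gaussian 1) borel (\<lambda>q. sqrt t *\<^sub>R q))"
    using assms(1) gaussian_scale[of 1 "sqrt t", where 'a = 'a] by simp
  then show ?thesis by (simp add: smooth_def integral_distr)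
qed

lemma borel_measurable_smooth [measurable]:
  assumes [measurable]: "H \<in> borel_measurable borel"
  shows "smooth t H \<in> borel_measurable borel"
proof -
  interpret prob_space "gaussian 1 :: 'a measure" by (rule prob_gaussian1)
  show ?thesis unfolding smooth_def by measurable
qed

lemma integrable_gaussian_bounded:
  fixes H :: "'a::euclidean_space \<Rightarrow> real"
  assumes "v > 0" and [measurable]: "H \<in> borel_measurable borel" and "\<And>x. \<bar>H x\<bar> \<le> B"
  shows "integrable (gaussian v) H"
proof -
  interpret prob_space "gaussian v :: 'a measure" by (rule prob_space_gaussian) fact
  show ?thesis using assms by (intro integrable_const_bound[of _ B]) auto
qed

lemma smooth_bounds:
  assumes [measurable]: "H \<in> borel_measurable borel" and "\<And>x. lo \<le> H x" "\<And>x. H x \<le> hi"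
  shows "lo \<le> smooth t H p" "smooth t H p \<le> hi"
proof -
  interpret prob_space "gaussian 1 :: 'a measure" by (rule prob_gaussian1)
  have "integrable (gaussian 1) (\<lambda>q. H (p + sqrt t *\<^sub>R q))"
  proof (intro integrable_gaussian_bounded)
    show "\<bar>H (p + sqrt t *\<^sub>R x)\<bar> \<le> \<bar>lo\<bar> + \<bar>hi\<bar>" for x
      using assms(2,3)[of "p + sqrt t *\<^sub>R x"] by linarith
  qed auto
  then show "lo \<le> smooth t H p" "smooth t H p \<le> hi"
    unfolding smooth_def using assms by (auto intro!: integral_ge_const integral_le_const)
qed

text \<open>The semigroup law: independent Gaussians add their variances. Boundedness gives the
  integrability for Fubini. Time zero is treated apart because \<open>gaussian 0\<close> is not a
  point mass.\<close>

lemma smooth_smooth: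
  assumes st: "s \<ge> 0" "t \<ge> 0" and [measurable]: "H \<in> borel_measurable borel" and B: "\<And>x. \<bar>H x\<bar> \<le> B"
  shows "smooth s (smooth t H) p = smooth (s + t) H p"
proof (cases "s = 0 \<or> t = 0")
  case True
  then show ?thesis
  proof
    assume "t = 0"
    then have "smooth t H = H" by (simp add: smooth_0 fun_eq_iff)
    then show ?thesis using \<open>t = 0\<close> by simp
  qed (simp add: smooth_0)
next
  case False
  then have st: "s > 0" "t > 0" using st by auto
  interpret gs: prob_space "gaussian s :: 'a measure" by (rule prob_space_gaussian) fact
  interpret gt: prob_space "gaussian t :: 'a measure" by (rule prob_space_gaussian) fact
  interpret pair_prob_space "gaussian s :: 'a measure" "gaussian t :: 'a measure" ..
  have "smooth (s + t) H p = (\<integral>z. H (p + z) \<partial>distr (gaussian s \<Otimes>\<^sub>M gaussian t) borel (\<lambda>(x, y). x + y))"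
    using st by (simp add: smooth_gaussian distr_gaussian_add)
  also have "\<dots> = (\<integral>z. H (p + (fst z + snd z)) \<partial>(gaussian s \<Otimes>\<^sub>M gaussian t))"
    by (subst integral_distr) (auto simp: case_prod_beta)
  also have "\<dots> = (\<integral>x. \<integral>y. H (p + (x + y)) \<partial>gaussian t \<partial>gaussian s)"
  proof (subst integral_fst'[symmetric])
    show "integrable (gaussian s \<Otimes>\<^sub>M gaussian t) (\<lambda>z. H (p + (fst z + snd z)))"
      using B by (intro integrable_const_bound[of _ B]) auto
  qed simp
  also have "\<dots> = smooth s (smooth t H) p"
    using st by (simp add: smooth_gaussian add.assoc)
  finally show ?thesis ..
qed

lemma distr_gaussian_fst:
  assumes "v > 0"
  shows "distr (gaussian v :: ('a::euclidean_space \<times> 'b::euclidean_space) measure) borel fst = gaussian v"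
proof (rule measure_eqI)
  interpret gt: prob_space "gaussian v :: 'b measure" by (rule prob_space_gaussian) fact
  fix A assume "A \<in> sets (distr (gaussian v :: ('a \<times> 'b) measure) borel fst)"
  then have [measurable]: "A \<in> sets borel" by simp
  have "fst -` A = A \<times> (UNIV :: 'b set)" by auto
  then show "emeasure (distr (gaussian v :: ('a \<times> 'b) measure) borel fst) A = emeasure (gaussian v) A"
    using assms gt.emeasure_space_1
    by (simp add: emeasure_distr gaussian_pair gt.emeasure_pair_measure_Times borel_prod[symmetric])
qed simp

text \<open>Together with \<open>distr_gaussian_fst\<close>, this makes \<open>fst q\<close> and
  \<open>r *\<^sub>R fst q + s *\<^sub>R snd q\<close> Gaussians of equal variance with correlation
  \<open>r\<close>, the coupling that represents one autoregressive step.\<close>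

lemma distr_gaussian_rotate:
  assumes v: "v > 0" and rs: "r \<noteq> 0" "s \<noteq> 0" "r\<^sup>2 + s\<^sup>2 = 1"
  shows "distr (gaussian v :: ('a::euclidean_space \<times> 'a) measure) borel (\<lambda>q. r *\<^sub>R fst q + s *\<^sub>R snd q) = gaussian v"
proof (rule measure_eqI)
  interpret gt: prob_space "gaussian v :: 'a measure" by (rule prob_space_gaussian) fact
  fix A assume "A \<in> sets (distr (gaussian v :: ('a \<times> 'a) measure) borel (\<lambda>q. r *\<^sub>R fst q + s *\<^sub>R snd q))"
  then have [measurable]: "A \<in> sets borel" by simp
  have [measurable]: "(\<lambda>q::'a \<times> 'a. r *\<^sub>R fst q + s *\<^sub>R snd q) \<in> borel_measurable borel"
    by (intro borel_measurable_continuous_onI continuous_intros)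
  have v': "r\<^sup>2 * v > 0" "s\<^sup>2 * v > 0" using v rs by auto
  have "emeasure (gaussian v) A = (\<integral>\<^sup>+x. indicator A x \<partial>gaussian (r\<^sup>2 * v + s\<^sup>2 * v))"
    using rs by (simp add: distrib_right[symmetric])
  also have "\<dots> = (\<integral>\<^sup>+x. \<integral>\<^sup>+y. indicator A (x + y) \<partial>gaussian (s\<^sup>2 * v) \<partial>gaussian (r\<^sup>2 * v))"
    by (rule nn_integral_gaussian_add[OF v', symmetric]) simp
  also have "\<dots> = (\<integral>\<^sup>+x. \<integral>\<^sup>+y. indicator A (r *\<^sub>R x + s *\<^sub>R y) \<partial>gaussian v \<partial>gaussian v)"
    using gaussian_scale[OF v rs(1), where 'a = 'a] gaussian_scale[OF v rs(2), where 'a = 'a]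
    by (simp flip: gaussian_scale[OF v rs(1)] gaussian_scale[OF v rs(2)] add: nn_integral_distr)
  also have "\<dots> = (\<integral>\<^sup>+q. indicator A (r *\<^sub>R fst q + s *\<^sub>R snd q) \<partial>(gaussian v \<Otimes>\<^sub>M gaussian v))"
    by (subst gt.nn_integral_fst[symmetric]) auto
  also have "\<dots> = (\<integral>\<^sup>+q. indicator A (r *\<^sub>R fst q + s *\<^sub>R snd q) \<partial>gaussian v)"
    by (simp add: gaussian_pair[OF v])
  also have "\<dots> = (\<integral>\<^sup>+q. indicator A q \<partial>distr (gaussian v :: ('a \<times> 'a) measure) borel (\<lambda>q. r *\<^sub>R fst q + s *\<^sub>R snd q))"
    by (subst nn_integral_distr) auto
  finally show "emeasure (distr (gaussian v :: ('a \<times> 'a) measure) borel (\<lambda>q. r *\<^sub>R fst q + s *\<^sub>R snd q)) A = emeasure (gaussian v) A"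
    by simp
qed simp

text \<open>A function of one Gaussian component of a pair thus follows the heat flow of the
  component space, although the smoothing takes place on the product.\<close>

lemma smooth_linear:
  fixes L :: "'a::euclidean_space \<Rightarrow> 'b::euclidean_space"
  assumes L: "linear L" "distr (gaussian 1) borel L = gaussian 1" and [measurable]: "F \<in> borel_measurable borel"
  shows "smooth t (\<lambda>p. F (L p)) p = smooth t F (L p)"
proof -
  have [measurable]: "L \<in> borel_measurable borel"
    using L(1) by (intro borel_measurable_continuous_onI linear_continuous_on) (simp add: linear_linear)
  have "smooth t F (L p) = (\<integral>q. F (L p + sqrt t *\<^sub>R q) \<partial>distr (gaussian 1) borel L)"
    by (simp add: smooth_def L)
  also have "\<dots> = smooth t (\<lambda>p. F (L p)) p"
    using L(1) by (subst integral_distr) (auto simp: smooth_def linear_add linear_cmul)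
  finally show ?thesis ..
qed

section \<open>Uniform first-order expansion of smoothed functions\<close>

lemma exp_remainder_le: "\<bar>exp s - 1 - s\<bar> \<le> s\<^sup>2 * exp \<bar>s\<bar>" for s :: real
proof -
  obtain t where t: "\<bar>t\<bar> \<le> \<bar>s\<bar>" "exp s = (\<Sum>m<2. s ^ m / fact m) + exp t / fact 2 * s ^ 2"
    using Maclaurin_exp_le[of s 2] by blast
  have "exp s - 1 - s = exp t / 2 * s\<^sup>2" using t(2) by (simp add: numeral_2_eq_2)
  then have "\<bar>exp s - 1 - s\<bar> = exp t / 2 * s\<^sup>2" by (simp only: abs_mult) simp
  also have "\<dots> \<le> exp \<bar>s\<bar> * s\<^sup>2"
  proof (intro mult_right_mono)
    have "exp t \<le> exp \<bar>s\<bar>" using t(1) by simp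
    then show "exp t / 2 \<le> exp \<bar>s\<bar>" using exp_ge_zero[of "t"] by linarith
  qed simp
  finally show ?thesis by (simp add: mult.commute)
qed

text \<open>The Cameron--Martin formula. It moves the shift from a function that is merely
  measurable to a weight that is smooth in \<open>u\<close>.\<close>

lemma gaussian_shift:
  fixes G :: "'a::euclidean_space \<Rightarrow> real"
  assumes [measurable]: "G \<in> borel_measurable borel"
  shows "(\<integral>q. G (q + u) \<partial>gaussian 1) = (\<integral>q. G q * exp (q \<bullet> u - (norm u)\<^sup>2 / 2) \<partial>gaussian 1)"
proof -
  have eq: "gaussian_density 1 (q - u) = gaussian_density 1 q * exp (q \<bullet> u - (norm u)\<^sup>2 / 2)" for q :: 'a
  proof -
    have "- (norm (q - u))\<^sup>2 / 2 = - (norm q)\<^sup>2 / 2 + (q \<bullet> u - (norm u)\<^sup>2 / 2)"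
      by (simp add: power2_norm_eq_inner inner_simps inner_commute field_simps)
    then have "exp (- (norm (q - u))\<^sup>2 / 2) = exp (- (norm q)\<^sup>2 / 2) * exp (q \<bullet> u - (norm u)\<^sup>2 / 2)"
      by (simp only: exp_add)
    then show ?thesis by (simp add: gaussian_density_def)
  qed
  have "(\<integral>q. G (q + u) \<partial>gaussian 1) = (\<integral>q. gaussian_density 1 q * G (q + u) \<partial>lborel)"
    by (simp add: integral_gaussian)
  also have "\<dots> = (\<integral>q. gaussian_density 1 (q - u) * G q \<partial>lborel)"
    using integral_lborel_shift[of "\<lambda>q. gaussian_density 1 (q - u) * G q" u] by simp
  also have "\<dots> = (\<integral>q. G q * exp (q \<bullet> u - (norm u)\<^sup>2 / 2) \<partial>gaussian 1)"
    by (simp add: integral_gaussian eq mult_ac)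
  finally show ?thesis .
qed

text \<open>After \<open>gaussian_shift\<close> only the exponential weight depends on
  \<open>u\<close>, and its linear part is \<open>q \<bullet> u\<close>; hence \<open>a\<close> is
  the Gaussian mean of \<open>G q *\<^sub>R q\<close>. The estimates involve \<open>G\<close>
  through \<open>B\<close> alone, so one \<open>K\<close> serves every \<open>G\<close>.\<close>

lemma smooth_expand_1:
  fixes B :: real
  shows "\<exists>K\<ge>0. \<forall>G. G \<in> borel_measurable borel \<longrightarrow> (\<forall>x::'a::euclidean_space. \<bar>G x\<bar> \<le> B) \<longrightarrow>
    (\<exists>a. norm a \<le> K \<and> (\<forall>u. \<bar>(\<integral>q. G (q + u) \<partial>gaussian 1) - (\<integral>q. G q \<partial>gaussian 1) - a \<bullet> u\<bar> \<le> K * (norm u)\<^sup>2))"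
proof -
  interpret prob_space "gaussian 1 :: 'a measure" by (rule prob_gaussian1)
  define m where "m = (\<integral>q. exp 1 * exp (3 * norm q) + 1 / 2 \<partial>(gaussian 1 :: 'a measure))"
  define k where "k = (\<integral>q. norm q \<partial>(gaussian 1 :: 'a measure))"
  have im: "integrable (gaussian 1) (\<lambda>q::'a. exp 1 * exp (3 * norm q) + 1 / 2)"
    by (intro Bochner_Integration.integrable_add integrable_mult_right integrable_gaussian_exp) simp_all
  have ik: "integrable (gaussian 1) (\<lambda>q::'a. norm q)"
    by (rule integrable_gaussian_bound_power[of _ _ 1 1]) auto
  have m0: "m \<ge> 0" unfolding m_def by (intro Bochner_Integration.integral_nonneg) auto
  have k0: "k \<ge> 0" unfolding k_def by (intro Bochner_Integration.integral_nonneg) auto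
  \<comment> \<open>Three contributions: the remainder for short shifts, the size of
    \<open>a\<close>, and the trivial bound for long shifts.\<close>
  define K where "K = \<bar>B\<bar> * m + \<bar>B\<bar> * k + 2 * \<bar>B\<bar>"
  have K0: "K \<ge> 0" using m0 k0 by (simp add: K_def)
  show ?thesis
  proof (intro exI[of _ K] conjI allI impI K0)
    fix G :: "'a \<Rightarrow> real" assume [measurable]: "G \<in> borel_measurable borel" and G: "\<forall>x. \<bar>G x\<bar> \<le> B"
    have B: "0 \<le> B" using G abs_ge_zero[of "G 0"] by (meson order_trans)
    define a where "a = (\<integral>q. G q *\<^sub>R q \<partial>gaussian 1)"
    have iq: "integrable (gaussian 1) (\<lambda>q. G q *\<^sub>R q)"
    proof (rule Bochner_Integration.integrable_bound)
      show "integrable (gaussian 1) (\<lambda>q::'a. B * norm q)" using ik by simp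
      show "AE q in gaussian 1. norm (G q *\<^sub>R q) \<le> norm (B * norm q)"
        using G B by (auto intro!: AE_I2 mult_right_mono simp: abs_mult)
    qed simp
    have iG: "integrable (gaussian 1) (\<lambda>q. G (q + u))" for u
      using G by (intro integrable_gaussian_bounded[where B = B]) auto
    have iGe: "integrable (gaussian 1) (\<lambda>q. G q * exp (q \<bullet> u - (norm u)\<^sup>2 / 2))" for u
    proof (rule integrable_gaussian_bound[where b = "norm u" and K = B])
      fix q
      have "q \<bullet> u - (norm u)\<^sup>2 / 2 \<le> norm u * norm q"
        using norm_cauchy_schwarz[of q u] zero_le_power2[of "norm u"] mult.commute[of "norm u" "norm q"] by linarith
      then show "norm (G q * exp (q \<bullet> u - (norm u)\<^sup>2 / 2)) \<le> B * exp (norm u * norm q)"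
        using G B by (auto simp: abs_mult intro!: mult_mono)
    qed auto
    have a_inner: "a \<bullet> u = (\<integral>q. G q * (q \<bullet> u) \<partial>gaussian 1)" for u
      unfolding a_def using integral_inner_left[OF iq, of u] by simp
    have iau: "integrable (gaussian 1) (\<lambda>q. G q * (q \<bullet> u))" for u
      using integrable_inner_left[OF iq, of u] by simp
    have na: "norm a \<le> B * k"
    proof -
      have "norm a \<le> (\<integral>q. norm (G q *\<^sub>R q) \<partial>gaussian 1)" unfolding a_def by (rule integral_norm_bound)
      also have "\<dots> \<le> (\<integral>q. B * norm q \<partial>(gaussian 1 :: 'a measure))"
        using integrable_norm[OF iq] ik G by (intro Bochner_Integration.integral_mono) (auto intro!: mult_right_mono)
      finally show ?thesis by (simp add: k_def)
    qed
    have bnd: "\<bar>\<integral>q. G (q + u) \<partial>gaussian 1\<bar> \<le> B" for u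
      using G iG[of u] by (simp add: abs_le_iff integral_le_const minus_le_iff integral_ge_const)
    show "\<exists>a. norm a \<le> K \<and> (\<forall>u. \<bar>(\<integral>q. G (q + u) \<partial>gaussian 1) - (\<integral>q. G q \<partial>gaussian 1) - a \<bullet> u\<bar> \<le> K * (norm u)\<^sup>2)"
    proof (intro exI[of _ a] conjI allI)
      show "norm a \<le> K" using na B mult_nonneg_nonneg[OF B m0] by (simp add: K_def)
      fix u
      show "\<bar>(\<integral>q. G (q + u) \<partial>gaussian 1) - (\<integral>q. G q \<partial>gaussian 1) - a \<bullet> u\<bar> \<le> K * (norm u)\<^sup>2"
      proof (cases "norm u \<le> 1")
        case False
        then have u: "norm u \<le> (norm u)\<^sup>2" "1 \<le> (norm u)\<^sup>2"
          using mult_left_mono[of 1 "norm u" "norm u"] unfolding power2_eq_square by simp_all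
        have "\<bar>a \<bullet> u\<bar> \<le> B * k * norm u"
          using Cauchy_Schwarz_ineq2[of a u] na by (meson mult_right_mono norm_ge_zero order_trans)
        also have "\<dots> \<le> B * k * (norm u)\<^sup>2" using u B k0 by (intro mult_left_mono) auto
        finally have "\<bar>(\<integral>q. G (q + u) \<partial>gaussian 1) - (\<integral>q. G q \<partial>gaussian 1) - a \<bullet> u\<bar> \<le> 2 * B * 1 + B * k * (norm u)\<^sup>2"
          using bnd[of u] bnd[of 0] by simp
        also have "\<dots> \<le> 2 * B * (norm u)\<^sup>2 + B * k * (norm u)\<^sup>2"
          using u B by (intro add_right_mono mult_left_mono) auto
        also have "\<dots> \<le> K * (norm u)\<^sup>2"
          unfolding distrib_right[symmetric] K_def using B m0 by (intro mult_right_mono) auto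
        finally show ?thesis .
      next
        case True
        \<comment> \<open>For short shifts the exponent is at most
          \<open>norm u * (1 + norm q)\<close> in absolute value, so that the remainder of the
          exponential carries the factor \<open>(norm u)\<^sup>2\<close>. The summand
          \<open>1 / 2\<close> is the quadratic part of the exponent itself.\<close>
        have pt: "\<bar>exp (q \<bullet> u - (norm u)\<^sup>2 / 2) - 1 - q \<bullet> u\<bar> \<le> (norm u)\<^sup>2 * (exp 1 * exp (3 * norm q) + 1 / 2)" for q
        proof -
          define s where "s = q \<bullet> u - (norm u)\<^sup>2 / 2"
          have "\<bar>s\<bar> \<le> norm q * norm u + norm u * norm u"
            using Cauchy_Schwarz_ineq2[of q u] zero_le_power2[of "norm u"]
            unfolding s_def power2_eq_square by linarith
          also have "\<dots> \<le> norm u * (1 + norm q)" using True by (simp add: algebra_simps mult_left_le)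
          finally have s: "\<bar>s\<bar> \<le> norm u * (1 + norm q)" .
          have s1: "\<bar>s\<bar> \<le> 1 + norm q"
            using s mult_right_mono[OF True, of "1 + norm q"] by simp
          have "s\<^sup>2 \<le> (norm u * (1 + norm q))\<^sup>2" using s by (metis abs_ge_zero power2_abs power_mono)
          then have s2: "s\<^sup>2 \<le> (norm u)\<^sup>2 * exp (2 * norm q)"
            using mult_left_mono[OF power_le_exp[of "norm q" 2], of "(norm u)\<^sup>2"] by (simp add: power_mult_distrib)
          have "\<bar>exp s - 1 - s\<bar> \<le> s\<^sup>2 * exp \<bar>s\<bar>" by (rule exp_remainder_le)
          also have "\<dots> \<le> ((norm u)\<^sup>2 * exp (2 * norm q)) * exp (1 + norm q)"
            using s1 s2 by (intro mult_mono) auto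
          also have "\<dots> = (norm u)\<^sup>2 * (exp 1 * exp (3 * norm q))"
            by (simp add: exp_add[symmetric])
          finally have "\<bar>exp s - 1 - s\<bar> \<le> (norm u)\<^sup>2 * (exp 1 * exp (3 * norm q))" .
          moreover have "exp s - 1 - q \<bullet> u = (exp s - 1 - s) - (norm u)\<^sup>2 / 2" by (simp add: s_def)
          ultimately have "\<bar>exp s - 1 - q \<bullet> u\<bar> \<le> (norm u)\<^sup>2 * (exp 1 * exp (3 * norm q)) + (norm u)\<^sup>2 * (1 / 2)"
            using zero_le_power2[of "norm u"] by linarith
          then show ?thesis unfolding s_def[symmetric] distrib_left .
        qed
        have "(\<integral>q. G (q + u) \<partial>gaussian 1) - (\<integral>q. G q \<partial>gaussian 1) - a \<bullet> u
            = (\<integral>q. G q * (exp (q \<bullet> u - (norm u)\<^sup>2 / 2) - 1 - q \<bullet> u) \<partial>gaussian 1)"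
          unfolding gaussian_shift[OF \<open>G \<in> borel_measurable borel\<close>] a_inner
          using iGe[of u] iG[of 0] iau[of u] by (simp add: right_diff_distrib)
        also have "\<bar>\<dots>\<bar> \<le> (\<integral>q. \<bar>G q * (exp (q \<bullet> u - (norm u)\<^sup>2 / 2) - 1 - q \<bullet> u)\<bar> \<partial>gaussian 1)"
          by (rule integral_abs_bound)
        also have "\<dots> \<le> (\<integral>q. B * ((norm u)\<^sup>2 * (exp 1 * exp (3 * norm q) + 1 / 2)) \<partial>(gaussian 1 :: 'a measure))"
        proof (rule Bochner_Integration.integral_mono)
          show "integrable (gaussian 1) (\<lambda>q. \<bar>G q * (exp (q \<bullet> u - (norm u)\<^sup>2 / 2) - 1 - q \<bullet> u)\<bar>)"
            using iGe[of u] iG[of 0] iau[of u] by (simp add: right_diff_distrib)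
          show "integrable (gaussian 1) (\<lambda>q::'a. B * ((norm u)\<^sup>2 * (exp 1 * exp (3 * norm q) + 1 / 2)))"
            using im by (intro integrable_mult_right)
          show "\<bar>G q * (exp (q \<bullet> u - (norm u)\<^sup>2 / 2) - 1 - q \<bullet> u)\<bar> \<le> B * ((norm u)\<^sup>2 * (exp 1 * exp (3 * norm q) + 1 / 2))" for q
            unfolding abs_mult using G B pt by (intro mult_mono) auto
        qed
        also have "\<dots> = B * m * (norm u)\<^sup>2" unfolding m_def by simp
        also have "\<dots> \<le> K * (norm u)\<^sup>2"
          using B k0 by (intro mult_right_mono) (auto simp: K_def)
        finally show ?thesis .
      qed
    qed
  qed
qed

text \<open>Rescaling space by \<open>sqrt \<epsilon>\<close> costs this factor once in the gradient
  and twice in the quadratic remainder.\<close>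

lemma smooth_expand:
  fixes B \<epsilon> :: real
  assumes \<epsilon>: "\<epsilon> > 0"
  obtains K where "K \<ge> 0" and "\<And>H p. H \<in> borel_measurable borel \<Longrightarrow> (\<And>x::'a::euclidean_space. \<bar>H x\<bar> \<le> B) \<Longrightarrow>
    \<exists>a. norm a \<le> K \<and> (\<forall>u. \<bar>smooth \<epsilon> H (p + u) - smooth \<epsilon> H p - a \<bullet> u\<bar> \<le> K * (norm u)\<^sup>2)"
proof -
  obtain K where K: "K \<ge> 0" "\<And>G. G \<in> borel_measurable borel \<Longrightarrow> (\<forall>x::'a. \<bar>G x\<bar> \<le> B) \<Longrightarrow>
    (\<exists>a. norm a \<le> K \<and> (\<forall>u. \<bar>(\<integral>q. G (q + u) \<partial>gaussian 1) - (\<integral>q. G q \<partial>gaussian 1) - a \<bullet> u\<bar> \<le> K * (norm u)\<^sup>2))"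
    using smooth_expand_1[of B, where 'a = 'a] by blast
  define K' where "K' = K / sqrt \<epsilon> + K / \<epsilon>"
  have K': "K' \<ge> 0" "K / sqrt \<epsilon> \<le> K'" "K / \<epsilon> \<le> K'" using K \<epsilon> by (auto simp: K'_def)
  show ?thesis
  proof (rule that[OF K'(1)])
    fix H :: "'a \<Rightarrow> real" and p assume [measurable]: "H \<in> borel_measurable borel" and B: "\<And>x. \<bar>H x\<bar> \<le> B"
    obtain a where a: "norm a \<le> K"
      "\<And>u. \<bar>(\<integral>q. H (p + sqrt \<epsilon> *\<^sub>R (q + u)) \<partial>gaussian 1) - (\<integral>q. H (p + sqrt \<epsilon> *\<^sub>R q) \<partial>gaussian 1) - a \<bullet> u\<bar> \<le> K * (norm u)\<^sup>2"
      using K(2)[of "\<lambda>q. H (p + sqrt \<epsilon> *\<^sub>R q)"] B by auto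
    show "\<exists>a. norm a \<le> K' \<and> (\<forall>u. \<bar>smooth \<epsilon> H (p + u) - smooth \<epsilon> H p - a \<bullet> u\<bar> \<le> K' * (norm u)\<^sup>2)"
    proof (intro exI[of _ "a /\<^sub>R sqrt \<epsilon>"] conjI allI)
      have "norm (a /\<^sub>R sqrt \<epsilon>) = norm a / sqrt \<epsilon>" using \<epsilon> by (simp add: divide_inverse mult.commute)
      also have "\<dots> \<le> K / sqrt \<epsilon>" using a(1) \<epsilon> by (intro divide_right_mono) auto
      finally show "norm (a /\<^sub>R sqrt \<epsilon>) \<le> K'" using K' by linarith
      fix u :: 'a
      have "p + sqrt \<epsilon> *\<^sub>R (q + u /\<^sub>R sqrt \<epsilon>) = p + u + sqrt \<epsilon> *\<^sub>R q" for q
        using \<epsilon> by (simp add: scaleR_add_right)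
      then have "\<bar>smooth \<epsilon> H (p + u) - smooth \<epsilon> H p - (a /\<^sub>R sqrt \<epsilon>) \<bullet> u\<bar> \<le> K * (norm (u /\<^sub>R sqrt \<epsilon>))\<^sup>2"
        using a(2)[of "u /\<^sub>R sqrt \<epsilon>"] by (simp add: smooth_def add.assoc)
      also have "\<dots> = K / \<epsilon> * (norm u)\<^sup>2"
        using \<epsilon> by (simp add: power_mult_distrib power_inverse divide_inverse)
      also have "\<dots> \<le> K' * (norm u)\<^sup>2" using K' by (intro mult_right_mono) auto
      finally show "\<bar>smooth \<epsilon> H (p + u) - smooth \<epsilon> H p - (a /\<^sub>R sqrt \<epsilon>) \<bullet> u\<bar> \<le> K' * (norm u)\<^sup>2" .
    qed
  qed
qed

section \<open>Taylor expansion of powers and the local inequality\<close>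

lemma powr_taylor3:
  fixes c m M :: real
  assumes m: "0 < m" and c: "0 < c" "c < 1"
  obtains K where "K \<ge> 0"
    "\<And>x. m \<le> x \<Longrightarrow> x \<le> M \<Longrightarrow> \<bar>x powr c - 1 - c * (x - 1) + c * (1 - c) / 2 * (x - 1)\<^sup>2\<bar> \<le> K * \<bar>x - 1\<bar> ^ 3"
proof -
  define d where "d k = (if k = 0 then 1 else if k = 1 then c else if k = 2 then c * (c - 1) else c * (c - 1) * (c - 2))" for k :: nat
  define diff where "diff k x = d k * x powr (c - real k)" for k :: nat and x :: real
  \<comment> \<open>The interval is enlarged so as to contain the expansion point 1.\<close>
  define a where "a = min m 1"
  define b where "b = max M 1"
  have a: "0 < a" "a \<le> 1" "a \<le> m" using m by (auto simp: a_def)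
  have b: "1 \<le> b" "M \<le> b" by (auto simp: b_def)
  define K where "K = \<bar>d 3\<bar> * a powr (c - 3)"
  show ?thesis
  proof (rule that[of K])
    show "K \<ge> 0" by (simp add: K_def)
    fix x assume x: "m \<le> x" "x \<le> M"
    show "\<bar>x powr c - 1 - c * (x - 1) + c * (1 - c) / 2 * (x - 1)\<^sup>2\<bar> \<le> K * \<bar>x - 1\<bar> ^ 3"
    proof (cases "x = 1")
      case False
      have "\<exists>t. (if x < 1 then x < t \<and> t < 1 else 1 < t \<and> t < x) \<and>
        diff 0 x = (\<Sum>k<3. diff k 1 / fact k * (x - 1) ^ k) + diff 3 t / fact 3 * (x - 1) ^ 3"
      proof (rule Taylor[of 3 diff "diff 0" a b 1 x])
        show "\<forall>k t. k < 3 \<and> a \<le> t \<and> t \<le> b \<longrightarrow> (diff k has_real_derivative diff (Suc k) t) (at t)"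
        proof (intro allI impI)
          fix k :: nat and t assume kt: "k < 3 \<and> a \<le> t \<and> t \<le> b"
          then have t: "t > 0" using a by auto
          have "k = 0 \<or> k = 1 \<or> k = 2" using kt by auto
          then have "d (Suc k) = d k * (c - real k)"
            by (auto simp: d_def)
          moreover have "(diff k has_real_derivative d k * ((c - real k) * t powr (c - real k - 1))) (at t)"
            unfolding diff_def using t by (auto intro!: derivative_eq_intros)
          ultimately show "(diff k has_real_derivative diff (Suc k) t) (at t)"
            by (simp add: diff_def mult.assoc diff_diff_eq add.commute)
        qed
      qed (use a b x False in auto)
      then obtain t where t': "if x < 1 then x < t \<and> t < 1 else 1 < t \<and> t < x"
        and eq: "diff 0 x = (\<Sum>k<3. diff k 1 / fact k * (x - 1) ^ k) + diff 3 t / fact 3 * (x - 1) ^ 3"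
        by blast
      have t: "a \<le> t" using t' a x by (auto split: if_splits)
      have eq': "x powr c - 1 - c * (x - 1) + c * (1 - c) / 2 * (x - 1)\<^sup>2 = d 3 * t powr (c - 3) / 6 * (x - 1) ^ 3"
        using eq by (simp add: diff_def d_def eval_nat_numeral fact_numeral) (simp add: field_simps)
      have "\<bar>d 3 * t powr (c - 3) / 6\<bar> \<le> K"
      proof -
        \<comment> \<open>The exponent \<open>c - 3\<close> is negative, so the power is largest at
          the left end of the interval.\<close>
        have "t powr (c - 3) \<le> a powr (c - 3)" using t a c by (intro powr_mono2') auto
        then have "\<bar>d 3\<bar> * t powr (c - 3) \<le> K" unfolding K_def by (intro mult_left_mono) auto
        moreover have "\<bar>d 3 * t powr (c - 3) / 6\<bar> = \<bar>d 3\<bar> * t powr (c - 3) / 6" by (simp add: abs_mult)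
        moreover have "0 \<le> \<bar>d 3\<bar> * t powr (c - 3)" by simp
        ultimately show ?thesis by linarith
      qed
      then show ?thesis unfolding eq' abs_mult power_abs by (intro mult_right_mono) auto
    qed simp
  qed
qed

text \<open>Multiply the two quadratic Taylor polynomials: beyond second order there remain
  monomials of degree three and four with bounded coefficients, and on the given range the fourth
  degree is absorbed by the third.\<close>

lemma powr_product_expand:
  fixes c m M :: real
  assumes m: "0 < m" "m \<le> M" and c: "0 < c" "c < 1"
  obtains K where "K \<ge> 0"
    "\<And>\<alpha> \<beta>. m \<le> 1 + \<alpha> \<Longrightarrow> 1 + \<alpha> \<le> M \<Longrightarrow> m \<le> 1 + \<beta> \<Longrightarrow> 1 + \<beta> \<le> M \<Longrightarrow>
      \<bar>(1 + \<alpha>) powr c * (1 + \<beta>) powr c - (1 + c * (\<alpha> + \<beta>) + c\<^sup>2 * (\<alpha> * \<beta>) - c * (1 - c) / 2 * (\<alpha>\<^sup>2 + \<beta>\<^sup>2))\<bar>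
        \<le> K * (\<bar>\<alpha>\<bar> + \<bar>\<beta>\<bar>) ^ 3"
proof -
  obtain K where K: "K \<ge> 0"
    "\<And>x. m \<le> x \<Longrightarrow> x \<le> M \<Longrightarrow> \<bar>x powr c - 1 - c * (x - 1) + c * (1 - c) / 2 * (x - 1)\<^sup>2\<bar> \<le> K * \<bar>x - 1\<bar> ^ 3"
    using powr_taylor3[OF m(1) c] by blast
  define k where "k = c * (1 - c) / 2"
  have k: "0 \<le> k" "k \<le> 1"
  proof -
    have "c * (1 - c) \<le> 1 * 1" using c by (intro mult_mono) auto
    then show "0 \<le> k" "k \<le> 1" using c by (auto simp: k_def)
  qed
  \<comment> \<open>\<open>D\<close> is a crude bound for
    \<open>\<bar>\<alpha>\<bar> + \<bar>\<beta>\<bar>\<close>; \<open>P\<close> below bounds the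
    quadratic Taylor polynomial.\<close>
  define D where "D = 2 * (M + 1)"
  have D: "D \<ge> 0" using m by (simp add: D_def)
  define P where "P = 1 + D + D\<^sup>2"
  have P: "P \<ge> 0" using D by (simp add: P_def)
  define K' where "K' = K * (M + 1) + P * K + (2 + D)"
  show ?thesis
  proof (rule that[of K'])
    show "K' \<ge> 0" using K m P D by (simp add: K'_def)
    fix \<alpha> \<beta> assume \<alpha>: "m \<le> 1 + \<alpha>" "1 + \<alpha> \<le> M" and \<beta>: "m \<le> 1 + \<beta>" "1 + \<beta> \<le> M"
    define p where "p x = 1 + c * x - k * x\<^sup>2" for x
    define \<delta> where "\<delta> = \<bar>\<alpha>\<bar> + \<bar>\<beta>\<bar>"
    have \<delta>: "0 \<le> \<delta>" "\<bar>\<alpha>\<bar> \<le> \<delta>" "\<bar>\<beta>\<bar> \<le> \<delta>" "\<delta> \<le> D"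
      using \<alpha> \<beta> m by (auto simp: \<delta>_def D_def)
    have e: "\<bar>(1 + x) powr c - p x\<bar> \<le> K * \<delta> ^ 3" if "m \<le> 1 + x" "1 + x \<le> M" "\<bar>x\<bar> \<le> \<delta>" for x
    proof -
      have "\<bar>(1 + x) powr c - p x\<bar> \<le> K * \<bar>x\<bar> ^ 3"
        using K(2)[of "1 + x"] that by (simp add: p_def k_def algebra_simps)
      also have "\<dots> \<le> K * \<delta> ^ 3" using that K by (intro mult_left_mono power_mono) auto
      finally show ?thesis .
    qed
    have pb: "\<bar>p \<alpha>\<bar> \<le> P"
    proof -
      have "\<bar>c * \<alpha>\<bar> \<le> 1 * D" unfolding abs_mult using c \<delta> by (intro mult_mono) auto
      moreover have "\<bar>k * \<alpha>\<^sup>2\<bar> \<le> 1 * D\<^sup>2"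
        unfolding abs_mult using k \<delta> power_mono[of "\<bar>\<alpha>\<bar>" D 2] by (intro mult_mono) auto
      ultimately show ?thesis by (simp add: p_def P_def)
    qed
    have yb: "\<bar>(1 + \<beta>) powr c\<bar> \<le> M + 1"
    proof -
      have "(1 + \<beta>) powr c \<le> (M + 1) powr c" using \<beta> m c by (intro powr_mono2) auto
      also have "\<dots> \<le> (M + 1) powr 1" using c m by (intro powr_mono) auto
      finally show ?thesis using m by simp
    qed
    have "\<bar>(1 + \<alpha>) powr c * (1 + \<beta>) powr c - p \<alpha> * p \<beta>\<bar>
        = \<bar>((1 + \<alpha>) powr c - p \<alpha>) * (1 + \<beta>) powr c + p \<alpha> * ((1 + \<beta>) powr c - p \<beta>)\<bar>"
      by (simp add: algebra_simps)
    also have "\<dots> \<le> (K * \<delta> ^ 3) * (M + 1) + P * (K * \<delta> ^ 3)"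
      apply (rule order_trans[OF abs_triangle_ineq])
      unfolding abs_mult using e[OF \<alpha> \<delta>(2)] e[OF \<beta> \<delta>(3)] pb yb P K \<delta>(1)
      by (intro add_mono mult_mono) auto
    finally have 1: "\<bar>(1 + \<alpha>) powr c * (1 + \<beta>) powr c - p \<alpha> * p \<beta>\<bar> \<le> (K * (M + 1) + P * K) * \<delta> ^ 3"
      by (simp add: algebra_simps)
    have m3: "\<bar>x * y * z\<bar> \<le> \<delta> ^ 3" if "\<bar>x\<bar> \<le> \<delta>" "\<bar>y\<bar> \<le> \<delta>" "\<bar>z\<bar> \<le> \<delta>" for x y z
      unfolding abs_mult power3_eq_cube using that \<delta>(1) by (intro mult_mono) auto
    have "p \<alpha> * p \<beta> - (1 + c * (\<alpha> + \<beta>) + c\<^sup>2 * (\<alpha> * \<beta>) - k * (\<alpha>\<^sup>2 + \<beta>\<^sup>2))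
        = - (c * k * (\<alpha> * \<beta> * \<beta>)) - c * k * (\<alpha> * \<alpha> * \<beta>) + k\<^sup>2 * \<beta> * (\<alpha> * \<alpha> * \<beta>)"
      by (simp add: p_def power2_eq_square algebra_simps)
    also have "\<bar>\<dots>\<bar> \<le> \<bar>c * k * (\<alpha> * \<beta> * \<beta>)\<bar> + \<bar>c * k * (\<alpha> * \<alpha> * \<beta>)\<bar> + \<bar>k\<^sup>2 * \<beta> * (\<alpha> * \<alpha> * \<beta>)\<bar>"
      by linarith
    also have "\<dots> \<le> 1 * \<delta> ^ 3 + 1 * \<delta> ^ 3 + D * \<delta> ^ 3"
    proof -
      have ck: "\<bar>c * k\<bar> \<le> 1" using mult_mono[of c 1 k 1] c k by simp
      have "\<bar>k\<^sup>2 * \<beta>\<bar> \<le> 1 * D"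
        unfolding abs_mult using k \<delta> power_mono[of k 1 2] by (intro mult_mono) auto
      then show ?thesis
        unfolding abs_mult[of "c * k"] abs_mult[of "k\<^sup>2 * \<beta>"] using ck m3 \<delta> D
        by (intro add_mono mult_mono) auto
    qed
    finally have 2: "\<bar>p \<alpha> * p \<beta> - (1 + c * (\<alpha> + \<beta>) + c\<^sup>2 * (\<alpha> * \<beta>) - k * (\<alpha>\<^sup>2 + \<beta>\<^sup>2))\<bar> \<le> (2 + D) * \<delta> ^ 3"
      by (simp add: algebra_simps)
    have "\<bar>(1 + \<alpha>) powr c * (1 + \<beta>) powr c - (1 + c * (\<alpha> + \<beta>) + c\<^sup>2 * (\<alpha> * \<beta>) - k * (\<alpha>\<^sup>2 + \<beta>\<^sup>2))\<bar>
        \<le> (K * (M + 1) + P * K) * \<delta> ^ 3 + (2 + D) * \<delta> ^ 3"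
      using 1 2 by linarith
    then show "\<bar>(1 + \<alpha>) powr c * (1 + \<beta>) powr c - (1 + c * (\<alpha> + \<beta>) + c\<^sup>2 * (\<alpha> * \<beta>) - c * (1 - c) / 2 * (\<alpha>\<^sup>2 + \<beta>\<^sup>2))\<bar> \<le> K' * (\<bar>\<alpha>\<bar> + \<bar>\<beta>\<bar>) ^ 3"
      unfolding k_def[symmetric] \<delta>_def[symmetric] K'_def distrib_right .
  qed
qed

text \<open>Only a first-order expansion of \<open>A\<close> and \<open>B\<close> is needed, since the averages of the remainders are
  the same on both sides; the second-order terms of \<open>A\<^sup>c B\<^sup>c\<close> form a negative semidefinite quadratic form
  because \<open>1 - c = r c\<close>.\<close>

lemma hypercontractive_local:
  fixes lo hi K r c :: real
  assumes lo: "0 < lo" "lo \<le> hi" and K: "K \<ge> 0" and r: "0 < r" and c_def: "c = 1 / (1 + r)"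
  obtains K' where "K' \<ge> 0"
    and "\<And>(A :: 'e::euclidean_space \<Rightarrow> real) B a b h.
      A \<in> borel_measurable borel \<Longrightarrow> B \<in> borel_measurable borel \<Longrightarrow>
      (\<And>q. lo \<le> A q \<and> A q \<le> hi) \<Longrightarrow> (\<And>q. lo \<le> B q \<and> B q \<le> hi) \<Longrightarrow>
      norm a \<le> K \<Longrightarrow> norm b \<le> K \<Longrightarrow> a \<bullet> b \<le> r * norm a * norm b \<Longrightarrow>
      (\<And>u. \<bar>A u - A 0 - a \<bullet> u\<bar> \<le> K * (norm u)\<^sup>2) \<Longrightarrow>
      (\<And>u. \<bar>B u - B 0 - b \<bullet> u\<bar> \<le> K * (norm u)\<^sup>2) \<Longrightarrow> 0 < h \<Longrightarrow> h \<le> 1 \<Longrightarrow>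
      smooth h (\<lambda>q. A q powr c * B q powr c) 0
        \<le> smooth h A 0 powr c * smooth h B 0 powr c + K' * sqrt h ^ 3"
proof -
  interpret prob_space "gaussian 1 :: 'e measure" by (rule prob_gaussian1)
  have c: "0 < c" "c < 1" "1 - c = r * c" using r by (auto simp: c_def field_simps)
  define k where "k = c * (1 - c) / 2"
  have k: "0 \<le> k" "k \<le> 1"
  proof -
    have "c * (1 - c) \<le> 1 * 1" using c(1,2) by (intro mult_mono) auto
    then show "0 \<le> k" "k \<le> 1" using c(1,2) by (auto simp: k_def)
  qed
  have c1: "0 \<le> c\<^sup>2" "c\<^sup>2 \<le> 1" using c power_le_one[of c 2] by auto
  \<comment> \<open>The range of the ratios of \<open>A\<close> to \<open>A 0\<close> and of
    \<open>B\<close> to \<open>B 0\<close>, on which the expansion of the power is uniform.\<close>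
  define m where "m = lo / hi"
  define M where "M = hi / lo"
  have mM: "0 < m" "m \<le> M" using lo by (auto simp: m_def M_def field_simps intro!: mult_mono)
  obtain L where L: "L \<ge> 0"
    "\<And>\<alpha> \<beta>. m \<le> 1 + \<alpha> \<Longrightarrow> 1 + \<alpha> \<le> M \<Longrightarrow> m \<le> 1 + \<beta> \<Longrightarrow> 1 + \<beta> \<le> M \<Longrightarrow>
      \<bar>(1 + \<alpha>) powr c * (1 + \<beta>) powr c - (1 + c * (\<alpha> + \<beta>) + c\<^sup>2 * (\<alpha> * \<beta>) - k * (\<alpha>\<^sup>2 + \<beta>\<^sup>2))\<bar>
        \<le> L * (\<bar>\<alpha>\<bar> + \<bar>\<beta>\<bar>) ^ 3"
    using powr_product_expand[OF mM c(1,2)] unfolding k_def by blast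
  define K1 where "K1 = K / lo"
  have K1: "K1 \<ge> 0" using K lo by (simp add: K1_def)
  have iw: "integrable (gaussian 1) (\<lambda>q::'e. (1 + norm q) ^ j)" for j
    by (rule integrable_gaussian_bound_power[of _ _ 1 j]) auto
  \<comment> \<open>The sixth moment dominates all remainders: the relative increments grow like
    \<open>(1 + norm q)\<^sup>2\<close> and enter up to the third power.\<close>
  define W where "W = (\<integral>q. (1 + norm q) ^ 6 \<partial>(gaussian 1 :: 'e measure))"
  have W1: "W \<ge> 1"
    unfolding W_def using iw[of 6] by (intro integral_ge_const) (auto simp: one_le_power)
  define K2 where "K2 = L * (8 * (2 * K1) ^ 3) + 9 * K1\<^sup>2"
  define K3 where "K3 = 3 * K1\<^sup>2 * W\<^sup>2 + L * (2 * K1 * W) ^ 3"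
  define K4 where "K4 = hi powr c * hi powr c * (K2 * W + K3)"
  have K2: "K2 \<ge> 0" using L K1 by (simp add: K2_def)
  have K3: "K3 \<ge> 0" using L K1 W1 by (simp add: K3_def)
  show ?thesis
  proof (rule that[of K4])
    show "K4 \<ge> 0" using K2 K3 W1 by (simp add: K4_def)
    fix A B :: "'e \<Rightarrow> real" and a b :: 'e and h :: real
    assume [measurable]: "A \<in> borel_measurable borel" "B \<in> borel_measurable borel"
      and Ab: "\<And>q. lo \<le> A q \<and> A q \<le> hi" and Bb: "\<And>q. lo \<le> B q \<and> B q \<le> hi"
      and ab: "norm a \<le> K" "norm b \<le> K" "a \<bullet> b \<le> r * norm a * norm b"
      and A1: "\<And>u. \<bar>A u - A 0 - a \<bullet> u\<bar> \<le> K * (norm u)\<^sup>2"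
      and B1: "\<And>u. \<bar>B u - B 0 - b \<bullet> u\<bar> \<le> K * (norm u)\<^sup>2"
      and h: "0 < h" "h \<le> 1"
    define s where "s = sqrt h"
    have s: "0 < s" "s \<le> 1" using h by (auto simp: s_def)
    \<comment> \<open>Relative increments at the scale \<open>sqrt h\<close> of the Gaussian
      displacement; dividing by the values at 0 makes every power an expansion around 1.\<close>
    define \<alpha> where "\<alpha> q = A (s *\<^sub>R q) / A 0 - 1" for q
    define \<beta> where "\<beta> q = B (s *\<^sub>R q) / B 0 - 1" for q
    define a' where "a' = a /\<^sub>R A 0"
    define b' where "b' = b /\<^sub>R B 0"
    have A0: "lo \<le> A 0" "A 0 \<le> hi" "0 < A 0" and B0: "lo \<le> B 0" "B 0 \<le> hi" "0 < B 0"
      using Ab[of 0] Bb[of 0] lo by auto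
    have [measurable]: "\<alpha> \<in> borel_measurable borel" "\<beta> \<in> borel_measurable borel"
      unfolding \<alpha>_def \<beta>_def by measurable
    have ratio: "m \<le> x / y" "x / y \<le> M" if "lo \<le> x" "x \<le> hi" "lo \<le> y" "y \<le> hi" for x y
      unfolding m_def M_def using lo that by (auto intro!: frac_le)
    have \<alpha>r: "m \<le> 1 + \<alpha> q" "1 + \<alpha> q \<le> M" for q
      using ratio[of "A (s *\<^sub>R q)" "A 0"] Ab A0 by (auto simp: \<alpha>_def)
    have \<beta>r: "m \<le> 1 + \<beta> q" "1 + \<beta> q \<le> M" for q
      using ratio[of "B (s *\<^sub>R q)" "B 0"] Bb B0 by (auto simp: \<beta>_def)
    have lin: "\<bar>F (s *\<^sub>R q) / F 0 - 1 - s * ((f /\<^sub>R F 0) \<bullet> q)\<bar> \<le> K1 * s\<^sup>2 * (1 + norm q)\<^sup>2"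
      if F: "lo \<le> F 0" "\<And>u. \<bar>F u - F 0 - f \<bullet> u\<bar> \<le> K * (norm u)\<^sup>2" for F f q
    proof -
      have F0: "F 0 > 0" using F lo by linarith
      have "F (s *\<^sub>R q) / F 0 - 1 - s * ((f /\<^sub>R F 0) \<bullet> q) = (F (s *\<^sub>R q) - F 0 - f \<bullet> (s *\<^sub>R q)) / F 0"
        using F0 by (simp add: divide_simps)
      then have "\<bar>F (s *\<^sub>R q) / F 0 - 1 - s * ((f /\<^sub>R F 0) \<bullet> q)\<bar> = \<bar>F (s *\<^sub>R q) - F 0 - f \<bullet> (s *\<^sub>R q)\<bar> / F 0"
        using F0 by simp
      also have "\<dots> \<le> K * (norm (s *\<^sub>R q))\<^sup>2 / lo"
        using F(1) F(2)[of "s *\<^sub>R q"] lo K by (intro frac_le) auto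
      also have "\<dots> = K1 * s\<^sup>2 * (norm q)\<^sup>2" using s by (simp add: K1_def power_mult_distrib)
      also have "\<dots> \<le> K1 * s\<^sup>2 * (1 + norm q)\<^sup>2" using K1 by (intro mult_left_mono power_mono) auto
      finally show ?thesis .
    qed
    have \<alpha>l: "\<bar>\<alpha> q - s * (a' \<bullet> q)\<bar> \<le> K1 * s\<^sup>2 * (1 + norm q)\<^sup>2" for q
      unfolding \<alpha>_def a'_def using lin[of A a q] A0 A1 by simp
    have \<beta>l: "\<bar>\<beta> q - s * (b' \<bullet> q)\<bar> \<le> K1 * s\<^sup>2 * (1 + norm q)\<^sup>2" for q
      unfolding \<beta>_def b'_def using lin[of B b q] B0 B1 by simp
    have na: "norm a' \<le> K1" "norm b' \<le> K1"
    proof -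
      have "norm a / A 0 \<le> K / lo" "norm b / B 0 \<le> K / lo" using ab A0 B0 lo K by (auto intro!: frac_le)
      then show "norm a' \<le> K1" "norm b' \<le> K1"
        using A0 B0 by (auto simp: a'_def b'_def K1_def divide_inverse mult.commute)
    qed
    have inn: "\<bar>s * (f \<bullet> q)\<bar> \<le> K1 * s * (1 + norm q)" if "norm f \<le> K1" for f q :: 'e
    proof -
      have "\<bar>f \<bullet> q\<bar> \<le> norm f * norm q" by (rule Cauchy_Schwarz_ineq2)
      also have "\<dots> \<le> K1 * (1 + norm q)" using that K1 by (intro mult_mono) auto
      finally show ?thesis using s mult_left_mono[of "\<bar>f \<bullet> q\<bar>" "K1 * (1 + norm q)" s] by (simp add: abs_mult mult_ac)
    qed
    have abs2: "\<bar>x\<bar> \<le> 2 * K1 * s * (1 + norm q)\<^sup>2"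
      if x: "\<bar>x - s * (f \<bullet> q)\<bar> \<le> K1 * s\<^sup>2 * (1 + norm q)\<^sup>2" "norm f \<le> K1" for x and f q :: 'e
    proof -
      have "K1 * s * (1 + norm q) \<le> K1 * s * (1 + norm q)\<^sup>2"
        using K1 s power_increasing[of 1 2 "1 + norm q"] by (intro mult_left_mono) auto
      moreover have "K1 * s\<^sup>2 * (1 + norm q)\<^sup>2 \<le> K1 * s * (1 + norm q)\<^sup>2"
        using K1 s power_decreasing[of 1 2 s] by (intro mult_right_mono mult_left_mono) auto
      ultimately show ?thesis using inn[OF x(2), of q] x(1) by linarith
    qed
    have prd: "\<bar>x * y - s\<^sup>2 * ((f \<bullet> q) * (g \<bullet> q))\<bar> \<le> 3 * K1\<^sup>2 * (s ^ 3 * (1 + norm q) ^ 6)"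
      if x: "\<bar>x - s * (f \<bullet> q)\<bar> \<le> K1 * s\<^sup>2 * (1 + norm q)\<^sup>2" "norm f \<le> K1"
        and y: "\<bar>y - s * (g \<bullet> q)\<bar> \<le> K1 * s\<^sup>2 * (1 + norm q)\<^sup>2" "norm g \<le> K1" for x y and f g q :: 'e
    proof -
      let ?w = "1 + norm q"
      have w: "?w \<ge> 1" by simp
      have "x * y - s\<^sup>2 * ((f \<bullet> q) * (g \<bullet> q)) = (x - s * (f \<bullet> q)) * y + s * (f \<bullet> q) * (y - s * (g \<bullet> q))"
        by (simp add: algebra_simps power2_eq_square)
      then have "\<bar>x * y - s\<^sup>2 * ((f \<bullet> q) * (g \<bullet> q))\<bar> \<le> \<bar>x - s * (f \<bullet> q)\<bar> * \<bar>y\<bar> + \<bar>s * (f \<bullet> q)\<bar> * \<bar>y - s * (g \<bullet> q)\<bar>"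
        by (simp add: abs_mult[symmetric])
      also have "\<dots> \<le> (K1 * s\<^sup>2 * ?w\<^sup>2) * (2 * K1 * s * ?w\<^sup>2) + (K1 * s * ?w) * (K1 * s\<^sup>2 * ?w\<^sup>2)"
        using x y inn[OF x(2), of q] abs2[OF y] K1 s by (intro add_mono mult_mono) auto
      also have "\<dots> = K1\<^sup>2 * s ^ 3 * (2 * ?w ^ 4 + ?w ^ 3)"
        by (simp add: eval_nat_numeral algebra_simps)
      also have "\<dots> \<le> K1\<^sup>2 * s ^ 3 * (2 * ?w ^ 6 + ?w ^ 6)"
        using s K1 power_increasing[of 4 6 ?w] power_increasing[of 3 6 ?w] w by (intro mult_left_mono add_mono) auto
      finally show ?thesis by (simp add: mult_ac)
    qed
    define R where "R = (\<lambda>q::'e. s ^ 3 * (1 + norm q) ^ 6)"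
    have pt: "(1 + \<alpha> q) powr c * (1 + \<beta> q) powr c \<le> 1 + c * (\<alpha> q + \<beta> q)
        + s\<^sup>2 * (c\<^sup>2 * ((a' \<bullet> q) * (b' \<bullet> q)) - k * ((a' \<bullet> q) * (a' \<bullet> q) + (b' \<bullet> q) * (b' \<bullet> q))) + K2 * R q" for q
    proof -
      have 1: "(1 + \<alpha> q) powr c * (1 + \<beta> q) powr c \<le> 1 + c * (\<alpha> q + \<beta> q) + c\<^sup>2 * (\<alpha> q * \<beta> q) - k * ((\<alpha> q)\<^sup>2 + (\<beta> q)\<^sup>2) + L * (\<bar>\<alpha> q\<bar> + \<bar>\<beta> q\<bar>) ^ 3"
        using L(2)[OF \<alpha>r[of q] \<beta>r[of q]] by linarith
      have "(\<bar>\<alpha> q\<bar> + \<bar>\<beta> q\<bar>) ^ 3 \<le> (2 * (2 * K1) * s * (1 + norm q)\<^sup>2) ^ 3"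
        using abs2[OF \<alpha>l na(1), of q] abs2[OF \<beta>l na(2), of q] by (intro power_mono) auto
      also have "\<dots> = 8 * ((2 * K1) ^ 3 * R q)" by (simp add: R_def power_mult_distrib power_mult[symmetric])
      finally have 2: "L * (\<bar>\<alpha> q\<bar> + \<bar>\<beta> q\<bar>) ^ 3 \<le> L * (8 * ((2 * K1) ^ 3 * R q))" using L by (intro mult_left_mono)
      have sc: "t * x \<le> y" if "0 \<le> t" "t \<le> 1" "\<bar>x\<bar> \<le> y" for t x y :: real
        using that mult_mono[of t 1 "\<bar>x\<bar>" "\<bar>x\<bar>"] mult_left_mono[of x "\<bar>x\<bar>" t] by linarith
      have 3: "c\<^sup>2 * (\<alpha> q * \<beta> q - s\<^sup>2 * ((a' \<bullet> q) * (b' \<bullet> q))) \<le> 3 * K1\<^sup>2 * R q"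
        unfolding R_def using prd[OF \<alpha>l na(1) \<beta>l na(2), of q] c1 by (intro sc) auto
      have 4: "k * (- (\<alpha> q * \<alpha> q - s\<^sup>2 * ((a' \<bullet> q) * (a' \<bullet> q)))) \<le> 3 * K1\<^sup>2 * R q"
        unfolding R_def using prd[OF \<alpha>l na(1) \<alpha>l na(1), of q] k by (intro sc) auto
      have 5: "k * (- (\<beta> q * \<beta> q - s\<^sup>2 * ((b' \<bullet> q) * (b' \<bullet> q)))) \<le> 3 * K1\<^sup>2 * R q"
        unfolding R_def using prd[OF \<beta>l na(2) \<beta>l na(2), of q] k by (intro sc) auto
      have "c\<^sup>2 * (\<alpha> q * \<beta> q) - k * ((\<alpha> q)\<^sup>2 + (\<beta> q)\<^sup>2)
        \<le> s\<^sup>2 * (c\<^sup>2 * ((a' \<bullet> q) * (b' \<bullet> q)) - k * ((a' \<bullet> q) * (a' \<bullet> q) + (b' \<bullet> q) * (b' \<bullet> q))) + 9 * K1\<^sup>2 * R q"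
        using 3 4 5 unfolding power2_eq_square[of "\<alpha> q"] power2_eq_square[of "\<beta> q"]
        by (simp add: right_diff_distrib distrib_left mult_ac)
      moreover have "K2 * R q = L * (8 * ((2 * K1) ^ 3 * R q)) + 9 * K1\<^sup>2 * R q"
        by (simp add: K2_def algebra_simps)
      ultimately show ?thesis using 1 2 by linarith
    qed
    have i\<alpha>: "integrable (gaussian 1) \<alpha>" and i\<beta>: "integrable (gaussian 1) \<beta>"
      using abs2[OF \<alpha>l na(1)] abs2[OF \<beta>l na(2)] K1 s
      by (auto intro!: integrable_gaussian_bound_power[where K = "2 * K1 * s" and k = 2])
    have ii: "integrable (gaussian 1) (\<lambda>q. (f \<bullet> q) * (g \<bullet> q))" for f g :: 'e
    proof (rule integrable_gaussian_bound_power[where K = "norm f * norm g" and k = 2])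
      fix q :: 'e
      have "\<bar>f \<bullet> q\<bar> * \<bar>g \<bullet> q\<bar> \<le> (norm f * (1 + norm q)) * (norm g * (1 + norm q))"
        using Cauchy_Schwarz_ineq2[of f q] Cauchy_Schwarz_ineq2[of g q]
        by (intro mult_mono) (auto simp: distrib_left add_increasing)
      then show "norm ((f \<bullet> q) * (g \<bullet> q)) \<le> norm f * norm g * (1 + norm q)\<^sup>2"
        by (simp add: abs_mult power2_eq_square mult_ac)
    qed auto
    have Eii: "(\<integral>q. (f \<bullet> q) * (g \<bullet> q) \<partial>gaussian 1) = f \<bullet> g" for f g :: 'e
      using gaussian_covariance[of 1 f g] by (simp add: inner_commute)
    have iR: "integrable (gaussian 1) R" "(\<integral>q. R q \<partial>gaussian 1) = s ^ 3 * W"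
      unfolding R_def W_def using iw[of 6] by simp_all
    define \<alpha>0 where "\<alpha>0 = (\<integral>q. \<alpha> q \<partial>gaussian 1)"
    define \<beta>0 where "\<beta>0 = (\<integral>q. \<beta> q \<partial>gaussian 1)"
    define S where "S = (\<integral>q. (1 + \<alpha> q) powr c * (1 + \<beta> q) powr c \<partial>gaussian 1)"
    define T where "T = (1 + \<alpha>0) powr c * (1 + \<beta>0) powr c"
    have iS: "integrable (gaussian 1) (\<lambda>q. (1 + \<alpha> q) powr c * (1 + \<beta> q) powr c)"
    proof (rule integrable_gaussian_bounded[where B = "M powr c * M powr c"])
      fix q
      have "0 \<le> 1 + \<alpha> q" "0 \<le> 1 + \<beta> q" using \<alpha>r(1)[of q] \<beta>r(1)[of q] mM by linarith+
      then show "\<bar>(1 + \<alpha> q) powr c * (1 + \<beta> q) powr c\<bar> \<le> M powr c * M powr c"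
        unfolding abs_mult using \<alpha>r(2)[of q] \<beta>r(2)[of q] c by (intro mult_mono) (auto intro!: powr_mono2)
    qed auto
    have "S \<le> (\<integral>q. 1 + c * (\<alpha> q + \<beta> q)
        + s\<^sup>2 * (c\<^sup>2 * ((a' \<bullet> q) * (b' \<bullet> q)) - k * ((a' \<bullet> q) * (a' \<bullet> q) + (b' \<bullet> q) * (b' \<bullet> q))) + K2 * R q \<partial>gaussian 1)"
      unfolding S_def using pt iS i\<alpha> i\<beta> ii iR by (intro Bochner_Integration.integral_mono) auto
    also have "\<dots> = 1 + c * (\<alpha>0 + \<beta>0) + s\<^sup>2 * (c\<^sup>2 * (a' \<bullet> b') - k * (a' \<bullet> a' + b' \<bullet> b')) + K2 * (s ^ 3 * W)"
      unfolding \<alpha>0_def \<beta>0_def using i\<alpha> i\<beta> ii iR prob_space by (simp add: Eii)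
    \<comment> \<open>The correlation bound on \<open>a \<bullet> b\<close> enters here: as
      \<open>k = r * c\<^sup>2 / 2\<close>, the mixed term is dominated by the two squares.\<close>
    also have "\<dots> \<le> 1 + c * (\<alpha>0 + \<beta>0) + s\<^sup>2 * 0 + K2 * (s ^ 3 * W)"
    proof -
      have "a' \<bullet> b' = (a \<bullet> b) / (A 0 * B 0)" by (simp add: a'_def b'_def divide_inverse mult_ac)
      also have "\<dots> \<le> (r * norm a * norm b) / (A 0 * B 0)" using ab A0 B0 by (intro divide_right_mono) auto
      also have "\<dots> = r * (norm a' * norm b')" using A0 B0 by (simp add: a'_def b'_def divide_inverse mult_ac)
      also have "\<dots> \<le> r * (((norm a')\<^sup>2 + (norm b')\<^sup>2) / 2)"
        using sum_squares_bound[of "norm a'" "norm b'"] r by (intro mult_left_mono) auto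
      finally have "c\<^sup>2 * (a' \<bullet> b') \<le> c\<^sup>2 * (r * (((norm a')\<^sup>2 + (norm b')\<^sup>2) / 2))"
        using c1 by (intro mult_left_mono)
      also have "\<dots> = k * (a' \<bullet> a' + b' \<bullet> b')"
        unfolding k_def c(3) by (simp add: power2_norm_eq_inner power2_eq_square[of c])
      finally have "c\<^sup>2 * (a' \<bullet> b') - k * (a' \<bullet> a' + b' \<bullet> b') \<le> 0" by simp
      from mult_left_mono[OF this, of "s\<^sup>2"] show ?thesis by simp
    qed
    finally have S: "S \<le> 1 + c * (\<alpha>0 + \<beta>0) + K2 * W * s ^ 3" by (simp add: mult_ac)
    \<comment> \<open>The linear parts have mean zero, so the averages of \<open>\<alpha>\<close>
      and \<open>\<beta>\<close> are of order \<open>h\<close> rather than \<open>sqrt h\<close>.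
      Their products are then of order \<open>h\<^sup>2\<close> and belong to the error.\<close>
    define u where "u = K1 * s\<^sup>2 * W"
    have u: "0 \<le> u" using K1 W1 by (simp add: u_def)
    have mean: "\<bar>\<integral>q. x q \<partial>gaussian 1\<bar> \<le> u"
      if x: "integrable (gaussian 1) x" "\<And>q. \<bar>x q - s * (f \<bullet> q)\<bar> \<le> K1 * s\<^sup>2 * (1 + norm q)\<^sup>2" for x and f :: 'e
    proof -
      have if1: "integrable (gaussian 1) (\<lambda>q. f \<bullet> q)"
        using Cauchy_Schwarz_ineq2[of f]
        by (intro integrable_gaussian_bound_power[where K = "norm f" and k = 1]) (auto simp: distrib_left add_increasing)
      have "(\<integral>q. f \<bullet> q \<partial>gaussian 1) = 0" using gaussian_mean[of 1 f] by (simp add: inner_commute)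
      then have "(\<integral>q. x q \<partial>gaussian 1) = (\<integral>q. x q - s * (f \<bullet> q) \<partial>gaussian 1)" using x(1) if1 by simp
      also have "\<bar>\<dots>\<bar> \<le> (\<integral>q. \<bar>x q - s * (f \<bullet> q)\<bar> \<partial>gaussian 1)" by (rule integral_abs_bound)
      also have "\<dots> \<le> (\<integral>q. K1 * s\<^sup>2 * (1 + norm q) ^ 6 \<partial>(gaussian 1 :: 'e measure))"
      proof (rule Bochner_Integration.integral_mono)
        fix q :: 'e
        have "K1 * s\<^sup>2 * (1 + norm q)\<^sup>2 \<le> K1 * s\<^sup>2 * (1 + norm q) ^ 6"
          using K1 by (intro mult_left_mono power_increasing) auto
        then show "\<bar>x q - s * (f \<bullet> q)\<bar> \<le> K1 * s\<^sup>2 * (1 + norm q) ^ 6" using x(2)[of q] by linarith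
      qed (use x if1 iw in auto)
      finally show ?thesis by (simp add: u_def W_def)
    qed
    have \<alpha>0: "\<bar>\<alpha>0\<bar> \<le> u" and \<beta>0: "\<bar>\<beta>0\<bar> \<le> u"
      unfolding \<alpha>0_def \<beta>0_def using mean[OF i\<alpha> \<alpha>l] mean[OF i\<beta> \<beta>l] by auto
    have avg: "m \<le> 1 + (\<integral>q. x q \<partial>gaussian 1)" "1 + (\<integral>q. x q \<partial>gaussian 1) \<le> M"
      if x: "integrable (gaussian 1) x" "\<And>q. m \<le> 1 + x q" "\<And>q. 1 + x q \<le> M" for x :: "'e \<Rightarrow> real"
    proof -
      have "m - 1 \<le> (\<integral>q. x q \<partial>gaussian 1)"
        using x(2) by (intro integral_ge_const[OF x(1)] AE_I2) (simp add: algebra_simps)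
      then show "m \<le> 1 + (\<integral>q. x q \<partial>gaussian 1)" by simp
      have "(\<integral>q. x q \<partial>gaussian 1) \<le> M - 1"
        using x(3) by (intro integral_le_const[OF x(1)] AE_I2) (simp add: algebra_simps)
      then show "1 + (\<integral>q. x q \<partial>gaussian 1) \<le> M" by simp
    qed
    have rng: "m \<le> 1 + \<alpha>0" "1 + \<alpha>0 \<le> M" "m \<le> 1 + \<beta>0" "1 + \<beta>0 \<le> M"
      unfolding \<alpha>0_def \<beta>0_def by (rule avg i\<alpha> i\<beta> \<alpha>r \<beta>r)+
    have T: "1 + c * (\<alpha>0 + \<beta>0) - K3 * s ^ 3 \<le> T"
    proof -
      have 1: "1 + c * (\<alpha>0 + \<beta>0) + c\<^sup>2 * (\<alpha>0 * \<beta>0) - k * (\<alpha>0\<^sup>2 + \<beta>0\<^sup>2) - L * (\<bar>\<alpha>0\<bar> + \<bar>\<beta>0\<bar>) ^ 3 \<le> T"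
        using L(2)[OF rng] unfolding T_def by linarith
      have "(\<bar>\<alpha>0\<bar> + \<bar>\<beta>0\<bar>) ^ 3 \<le> (2 * u) ^ 3" using \<alpha>0 \<beta>0 by (intro power_mono) auto
      then have 2: "L * (\<bar>\<alpha>0\<bar> + \<bar>\<beta>0\<bar>) ^ 3 \<le> L * (2 * u) ^ 3" using L by (intro mult_left_mono)
      have tri: "\<bar>t * (x * y)\<bar> \<le> u * u" if "0 \<le> t" "t \<le> 1" "\<bar>x\<bar> \<le> u" "\<bar>y\<bar> \<le> u" for t x y
      proof -
        have "\<bar>t\<bar> * (\<bar>x\<bar> * \<bar>y\<bar>) \<le> 1 * (u * u)" using that u by (intro mult_mono) auto
        then show ?thesis by (simp add: abs_mult)
      qed
      have 3: "c\<^sup>2 * (\<alpha>0 * \<beta>0) - k * (\<alpha>0\<^sup>2 + \<beta>0\<^sup>2) \<ge> - 3 * (u * u)"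
        using tri[OF c1 \<alpha>0 \<beta>0] tri[OF k \<alpha>0 \<alpha>0] tri[OF k \<beta>0 \<beta>0]
        unfolding distrib_left power2_eq_square[of \<alpha>0] power2_eq_square[of \<beta>0] by linarith
      have "u * u = K1\<^sup>2 * W\<^sup>2 * s ^ 4" by (simp add: u_def power2_eq_square eval_nat_numeral)
      also have "\<dots> \<le> K1\<^sup>2 * W\<^sup>2 * s ^ 3" using s by (intro mult_left_mono power_decreasing) auto
      finally have 4: "u * u \<le> K1\<^sup>2 * W\<^sup>2 * s ^ 3" .
      have "L * (2 * u) ^ 3 = L * (2 * K1 * W) ^ 3 * s ^ 6"
        by (simp add: u_def power_mult_distrib power_mult[symmetric])
      also have "\<dots> \<le> L * (2 * K1 * W) ^ 3 * s ^ 3" using s L K1 W1 by (intro mult_left_mono power_decreasing) auto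
      finally have 5: "L * (2 * u) ^ 3 \<le> L * (2 * K1 * W) ^ 3 * s ^ 3" .
      show ?thesis using 1 2 3 4 5 by (simp add: K3_def distrib_right)
    qed
    have ST: "S \<le> T + (K2 * W + K3) * s ^ 3" using S T by (simp add: distrib_right)
    have "smooth h (\<lambda>q. A q powr c * B q powr c) 0 = (\<integral>q. A 0 powr c * B 0 powr c * ((1 + \<alpha> q) powr c * (1 + \<beta> q) powr c) \<partial>gaussian 1)"
      unfolding smooth_def
    proof (intro Bochner_Integration.integral_cong refl)
      fix q
      have "A (s *\<^sub>R q) = A 0 * (1 + \<alpha> q)" "B (s *\<^sub>R q) = B 0 * (1 + \<beta> q)" using A0 B0 by (auto simp: \<alpha>_def \<beta>_def)
      then show "A (0 + sqrt h *\<^sub>R q) powr c * B (0 + sqrt h *\<^sub>R q) powr c = A 0 powr c * B 0 powr c * ((1 + \<alpha> q) powr c * (1 + \<beta> q) powr c)"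
        unfolding s_def[symmetric] using A0 B0 \<alpha>r(1)[of q] \<beta>r(1)[of q] mM by (simp add: powr_mult)
    qed
    also have "\<dots> = A 0 powr c * B 0 powr c * S" unfolding S_def by simp
    also have "\<dots> \<le> A 0 powr c * B 0 powr c * (T + (K2 * W + K3) * s ^ 3)" using ST by (intro mult_left_mono) auto
    also have "\<dots> = A 0 powr c * B 0 powr c * T + A 0 powr c * B 0 powr c * ((K2 * W + K3) * s ^ 3)" by (simp add: distrib_left)
    also have "\<dots> \<le> A 0 powr c * B 0 powr c * T + hi powr c * hi powr c * ((K2 * W + K3) * s ^ 3)"
      using A0 B0 c K2 K3 W1 s by (intro add_left_mono mult_right_mono mult_mono powr_mono2) auto
    also have "A 0 powr c * B 0 powr c * T = smooth h A 0 powr c * smooth h B 0 powr c"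
    proof -
      have "smooth h A 0 = (\<integral>q. A 0 * (1 + \<alpha> q) \<partial>gaussian 1)" "smooth h B 0 = (\<integral>q. B 0 * (1 + \<beta> q) \<partial>gaussian 1)"
        unfolding smooth_def using A0 B0 by (auto simp: \<alpha>_def \<beta>_def s_def)
      then have "smooth h A 0 = A 0 * (1 + \<alpha>0)" "smooth h B 0 = B 0 * (1 + \<beta>0)"
        unfolding \<alpha>0_def \<beta>0_def using i\<alpha> i\<beta> prob_space by auto
      moreover have "0 \<le> 1 + \<alpha>0" "0 \<le> 1 + \<beta>0" using rng mM by linarith+
      ultimately show ?thesis using A0 B0 by (simp add: T_def powr_mult)
    qed
    finally show "smooth h (\<lambda>q. A q powr c * B q powr c) 0 \<le> smooth h A 0 powr c * smooth h B 0 powr c + K4 * sqrt h ^ 3"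
      by (simp add: K4_def s_def mult_ac)
  qed
qed

section \<open>From small steps to the whole heat flow\<close>

lemma smooth_mono_add:
  assumes [measurable]: "H \<in> borel_measurable borel" "H' \<in> borel_measurable borel"
    and B: "\<And>x. \<bar>H x\<bar> \<le> B" "\<And>x. \<bar>H' x\<bar> \<le> B'" and le: "\<And>x. H x \<le> H' x + C"
  shows "smooth t H p \<le> smooth t H' p + C"
proof -
  interpret prob_space "gaussian 1 :: 'a measure" by (rule prob_gaussian1)
  have i: "integrable (gaussian 1) (\<lambda>q. H (p + sqrt t *\<^sub>R q))" "integrable (gaussian 1) (\<lambda>q. H' (p + sqrt t *\<^sub>R q))"
    using B by (auto intro!: integrable_gaussian_bounded)
  have "smooth t H p \<le> (\<integral>q. H' (p + sqrt t *\<^sub>R q) + C \<partial>gaussian 1)"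
    unfolding smooth_def using i le by (intro Bochner_Integration.integral_mono) auto
  also have "\<dots> = smooth t H' p + C"
    unfolding smooth_def using i prob_space by simp
  finally show ?thesis .
qed

lemma smooth_abs_bound:
  assumes "H \<in> borel_measurable borel" and B: "\<And>x. \<bar>H x\<bar> \<le> B"
  shows "\<bar>smooth t H p\<bar> \<le> B"
proof -
  have "- B \<le> H x" "H x \<le> B" for x using B[of x] by auto
  from smooth_bounds[OF assms(1) this] show ?thesis by (simp add: abs_le_iff minus_le_iff)
qed

lemma linear_rotate: "linear (\<lambda>q::'a::real_vector \<times> 'a. r *\<^sub>R fst q + s *\<^sub>R snd q)"
  by (rule linearI) (auto simp: algebra_simps)

lemma norm_rotate_le:
  fixes q :: "'a::euclidean_space \<times> 'a"
  assumes "r\<^sup>2 + s\<^sup>2 = 1"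
  shows "norm (r *\<^sub>R fst q + s *\<^sub>R snd q) \<le> norm q"
proof -
  let ?x = "norm (fst q)" and ?y = "norm (snd q)"
  have "(norm (r *\<^sub>R fst q + s *\<^sub>R snd q))\<^sup>2 \<le> (\<bar>r\<bar> * ?x + \<bar>s\<bar> * ?y)\<^sup>2"
    using norm_triangle_ineq[of "r *\<^sub>R fst q" "s *\<^sub>R snd q"] by (intro power_mono) auto
  \<comment> \<open>Lagrange's identity.\<close>
  also have "\<dots> = (r\<^sup>2 + s\<^sup>2) * (?x\<^sup>2 + ?y\<^sup>2) - (\<bar>s\<bar> * ?x - \<bar>r\<bar> * ?y)\<^sup>2"
    by (simp add: power2_eq_square algebra_simps abs_mult_self_eq)
  also have "\<dots> \<le> (norm q)\<^sup>2" using assms by (simp add: norm_prod_def)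
  finally show ?thesis by (rule power2_le_imp_le) simp
qed

text \<open>The functional \<open>\<Psi>\<close> below interpolates between both sides along the heat flow; each of its \<open>n\<close> steps
  costs \<open>O (n powr (- 3 / 2))\<close>. The initial smoothing by \<open>\<epsilon>\<close> makes the expansions uniform up to the end of
  the flow.\<close>

lemma hypercontractive_smooth:
  fixes F G :: "'a::euclidean_space \<Rightarrow> real" and lo hi r s c \<epsilon> :: real
  assumes lo: "0 < lo" "lo \<le> hi" and r: "0 < r" "0 < s" "r\<^sup>2 + s\<^sup>2 = 1" and c: "c = 1 / (1 + r)"
    and \<epsilon>: "\<epsilon> > 0"
    and [measurable]: "F \<in> borel_measurable borel" "G \<in> borel_measurable borel"
    and F: "\<And>x. lo \<le> F x \<and> F x \<le> hi" and G: "\<And>x. lo \<le> G x \<and> G x \<le> hi"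
  shows "smooth 1 (\<lambda>q::'a \<times> 'a. smooth \<epsilon> F (fst q) powr c * smooth \<epsilon> G (r *\<^sub>R fst q + s *\<^sub>R snd q) powr c) 0
    \<le> smooth 1 (smooth \<epsilon> F) 0 powr c * smooth 1 (smooth \<epsilon> G) 0 powr c"
proof -
  define L where "L q = r *\<^sub>R fst q + s *\<^sub>R snd q" for q :: "'a \<times> 'a"
  have [measurable]: "L \<in> borel_measurable borel"
    unfolding L_def by (intro borel_measurable_continuous_onI continuous_intros)
  have [measurable]: "fst \<in> borel_measurable (borel :: ('a \<times> 'a) measure)"
    by (intro borel_measurable_continuous_onI continuous_intros)
  have L: "linear L" "distr (gaussian 1) borel L = gaussian 1"
    using linear_rotate distr_gaussian_rotate[of 1 r s] r unfolding L_def by auto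
  have fst: "linear (fst :: 'a \<times> 'a \<Rightarrow> 'a)" "distr (gaussian 1) borel (fst :: 'a \<times> 'a \<Rightarrow> 'a) = gaussian 1"
    using distr_gaussian_fst[of 1] by (auto simp: linear_fst)
  define fA where "fA \<tau> q = smooth (\<tau> + \<epsilon>) F (fst q)" for \<tau> and q :: "'a \<times> 'a"
  define fB where "fB \<tau> q = smooth (\<tau> + \<epsilon>) G (L q)" for \<tau> and q :: "'a \<times> 'a"
  define P where "P \<tau> q = fA \<tau> q powr c * fB \<tau> q powr c" for \<tau> and q :: "'a \<times> 'a"
  have [measurable]: "fA \<tau> \<in> borel_measurable borel" "fB \<tau> \<in> borel_measurable borel" for \<tau>
    unfolding fA_def fB_def by measurable
  have [measurable]: "P \<tau> \<in> borel_measurable borel" for \<tau>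
    unfolding P_def by measurable
  have c0: "0 < c" using r by (simp add: c)
  have Fabs: "\<bar>F x\<bar> \<le> hi" "\<bar>G x\<bar> \<le> hi" for x using F[of x] G[of x] lo by auto
  have fAb: "lo \<le> fA \<tau> q" "fA \<tau> q \<le> hi" and fBb: "lo \<le> fB \<tau> q" "fB \<tau> q \<le> hi" for \<tau> q
    unfolding fA_def fB_def using F G by (auto intro!: smooth_bounds)
  have Pb: "\<bar>P \<tau> q\<bar> \<le> hi powr c * hi powr c" for \<tau> q
    unfolding P_def abs_mult using fAb[of \<tau> q] fBb[of \<tau> q] lo c0 by (intro mult_mono) (auto intro!: powr_mono2)
  have flowA: "smooth h (fA \<tau>) q = fA (\<tau> + h) q" if "0 \<le> h" "0 \<le> \<tau>" for h \<tau> q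
    unfolding fA_def using that \<epsilon> Fabs
    by (subst smooth_linear[OF fst]) (auto simp: smooth_smooth[of _ _ _ hi] add_ac)
  have flowB: "smooth h (fB \<tau>) q = fB (\<tau> + h) q" if "0 \<le> h" "0 \<le> \<tau>" for h \<tau> q
    unfolding fB_def using that \<epsilon> Fabs
    by (subst smooth_linear[OF L]) (auto simp: smooth_smooth[of _ _ _ hi] add_ac)
  obtain K where K: "K \<ge> 0" "\<And>H p. H \<in> borel_measurable borel \<Longrightarrow> (\<And>x::'a. \<bar>H x\<bar> \<le> hi) \<Longrightarrow>
    \<exists>a. norm a \<le> K \<and> (\<forall>u. \<bar>smooth \<epsilon> H (p + u) - smooth \<epsilon> H p - a \<bullet> u\<bar> \<le> K * (norm u)\<^sup>2)"
    using smooth_expand[OF \<epsilon>, of hi] by blast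
  \<comment> \<open>Split off the last \<open>\<epsilon>\<close> of smoothing:
    \<open>smooth \<tau> H\<close> obeys the same bounds as \<open>H\<close>, so \<open>K\<close>
    does not depend on \<open>\<tau>\<close>.\<close>
  have expand: "\<exists>a. norm a \<le> K \<and> (\<forall>u. \<bar>smooth (\<tau> + \<epsilon>) H (p + u) - smooth (\<tau> + \<epsilon>) H p - a \<bullet> u\<bar> \<le> K * (norm u)\<^sup>2)"
    if "0 \<le> \<tau>" "H \<in> borel_measurable borel" "\<And>x. lo \<le> H x \<and> H x \<le> hi" for \<tau> H and p :: 'a
  proof -
    have [measurable]: "H \<in> borel_measurable borel" by fact
    have "\<bar>H x\<bar> \<le> hi" for x using that(3)[of x] lo by auto
    then have "smooth (\<tau> + \<epsilon>) H = smooth \<epsilon> (smooth \<tau> H)"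
      using that \<epsilon> by (intro ext) (simp add: smooth_smooth[of _ _ _ hi] add.commute)
    moreover have "\<bar>smooth \<tau> H x\<bar> \<le> hi" for x
      using smooth_bounds[of H lo hi \<tau> x] that lo by auto
    ultimately show ?thesis using K(2)[of "smooth \<tau> H" p] by simp
  qed
  obtain K' where K': "K' \<ge> 0"
    and loc: "\<And>(A :: 'a \<times> 'a \<Rightarrow> real) B a b h.
      A \<in> borel_measurable borel \<Longrightarrow> B \<in> borel_measurable borel \<Longrightarrow>
      (\<And>q. lo \<le> A q \<and> A q \<le> hi) \<Longrightarrow> (\<And>q. lo \<le> B q \<and> B q \<le> hi) \<Longrightarrow>
      norm a \<le> K \<Longrightarrow> norm b \<le> K \<Longrightarrow> a \<bullet> b \<le> r * norm a * norm b \<Longrightarrow>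
      (\<And>u. \<bar>A u - A 0 - a \<bullet> u\<bar> \<le> K * (norm u)\<^sup>2) \<Longrightarrow>
      (\<And>u. \<bar>B u - B 0 - b \<bullet> u\<bar> \<le> K * (norm u)\<^sup>2) \<Longrightarrow> 0 < h \<Longrightarrow> h \<le> 1 \<Longrightarrow>
      smooth h (\<lambda>q. A q powr c * B q powr c) 0
        \<le> smooth h A 0 powr c * smooth h B 0 powr c + K' * sqrt h ^ 3"
    using hypercontractive_local[OF lo K(1) r(1) c, where 'e = "'a \<times> 'a"] by blast
  have step: "smooth h (P \<tau>) p \<le> P (\<tau> + h) p + K' * sqrt h ^ 3" if th: "0 \<le> \<tau>" "0 < h" "h \<le> 1" for \<tau> h p
  proof -
    obtain a where a: "norm a \<le> K" "\<And>u. \<bar>smooth (\<tau> + \<epsilon>) F (fst p + u) - smooth (\<tau> + \<epsilon>) F (fst p) - a \<bullet> u\<bar> \<le> K * (norm u)\<^sup>2"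
      using expand[of \<tau> F "fst p"] th(1) F by auto
    obtain b where b: "norm b \<le> K" "\<And>u. \<bar>smooth (\<tau> + \<epsilon>) G (L p + u) - smooth (\<tau> + \<epsilon>) G (L p) - b \<bullet> u\<bar> \<le> K * (norm u)\<^sup>2"
      using expand[of \<tau> G "L p"] th(1) G by auto
    \<comment> \<open>The first-order coefficient of \<open>fB\<close> on the product space. As
      \<open>r\<^sup>2 + s\<^sup>2 = 1\<close>, its norm is that of \<open>b\<close>, while its
      inner product with \<open>(a, 0)\<close> is \<open>r\<close> times
      \<open>a \<bullet> b\<close>.\<close>
    let ?b = "(r *\<^sub>R b, s *\<^sub>R b)"
    have nb: "norm ?b = norm b"
    proof -
      have "(norm ?b)\<^sup>2 = (r\<^sup>2 + s\<^sup>2) * (norm b)\<^sup>2" by (simp add: norm_Pair power_mult_distrib distrib_right)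
      then show ?thesis using r(3) by simp
    qed
    have "smooth h (\<lambda>q. fA \<tau> (p + q) powr c * fB \<tau> (p + q) powr c) 0
      \<le> smooth h (\<lambda>q. fA \<tau> (p + q)) 0 powr c * smooth h (\<lambda>q. fB \<tau> (p + q)) 0 powr c + K' * sqrt h ^ 3"
    proof (rule loc[of _ _ "(a, 0)" ?b])
      show "norm (a, 0::'a) \<le> K" using a by (simp add: norm_Pair)
      show "norm ?b \<le> K" using b by (simp add: nb)
      have "a \<bullet> b \<le> norm a * norm b" by (rule norm_cauchy_schwarz)
      then show "(a, 0) \<bullet> ?b \<le> r * norm (a, 0::'a) * norm ?b"
        unfolding nb using r by (simp add: norm_Pair mult.assoc)
      fix u :: "'a \<times> 'a"
      have "(norm (fst u))\<^sup>2 \<le> (norm u)\<^sup>2" by (simp add: norm_prod_def)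
      then have "K * (norm (fst u))\<^sup>2 \<le> K * (norm u)\<^sup>2" using K by (intro mult_left_mono) auto
      moreover have "(a, 0) \<bullet> u = a \<bullet> fst u" by (cases u) simp
      ultimately show "\<bar>fA \<tau> (p + u) - fA \<tau> (p + 0) - (a, 0) \<bullet> u\<bar> \<le> K * (norm u)\<^sup>2"
        using a(2)[of "fst u"] by (simp add: fA_def)
      have "(norm (L u))\<^sup>2 \<le> (norm u)\<^sup>2" using norm_rotate_le[OF r(3), of u] unfolding L_def by (intro power_mono) auto
      then have "K * (norm (L u))\<^sup>2 \<le> K * (norm u)\<^sup>2" using K by (intro mult_left_mono) auto
      moreover have "?b \<bullet> u = b \<bullet> L u" by (cases u) (simp add: L_def inner_add_right)
      ultimately show "\<bar>fB \<tau> (p + u) - fB \<tau> (p + 0) - ?b \<bullet> u\<bar> \<le> K * (norm u)\<^sup>2"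
        using b(2)[of "L u"] L(1) by (simp add: fB_def linear_add)
    qed (use th fAb fBb in auto)
    moreover have "smooth h (\<lambda>q. H (p + q)) 0 = smooth h H p" for H by (simp add: smooth_def)
    ultimately show ?thesis
      using th flowA[of h \<tau> p] flowB[of h \<tau> p]
      unfolding P_def[abs_def] by (simp add: smooth_def)
  qed
  have main: "smooth 1 (P 0) 0 \<le> P 1 0 + K' / sqrt (real n)" if n: "n > 0" for n :: nat
  proof -
    \<comment> \<open>After \<open>k\<close> of \<open>n\<close> steps the flow time
      \<open>k / n\<close> has moved from inside the product of powers to outside:
      \<open>k = 0\<close> is the right-hand side of the claim, \<open>k = n\<close> the left-hand
      side.\<close>
    define \<Psi> where "\<Psi> k = smooth (real k / n) (P (real (n - k) / n)) 0" for k
    have 1: "\<Psi> (Suc k) \<le> \<Psi> k + K' * sqrt (1 / n) ^ 3" if "k < n" for k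
    proof -
      have nk: "real (n - Suc k) / n + 1 / n = real (n - k) / n"
        using that by (simp add: add_divide_distrib[symmetric])
      have "\<Psi> (Suc k) = smooth (real k / n) (smooth (1 / n) (P (real (n - Suc k) / n))) 0"
        unfolding \<Psi>_def using Pb by (subst smooth_smooth[where B = "hi powr c * hi powr c"]) (auto simp: add_divide_distrib add.commute)
      also have "\<dots> \<le> smooth (real k / n) (P (real (n - k) / n)) 0 + K' * sqrt (1 / n) ^ 3"
      proof (rule smooth_mono_add)
        show "\<bar>smooth (1 / n) (P (real (n - Suc k) / n)) x\<bar> \<le> hi powr c * hi powr c" for x
          by (rule smooth_abs_bound) (use Pb in auto)
        show "smooth (1 / n) (P (real (n - Suc k) / n)) x \<le> P (real (n - k) / n) x + K' * sqrt (1 / n) ^ 3" for x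
          using step[of "real (n - Suc k) / n" "1 / n" x] n unfolding nk by simp
      qed (use Pb in auto)
      finally show ?thesis by (simp add: \<Psi>_def)
    qed
    have 2: "\<Psi> k \<le> \<Psi> 0 + k * (K' * sqrt (1 / n) ^ 3)" if "k \<le> n" for k
      using that
    proof (induction k)
      case (Suc k)
      then show ?case using 1[of k] by (simp add: algebra_simps)
    qed simp
    have "real n * (K' * sqrt (1 / n) ^ 3) = K' / sqrt n"
      using n by (simp add: power3_eq_cube real_sqrt_divide divide_simps)
    then show ?thesis using 2[of n] n by (simp add: \<Psi>_def smooth_0)
  qed
  have "(\<lambda>n. P 1 0 + K' / sqrt (real n)) \<longlonglongrightarrow> P 1 0 + 0"
    by (intro tendsto_add tendsto_const tendsto_divide_0[OF tendsto_const]
        filterlim_at_top_imp_at_infinity filterlim_compose[OF sqrt_at_top filterlim_real_sequentially])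
  then have "smooth 1 (P 0) 0 \<le> P 1 0 + 0"
    by (rule LIMSEQ_le_const) (auto intro!: exI[of _ 1] main)
  moreover have "fA 1 0 = smooth 1 (smooth \<epsilon> F) 0" "fB 1 0 = smooth 1 (smooth \<epsilon> G) 0"
    unfolding fA_def fB_def using \<epsilon> Fabs L(1) by (auto simp: smooth_smooth[of _ _ _ hi] linear_0)
  ultimately show ?thesis by (simp add: P_def[abs_def] fA_def fB_def L_def)
qed

section \<open>Removal of the smoothing and the dual form\<close>

lemma continuous_on_param_integral:
  fixes H :: "'a::euclidean_space \<Rightarrow> 'b \<Rightarrow> real"
  assumes "prob_space \<mu>" and cont: "\<And>z. continuous_on UNIV (\<lambda>x. H x z)"
    and meas: "\<And>x. H x \<in> borel_measurable \<mu>" and B: "\<And>x z. \<bar>H x z\<bar> \<le> B"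
  shows "continuous_on UNIV (\<lambda>x. \<integral>z. H x z \<partial>\<mu>)"
  unfolding continuous_on_sequentially
proof (intro ballI allI impI)
  interpret prob_space \<mu> by fact
  fix x and u :: "nat \<Rightarrow> 'a" assume u: "(\<forall>n. u n \<in> UNIV) \<and> u \<longlonglongrightarrow> x"
  have "(\<lambda>n. \<integral>z. H (u n) z \<partial>\<mu>) \<longlonglongrightarrow> (\<integral>z. H x z \<partial>\<mu>)"
  proof (rule integral_dominated_convergence[where w = "\<lambda>_. B"])
    show "AE z in \<mu>. (\<lambda>n. H (u n) z) \<longlonglongrightarrow> H x z"
    proof (rule AE_I2)
      fix z show "(\<lambda>n. H (u n) z) \<longlonglongrightarrow> H x z"
        using continuous_on_tendsto_compose[OF cont[of z], of u x] u by auto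
    qed
  qed (use B meas in auto)
  then show "((\<lambda>x. \<integral>z. H x z \<partial>\<mu>) \<circ> u) \<longlonglongrightarrow> (\<integral>z. H x z \<partial>\<mu>)" by (simp add: o_def)
qed

lemma smooth_tendsto:
  fixes F :: "'a::euclidean_space \<Rightarrow> real"
  assumes cont: "continuous_on UNIV F" and B: "\<And>x. \<bar>F x\<bar> \<le> B" and e: "e \<longlonglongrightarrow> 0"
  shows "(\<lambda>n. smooth (e n) F x) \<longlonglongrightarrow> F x"
proof -
  interpret prob_space "gaussian 1 :: 'a measure" by (rule prob_gaussian1)
  have [measurable]: "F \<in> borel_measurable borel" using cont by (rule borel_measurable_continuous_onI)
  have "(\<lambda>n. smooth (e n) F x) \<longlonglongrightarrow> (\<integral>q. F x \<partial>(gaussian 1 :: 'a measure))"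
    unfolding smooth_def
  proof (rule integral_dominated_convergence[where w = "\<lambda>_. B"])
    show "AE q in gaussian 1. (\<lambda>n. F (x + sqrt (e n) *\<^sub>R q)) \<longlonglongrightarrow> F x"
    proof (rule AE_I2)
      fix q :: 'a
      have "(\<lambda>n. x + sqrt (e n) *\<^sub>R q) \<longlonglongrightarrow> x + sqrt 0 *\<^sub>R q"
        using e by (intro tendsto_intros)
      then show "(\<lambda>n. F (x + sqrt (e n) *\<^sub>R q)) \<longlonglongrightarrow> F x"
        using continuous_on_tendsto_compose[OF cont] by simp
    qed
  qed (use B in auto)
  then show ?thesis using prob_space by simp
qed

text \<open>The limit of \<open>hypercontractive_smooth\<close> as the smoothing disappears, by
  dominated convergence. Continuity of \<open>F\<close> and \<open>G\<close> gives the pointwise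
  limits, and \<open>lo\<close> keeps the bases of the powers away from 0.\<close>

lemma hypercontractive_bilinear:
  fixes F G :: "'a::euclidean_space \<Rightarrow> real" and lo hi r s c :: real
  assumes lo: "0 < lo" "lo \<le> hi" and r: "0 < r" "0 < s" "r\<^sup>2 + s\<^sup>2 = 1" and c: "c = 1 / (1 + r)"
    and cont: "continuous_on UNIV F" "continuous_on UNIV G"
    and F: "\<And>x. lo \<le> F x \<and> F x \<le> hi" and G: "\<And>x. lo \<le> G x \<and> G x \<le> hi"
  shows "(\<integral>x. F x powr c * (\<integral>y. G (r *\<^sub>R x + s *\<^sub>R y) powr c \<partial>gaussian 1) \<partial>gaussian 1)
    \<le> (\<integral>x. F x \<partial>gaussian 1) powr c * (\<integral>x. G x \<partial>gaussian 1) powr c"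
proof -
  interpret g: prob_space "gaussian 1 :: 'a measure" by (rule prob_gaussian1)
  interpret g2: prob_space "gaussian 1 :: ('a \<times> 'a) measure" by (rule prob_gaussian1)
  interpret pair_prob_space "gaussian 1 :: 'a measure" "gaussian 1 :: 'a measure" ..
  have [measurable]: "F \<in> borel_measurable borel" "G \<in> borel_measurable borel"
    using cont by (auto intro: borel_measurable_continuous_onI)
  define e where "e n = inverse (real (Suc n))" for n
  have e: "e \<longlonglongrightarrow> 0" "\<And>n. e n > 0" unfolding e_def using LIMSEQ_inverse_real_of_nat by auto
  have c0: "0 < c" using r by (simp add: c)
  have Fabs: "\<bar>F x\<bar> \<le> hi" "\<bar>G x\<bar> \<le> hi" for x using F[of x] G[of x] lo by auto
  have bF: "lo \<le> smooth t F x" "smooth t F x \<le> hi" and bG: "lo \<le> smooth t G x" "smooth t G x \<le> hi" for t x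
    using F G by (auto intro!: smooth_bounds)
  define L where "L q = r *\<^sub>R fst q + s *\<^sub>R snd q" for q :: "'a \<times> 'a"
  have [measurable]: "L \<in> borel_measurable borel"
    unfolding L_def by (intro borel_measurable_continuous_onI continuous_intros)
  have [measurable]: "fst \<in> borel_measurable (borel :: ('a \<times> 'a) measure)"
    by (intro borel_measurable_continuous_onI continuous_intros)
  have powb: "\<bar>x powr c * y powr c\<bar> \<le> hi powr c * hi powr c" if "lo \<le> x" "x \<le> hi" "lo \<le> y" "y \<le> hi" for x y
    unfolding abs_mult using that lo c0 by (intro mult_mono) (auto intro!: powr_mono2)
  have le: "(\<integral>q. smooth (e n) F (fst q) powr c * smooth (e n) G (L q) powr c \<partial>gaussian 1)
      \<le> smooth 1 (smooth (e n) F) 0 powr c * smooth 1 (smooth (e n) G) 0 powr c" for n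
    using hypercontractive_smooth[OF lo r c e(2)[of n], of F G] F G by (simp add: smooth_def[of 1] L_def)
  have lim1: "(\<lambda>n. \<integral>q. smooth (e n) F (fst q) powr c * smooth (e n) G (L q) powr c \<partial>gaussian 1)
      \<longlonglongrightarrow> (\<integral>q. F (fst q) powr c * G (L q) powr c \<partial>gaussian 1)"
  proof (rule integral_dominated_convergence[where w = "\<lambda>_. hi powr c * hi powr c"])
    show "AE q in gaussian 1. (\<lambda>n. smooth (e n) F (fst q) powr c * smooth (e n) G (L q) powr c) \<longlonglongrightarrow> F (fst q) powr c * G (L q) powr c"
    proof (rule AE_I2)
      fix q
      have "F (fst q) \<noteq> 0" "G (L q) \<noteq> 0" using F[of "fst q"] G[of "L q"] lo by auto
      then show "(\<lambda>n. smooth (e n) F (fst q) powr c * smooth (e n) G (L q) powr c) \<longlonglongrightarrow> F (fst q) powr c * G (L q) powr c"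
        by (intro tendsto_mult tendsto_powr smooth_tendsto[OF cont(1) Fabs(1) e(1)] smooth_tendsto[OF cont(2) Fabs(2) e(1)] tendsto_const)
    qed
  qed (use powb bF bG in auto)
  have lim2: "(\<lambda>n. smooth 1 (smooth (e n) H) 0) \<longlonglongrightarrow> (\<integral>x. H x \<partial>gaussian 1)"
    if H: "continuous_on UNIV H" "\<And>x. lo \<le> H x \<and> H x \<le> hi" for H :: "'a \<Rightarrow> real"
  proof -
    have [measurable]: "H \<in> borel_measurable borel" using H(1) by (rule borel_measurable_continuous_onI)
    have Hb: "\<bar>H x\<bar> \<le> hi" for x using H(2)[of x] lo by auto
    have bH: "lo \<le> smooth t H x" "smooth t H x \<le> hi" for t x using H(2) by (auto intro!: smooth_bounds)
    have "(\<lambda>n. \<integral>q. smooth (e n) H q \<partial>gaussian 1) \<longlonglongrightarrow> (\<integral>x. H x \<partial>gaussian 1)"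
    proof (rule integral_dominated_convergence[where w = "\<lambda>_. hi"])
      show "AE q in gaussian 1. norm (smooth (e n) H q) \<le> hi" for n
        using bH[of "e n"] lo by (intro AE_I2) (smt (verit) real_norm_def)
    qed (use smooth_tendsto[OF H(1) Hb e(1)] in auto)
    then show ?thesis by (simp add: smooth_def[of 1])
  qed
  have pos: "(\<integral>x. F x \<partial>gaussian 1) \<noteq> 0" "(\<integral>x. G x \<partial>gaussian 1) \<noteq> 0"
    using smooth_bounds(1)[of F lo hi 1 0] smooth_bounds(1)[of G lo hi 1 0] F G lo by (auto simp: smooth_def)
  have "(\<integral>q. F (fst q) powr c * G (L q) powr c \<partial>gaussian 1) \<le> (\<integral>x. F x \<partial>gaussian 1) powr c * (\<integral>x. G x \<partial>gaussian 1) powr c"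
    using le lim1 pos
    by (intro LIMSEQ_le[OF lim1 tendsto_mult[OF tendsto_powr[OF lim2 tendsto_const] tendsto_powr[OF lim2 tendsto_const]]])
      (auto simp: cont F G)
  also have "(\<integral>q. F (fst q) powr c * G (L q) powr c \<partial>gaussian 1)
      = (\<integral>q. F (fst q) powr c * G (L q) powr c \<partial>(gaussian 1 \<Otimes>\<^sub>M gaussian 1))"
    by (simp add: gaussian_pair)
  also have "\<dots> = (\<integral>x. \<integral>y. F x powr c * G (L (x, y)) powr c \<partial>gaussian 1 \<partial>gaussian 1)"
  proof (subst integral_fst'[symmetric])
    show "integrable (gaussian 1 \<Otimes>\<^sub>M gaussian 1) (\<lambda>q. F (fst q) powr c * G (L q) powr c)"
      using powb F G integrable_gaussian_bounded[of 1 "\<lambda>q. F (fst q) powr c * G (L q) powr c" "hi powr c * hi powr c"]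
      by (simp add: gaussian_pair)
  qed simp
  finally show ?thesis by (simp add: L_def)
qed

text \<open>A norm bound follows from the bilinear one by testing with the function that attains the
  dual norm. This makes the left-hand side equal to \<open>I\<close>, so that
  \<open>I \<le> I powr c * J powr c\<close>; the logarithm of this is the claim.\<close>

lemma hypercontractive:
  fixes f Pf :: "'a::euclidean_space \<Rightarrow> real"
  assumes lo: "0 < lo" and r: "0 < r" "r < 1" and v: "v > 0"
    and cont: "continuous_on UNIV f" and f: "\<And>x. lo \<le> f x \<and> f x \<le> hi"
    and Pf: "\<And>x. Pf x = (\<integral>z. f (r *\<^sub>R x + z) \<partial>gaussian ((1 - r\<^sup>2) * v))"
  shows "r * ln (\<integral>x. Pf x powr ((1 + r) / r) \<partial>gaussian v) \<le> ln (\<integral>x. f x powr (1 + r) \<partial>gaussian v)"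
proof -
  interpret g: prob_space "gaussian 1 :: 'a measure" by (rule prob_gaussian1)
  have [measurable]: "f \<in> borel_measurable borel"
    using cont by (rule borel_measurable_continuous_onI)
  define s where "s = sqrt (1 - r\<^sup>2)"
  have r2: "r\<^sup>2 < 1" using r by (simp add: power_less_one_iff)
  have s: "0 < s" "r\<^sup>2 + s\<^sup>2 = 1" using r2 by (auto simp: s_def)
  have v': "(1 - r\<^sup>2) * v > 0" using r2 v by simp
  define c where "c = 1 / (1 + r)"
  have c: "0 < c" using r by (simp add: c_def)
  have lohi: "lo \<le> hi" using f[of 0] by linarith
  have rescale: "(\<integral>x. h x \<partial>gaussian (k\<^sup>2 * 1)) = (\<integral>x. h (k *\<^sub>R x) \<partial>gaussian 1)"
    if "k \<noteq> 0" "h \<in> borel_measurable borel" for k and h :: "'a \<Rightarrow> real"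
    using that by (subst gaussian_scale[symmetric]) (auto simp: integral_distr)
  have rescale_v: "(\<integral>x. h x \<partial>gaussian v) = (\<integral>x. h (sqrt v *\<^sub>R x) \<partial>gaussian 1)"
    if "h \<in> borel_measurable borel" for h :: "'a \<Rightarrow> real"
    using rescale[of "sqrt v" h] v that by simp
  have Pf1: "Pf (sqrt v *\<^sub>R x) = (\<integral>y. f (sqrt v *\<^sub>R (r *\<^sub>R x + s *\<^sub>R y)) \<partial>gaussian 1)" for x
  proof -
    define k where "k = sqrt v * s"
    have k: "(1 - r\<^sup>2) * v = k\<^sup>2 * 1" "k \<noteq> 0" using v r2 s by (simp_all add: k_def s_def power_mult_distrib)
    have "Pf (sqrt v *\<^sub>R x) = (\<integral>y. f (r *\<^sub>R sqrt v *\<^sub>R x + k *\<^sub>R y) \<partial>gaussian 1)"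
      unfolding Pf k(1) by (rule rescale[OF k(2)]) measurable
    moreover have "r *\<^sub>R sqrt v *\<^sub>R x + k *\<^sub>R y = sqrt v *\<^sub>R (r *\<^sub>R x + s *\<^sub>R y)" for y
      by (simp add: k_def scaleR_add_right mult.commute)
    ultimately show ?thesis by simp
  qed
  have fb: "\<bar>f x\<bar> \<le> hi" for x using f[of x] lo by auto
  have Pf_bounds: "lo \<le> Pf x" "Pf x \<le> hi" for x
  proof -
    interpret gv: prob_space "gaussian ((1 - r\<^sup>2) * v) :: 'a measure" by (rule prob_space_gaussian[OF v'])
    have "integrable (gaussian ((1 - r\<^sup>2) * v)) (\<lambda>z. f (r *\<^sub>R x + z))"
      using fb by (intro integrable_gaussian_bounded[OF v']) auto
    then show "lo \<le> Pf x" "Pf x \<le> hi"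
      unfolding Pf using f by (auto intro!: gv.integral_ge_const gv.integral_le_const)
  qed
  have contP: "continuous_on UNIV Pf"
    unfolding Pf[abs_def] using fb
    by (intro continuous_on_param_integral[OF prob_space_gaussian[OF v'], of _ hi]
        continuous_on_compose2[OF cont] continuous_intros) auto
  have [measurable]: "Pf \<in> borel_measurable borel"
    using contP by (rule borel_measurable_continuous_onI)
  \<comment> \<open>The exponent \<open>c\<close> undoes these powers: \<open>G\<close> becomes
    \<open>f\<close>, and \<open>F\<close> becomes the power \<open>1 / r\<close> of
    \<open>Pf\<close>, whose product with the inner integral \<open>Pf\<close> is \<open>F\<close>
    again.\<close>
  define F where "F x = Pf (sqrt v *\<^sub>R x) powr ((1 + r) / r)" for x
  define G where "G x = f (sqrt v *\<^sub>R x) powr (1 + r)" for x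
  define I where "I = (\<integral>x. Pf x powr ((1 + r) / r) \<partial>gaussian v)"
  define J where "J = (\<integral>x. f x powr (1 + r) \<partial>gaussian v)"
  have IF: "I = (\<integral>x. F x \<partial>gaussian 1)" and JG: "J = (\<integral>x. G x \<partial>gaussian 1)"
    unfolding I_def J_def F_def G_def by (subst rescale_v; simp)+
  define lo' where "lo' = min (lo powr ((1 + r) / r)) (lo powr (1 + r))"
  define hi' where "hi' = max (hi powr ((1 + r) / r)) (hi powr (1 + r))"
  have lo': "0 < lo'" using lo by (simp add: lo'_def)
  have F: "lo' \<le> F x \<and> F x \<le> hi'" for x
  proof -
    have "lo powr ((1 + r) / r) \<le> F x" "F x \<le> hi powr ((1 + r) / r)"
      unfolding F_def using Pf_bounds[of "sqrt v *\<^sub>R x"] lo r by (auto intro!: powr_mono2)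
    then show ?thesis by (auto simp: lo'_def hi'_def)
  qed
  have G: "lo' \<le> G x \<and> G x \<le> hi'" for x
  proof -
    have "lo powr (1 + r) \<le> G x" "G x \<le> hi powr (1 + r)"
      unfolding G_def using f[of "sqrt v *\<^sub>R x"] lo r by (auto intro!: powr_mono2)
    then show ?thesis by (auto simp: lo'_def hi'_def)
  qed
  have lohi': "lo' \<le> hi'" using F[of 0] by linarith
  have cF: "continuous_on UNIV F" unfolding F_def
  proof (rule continuous_on_powr)
    show "continuous_on UNIV (\<lambda>x. Pf (sqrt v *\<^sub>R x))"
      by (intro continuous_on_compose2[OF contP] continuous_intros) auto
    show "\<forall>x\<in>UNIV. Pf (sqrt v *\<^sub>R x) \<noteq> 0"
    proof
      fix x show "Pf (sqrt v *\<^sub>R x) \<noteq> 0" using Pf_bounds(1)[of "sqrt v *\<^sub>R x"] lo by auto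
    qed
  qed (intro continuous_intros)
  have cG: "continuous_on UNIV G" unfolding G_def
  proof (rule continuous_on_powr)
    show "continuous_on UNIV (\<lambda>x. f (sqrt v *\<^sub>R x))"
      by (intro continuous_on_compose2[OF cont] continuous_intros) auto
    show "\<forall>x\<in>UNIV. f (sqrt v *\<^sub>R x) \<noteq> 0"
    proof
      fix x show "f (sqrt v *\<^sub>R x) \<noteq> 0" using f[of "sqrt v *\<^sub>R x"] lo by auto
    qed
  qed (intro continuous_intros)
  have Gc: "G x powr c = f (sqrt v *\<^sub>R x)" for x
    unfolding G_def c_def powr_powr using r f[of "sqrt v *\<^sub>R x"] lo by simp
  have Fc: "F x powr c = Pf (sqrt v *\<^sub>R x) powr (1 / r)" for x
    unfolding F_def c_def powr_powr using r by simp
  have "F x powr c * (\<integral>y. G (r *\<^sub>R x + s *\<^sub>R y) powr c \<partial>gaussian 1) = F x" for x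
  proof -
    have "F x powr c * (\<integral>y. G (r *\<^sub>R x + s *\<^sub>R y) powr c \<partial>gaussian 1) = Pf (sqrt v *\<^sub>R x) powr (1 / r) * Pf (sqrt v *\<^sub>R x)"
      unfolding Fc Gc Pf1 by simp
    also have "\<dots> = Pf (sqrt v *\<^sub>R x) powr (1 / r) * Pf (sqrt v *\<^sub>R x) powr 1"
      using Pf_bounds(1)[of "sqrt v *\<^sub>R x"] lo by simp
    also have "\<dots> = F x"
      unfolding F_def powr_add[symmetric] using r by (simp add: field_simps)
    finally show ?thesis .
  qed
  then have "I \<le> I powr c * J powr c"
    using hypercontractive_bilinear[OF lo' lohi' r(1) s c_def cF cG F G] by (simp add: IF JG)
  moreover have pos: "I > 0" "J > 0"
  proof -
    have [measurable]: "F \<in> borel_measurable borel" "G \<in> borel_measurable borel"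
      using cF cG by (auto intro: borel_measurable_continuous_onI)
    have "lo' \<le> smooth 1 F 0" using F by (intro smooth_bounds(1)[of F lo' hi']) auto
    moreover have "lo' \<le> smooth 1 G 0" using G by (intro smooth_bounds(1)[of G lo' hi']) auto
    ultimately show "I > 0" "J > 0" using lo' by (simp_all add: IF JG smooth_def)
  qed
  ultimately have "ln I \<le> ln (I powr c * J powr c)"
    by (subst ln_le_cancel_iff) auto
  also have "\<dots> = c * ln I + c * ln J" using pos by (simp add: ln_mult ln_powr)
  finally have "(1 + r) * ln I \<le> (1 + r) * (c * ln I + c * ln J)" using r by (intro mult_left_mono) auto
  also have "\<dots> = ((1 + r) * c) * (ln I + ln J)" by (simp only: distrib_left mult.assoc)
  also have "(1 + r) * c = 1" using r by (simp add: c_def)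
  finally show ?thesis unfolding I_def[symmetric] J_def[symmetric] by (simp add: algebra_simps)
qed

section \<open>One step of the algorithm\<close>

text \<open>Jensen's inequality through the tangent line of the exponential at the mean. The
  hypothesis on the nonnegative integral supplies integrability of the exponential.\<close>

lemma (in prob_space) integral_le_ln:
  assumes int: "integrable M \<psi>" and le: "(\<integral>\<^sup>+x. ennreal (exp (\<psi> x)) \<partial>M) \<le> ennreal Z" and Z: "Z > 0"
  shows "(\<integral>x. \<psi> x \<partial>M) \<le> ln Z"
proof -
  define m where "m = (\<integral>x. \<psi> x \<partial>M)"
  have [measurable]: "\<psi> \<in> borel_measurable M" using int by simp
  have ie: "integrable M (\<lambda>x. exp (\<psi> x))"
    using le by (intro integrableI_nonneg) (auto intro: le_less_trans)
  have "exp m = (\<integral>x. exp m * (1 + (\<psi> x - m)) \<partial>M)"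
    using int prob_space by (simp add: m_def[symmetric])
  also have "\<dots> \<le> (\<integral>x. exp (\<psi> x) \<partial>M)"
  proof (rule integral_mono)
    fix x
    have "exp m * (1 + (\<psi> x - m)) \<le> exp m * exp (\<psi> x - m)" by (intro mult_left_mono) auto
    also have "\<dots> = exp (\<psi> x)" by (simp add: exp_add[symmetric])
    finally show "exp m * (1 + (\<psi> x - m)) \<le> exp (\<psi> x)" .
  qed (use int ie in auto)
  also have "ennreal \<dots> \<le> ennreal Z"
    using le ie by (subst nn_integral_eq_integral[symmetric]) auto
  then have "(\<integral>x. exp (\<psi> x) \<partial>M) \<le> Z" using Z by (simp add: ennreal_le_iff)
  finally have "exp m \<le> Z" .
  then have "ln (exp m) \<le> ln Z" using Z by (subst ln_le_cancel_iff) auto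
  then show ?thesis by (simp add: m_def)
qed

section \<open>Monotone vector fields\<close>

lemma has_derivative_line:
  assumes "(V has_derivative V') (at x)"
  shows "((\<lambda>t. V (x + t *\<^sub>R h)) has_vector_derivative V' h) (at 0)"
proof -
  have "((\<lambda>t. x + t *\<^sub>R h) has_derivative (\<lambda>t. t *\<^sub>R h)) (at 0)"
    by (auto intro!: derivative_eq_intros)
  then have "((\<lambda>t. V (x + t *\<^sub>R h)) has_derivative (\<lambda>t. V' (t *\<^sub>R h))) (at 0)"
    by (rule has_derivative_compose) (use assms in simp)
  moreover have "V' (t *\<^sub>R h) = t *\<^sub>R V' h" for t
    using has_derivative_linear[OF assms] by (simp add: linear_cmul)
  ultimately show ?thesis by (simp add: has_vector_derivative_def)
qed

lemma difference_quotient_limit: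
  assumes "(V has_derivative V') (at x)"
  shows "((\<lambda>t. (V (x + t *\<^sub>R h) - V x) /\<^sub>R t) \<longlongrightarrow> V' h) (at (0::real))"
proof -
  have "((\<lambda>t. (V (x + t *\<^sub>R h) - V (x + 0 *\<^sub>R h) - (t - 0) *\<^sub>R V' h) /\<^sub>R norm (t - 0)) \<longlongrightarrow> 0) (at 0)"
    using has_derivative_line[OF assms, of h]
    by (simp add: has_vector_derivative_def has_derivative_def)
  then have "((\<lambda>t. norm ((V (x + t *\<^sub>R h) - V x - t *\<^sub>R V' h) /\<^sub>R norm t)) \<longlongrightarrow> 0) (at 0)"
    by (intro tendsto_norm_zero) simp
  moreover have "eventually (\<lambda>t. norm ((V (x + t *\<^sub>R h) - V x - t *\<^sub>R V' h) /\<^sub>R norm t)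
      = norm ((V (x + t *\<^sub>R h) - V x) /\<^sub>R t - V' h)) (at (0::real))"
  proof (rule eventually_at_filter[THEN iffD2], rule always_eventually, intro allI impI)
    fix t :: real assume t: "t \<noteq> 0"
    have "(V (x + t *\<^sub>R h) - V x) /\<^sub>R t - V' h = (V (x + t *\<^sub>R h) - V x - t *\<^sub>R V' h) /\<^sub>R t"
      using t by (simp add: scaleR_diff_right)
    then show "norm ((V (x + t *\<^sub>R h) - V x - t *\<^sub>R V' h) /\<^sub>R norm t) = norm ((V (x + t *\<^sub>R h) - V x) /\<^sub>R t - V' h)"
      by simp
  qed
  ultimately have "((\<lambda>t. norm ((V (x + t *\<^sub>R h) - V x) /\<^sub>R t - V' h)) \<longlongrightarrow> 0) (at 0)"
    by (rule Lim_transform_eventually)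
  then show ?thesis by (simp add: LIM_zero_iff tendsto_norm_zero_iff)
qed

text \<open>The drift of the algorithm is \<open>- \<alpha> (u + V u)\<close> evaluated at the noisy point \<open>u\<close>.\<close>

locale monotone_field =
  fixes V :: "'a::euclidean_space \<Rightarrow> 'a" and V' :: "'a \<Rightarrow> 'a \<Rightarrow>\<^sub>L 'a" and K :: real
  assumes deriv: "\<And>x. (V has_derivative blinfun_apply (V' x)) (at x)"
    and cont_deriv: "continuous_on UNIV V'"
    and mono: "\<And>x y. (V x - V y) \<bullet> (x - y) \<ge> 0"
    and lip: "\<And>x y. norm (V x - V y) \<le> K * norm (x - y)"
begin

definition divergence :: "'a \<Rightarrow> real" where
  "divergence x = (\<Sum>b\<in>Basis. blinfun_apply (V' x) b \<bullet> b)"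

lemma K_nonneg: "K \<ge> 0"
proof -
  obtain b :: 'a where b: "b \<in> Basis" using nonempty_Basis by blast
  have "0 \<le> K * norm (b - 0)" using lip[of b 0] norm_ge_zero order_trans by blast
  then show ?thesis using b by simp
qed

lemma continuous_V: "continuous_on UNIV V"
  using has_derivative_continuous[OF deriv] by (simp add: continuous_on_eq_continuous_at)

lemma continuous_divergence: "continuous_on UNIV divergence"
  unfolding divergence_def by (intro continuous_intros cont_deriv)

lemma measurable_V [measurable]: "V \<in> borel_measurable borel"
  using continuous_V by (rule borel_measurable_continuous_onI)

lemma measurable_divergence [measurable]: "divergence \<in> borel_measurable borel"
  using continuous_divergence by (rule borel_measurable_continuous_onI)

lemma norm_deriv_le: "norm (blinfun_apply (V' x) h) \<le> K * norm h"
proof (rule tendsto_upperbound[OF tendsto_norm[OF difference_quotient_limit[OF deriv]]])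
  show "eventually (\<lambda>t. norm ((V (x + t *\<^sub>R h) - V x) /\<^sub>R t) \<le> K * norm h) (at (0::real))"
  proof (rule eventually_at_filter[THEN iffD2], rule always_eventually, intro allI impI)
    fix t :: real assume t: "t \<noteq> 0"
    have "norm ((V (x + t *\<^sub>R h) - V x) /\<^sub>R t) = norm (V (x + t *\<^sub>R h) - V x) / \<bar>t\<bar>"
      by (simp add: divide_inverse mult.commute)
    also have "\<dots> \<le> K * norm (t *\<^sub>R h) / \<bar>t\<bar>"
      using lip[of "x + t *\<^sub>R h" x] by (intro divide_right_mono) auto
    also have "\<dots> = K * norm h" using t by simp
    finally show "norm ((V (x + t *\<^sub>R h) - V x) /\<^sub>R t) \<le> K * norm h" .
  qed
qed simp

lemma deriv_nonneg: "blinfun_apply (V' x) h \<bullet> h \<ge> 0"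
proof (rule tendsto_lowerbound[OF tendsto_inner[OF difference_quotient_limit[OF deriv] tendsto_const]])
  show "eventually (\<lambda>t. 0 \<le> ((V (x + t *\<^sub>R h) - V x) /\<^sub>R t) \<bullet> h) (at (0::real))"
  proof (rule eventually_at_filter[THEN iffD2], rule always_eventually, intro allI impI)
    fix t :: real assume t: "t \<noteq> 0"
    have "0 \<le> (V (x + t *\<^sub>R h) - V x) \<bullet> (t *\<^sub>R h)" using mono[of "x + t *\<^sub>R h" x] by simp
    then have "0 \<le> ((V (x + t *\<^sub>R h) - V x) \<bullet> (t *\<^sub>R h)) / t\<^sup>2" by simp
    also have "\<dots> = ((V (x + t *\<^sub>R h) - V x) /\<^sub>R t) \<bullet> h"
      using t by (simp add: power2_eq_square divide_simps)
    finally show "0 \<le> ((V (x + t *\<^sub>R h) - V x) /\<^sub>R t) \<bullet> h" .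
  qed
qed simp

lemma divergence_nonneg: "divergence x \<ge> 0"
  unfolding divergence_def by (intro sum_nonneg deriv_nonneg)

lemma divergence_le: "divergence x \<le> K * DIM('a)"
proof -
  have "divergence x \<le> (\<Sum>b\<in>(Basis::'a set). K)"
    unfolding divergence_def
  proof (rule sum_mono)
    fix b :: 'a assume b: "b \<in> Basis"
    have "blinfun_apply (V' x) b \<bullet> b \<le> norm (blinfun_apply (V' x) b) * norm b" by (rule norm_cauchy_schwarz)
    also have "\<dots> \<le> K" using norm_deriv_le[of x b] b by simp
    finally show "blinfun_apply (V' x) b \<bullet> b \<le> K" .
  qed
  then show ?thesis by (simp add: mult.commute)
qed

lemma V_growth: "norm (V (x + y)) \<le> (norm (V x) + K) * (1 + norm y)"
proof -
  have "norm (V (x + y)) \<le> norm (V x) + norm (V (x + y) - V x)" by (metis add_diff_cancel_left' add.commute diff_add_cancel norm_triangle_ineq)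
  also have "\<dots> \<le> norm (V x) + K * norm y" using lip[of "x + y" x] by simp
  also have "\<dots> \<le> (norm (V x) + K) * (1 + norm y)"
    using K_nonneg by (simp add: algebra_simps)
  finally show ?thesis .
qed

lemma V_growth': "norm (V (x + y)) \<le> (norm (V x) + K) * exp (1 * norm y)"
  using V_growth[of x y] mult_left_mono[OF exp_ge_add_one_self[of "norm y"], of "norm (V x) + K"] K_nonneg
  by simp

text \<open>By monotonicity of \<open>V\<close>, the inner product of \<open>y - z\<close> with the
  difference of the images is at least \<open>(norm (y - z))\<^sup>2\<close>; Cauchy--Schwarz then
  removes one factor.\<close>

lemma expanding: "dist y z \<le> dist (y + V (x + y)) (z + V (x + z))"
proof -
  have "(norm (y - z))\<^sup>2 \<le> (y - z) \<bullet> ((y + V (x + y)) - (z + V (x + z)))"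
    using mono[of "x + y" "x + z"] by (simp add: power2_norm_eq_inner algebra_simps inner_commute)
  also have "\<dots> \<le> norm (y - z) * norm ((y + V (x + y)) - (z + V (x + z)))" by (rule norm_cauchy_schwarz)
  finally show ?thesis
    by (cases "y = z") (auto simp: dist_norm power2_eq_square)
qed

text \<open>\<open>gaussian_stein\<close> for each coordinate of \<open>V\<close>, summed over the
  basis: the diagonal derivatives add up to the divergence.\<close>

lemma stein:
  assumes w: "w > 0"
  shows "integrable (gaussian w) (\<lambda>y. y \<bullet> V (x + y))"
    "(\<integral>y. y \<bullet> V (x + y) \<partial>gaussian w) = w * (\<integral>y. divergence (x + y) \<partial>gaussian w)"
proof -
  have K: "K \<ge> 0" by (rule K_nonneg)
  show "integrable (gaussian w) (\<lambda>y. y \<bullet> V (x + y))"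
  proof (rule integrable_gaussian_bound_power[where k = 2])
    fix y
    have "\<bar>y \<bullet> V (x + y)\<bar> \<le> norm y * norm (V (x + y))" by (rule Cauchy_Schwarz_ineq2)
    also have "\<dots> \<le> (1 + norm y) * ((norm (V x) + K) * (1 + norm y))"
      using V_growth[of x y] K by (intro mult_mono) auto
    finally show "norm (y \<bullet> V (x + y)) \<le> (norm (V x) + K) * (1 + norm y)\<^sup>2"
      by (simp add: power2_eq_square mult_ac)
  qed (use w K in auto)
  let ?d = "\<lambda>b y. blinfun_apply (V' (x + y)) b \<bullet> b"
  have ib: "integrable (gaussian w) (\<lambda>y. (y \<bullet> b) * (V (x + y) \<bullet> b))" if b: "b \<in> Basis" for b
  proof (rule integrable_gaussian_bound_power[where k = 2])
    fix y
    have "\<bar>(y \<bullet> b) * (V (x + y) \<bullet> b)\<bar> \<le> norm y * norm (V (x + y))"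
      unfolding abs_mult using Basis_le_norm[OF b] by (intro mult_mono) auto
    also have "\<dots> \<le> (1 + norm y) * ((norm (V x) + K) * (1 + norm y))"
      using V_growth[of x y] K by (intro mult_mono) auto
    finally show "norm ((y \<bullet> b) * (V (x + y) \<bullet> b)) \<le> (norm (V x) + K) * (1 + norm y)\<^sup>2"
      by (simp add: power2_eq_square mult_ac)
  qed (use w K in auto)
  have contd: "continuous_on UNIV (\<lambda>y. ?d b y)" for b
    by (intro continuous_intros continuous_on_compose2[OF cont_deriv]) auto
  have db: "\<bar>?d b y\<bar> \<le> K" if b: "b \<in> Basis" for b y
    using Cauchy_Schwarz_ineq2[of "blinfun_apply (V' (x + y)) b" b] norm_deriv_le[of "x + y" b] b by simp
  have id: "integrable (gaussian w) (\<lambda>y. ?d b y)" if b: "b \<in> Basis" for b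
    using db[OF b] contd w K
    by (intro integrable_gaussian_bound_power[where k = 0 and K = K]) (auto intro: borel_measurable_continuous_onI)
  have st: "(\<integral>y. (y \<bullet> b) * (V (x + y) \<bullet> b) \<partial>gaussian w) = w * (\<integral>y. ?d b y \<partial>gaussian w)" if b: "b \<in> Basis" for b
  proof (rule gaussian_stein[where K = "norm (V x) + K" and b = 1])
    show "((\<lambda>t. V (x + (y + t *\<^sub>R b)) \<bullet> b) has_real_derivative ?d b y) (at 0)" for y
    proof -
      have "((\<lambda>t. V (x + y + t *\<^sub>R b)) has_vector_derivative blinfun_apply (V' (x + y)) b) (at 0)"
        by (rule has_derivative_line[OF deriv])
      then have "((\<lambda>t. V (x + y + t *\<^sub>R b) \<bullet> b) has_vector_derivative ?d b y) (at 0)"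
        by (rule bounded_linear.has_vector_derivative[OF bounded_linear_inner_left])
      then show ?thesis by (simp add: has_real_derivative_iff_has_vector_derivative add.assoc)
    qed
    show "\<bar>V (x + y) \<bullet> b\<bar> \<le> (norm (V x) + K) * exp (1 * norm y)" for y
      using Basis_le_norm[OF b, of "V (x + y)"] V_growth'[of x y] by linarith
    have "K * 1 \<le> (norm (V x) + K) * exp (1 * norm y)" for y :: 'a
      using K by (intro mult_mono) auto
    then show "\<bar>?d b y\<bar> \<le> (norm (V x) + K) * exp (1 * norm y)" for y
      using db[OF b, of y] by (metis mult.right_neutral order_trans)
    show "continuous_on UNIV (\<lambda>y. V (x + y) \<bullet> b)"
      by (intro continuous_intros continuous_on_compose2[OF continuous_V]) auto
  qed (use w contd in auto)
  have "(\<integral>y. y \<bullet> V (x + y) \<partial>gaussian w) = (\<integral>y. (\<Sum>b\<in>Basis. (y \<bullet> b) * (V (x + y) \<bullet> b)) \<partial>gaussian w)"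
    by (subst euclidean_inner) simp
  also have "\<dots> = (\<Sum>b\<in>Basis. w * (\<integral>y. ?d b y \<partial>gaussian w))"
    using ib by (simp add: st)
  also have "\<dots> = w * (\<integral>y. divergence (x + y) \<partial>gaussian w)"
    unfolding divergence_def using id by (simp add: sum_distrib_left[symmetric])
  finally show "(\<integral>y. y \<bullet> V (x + y) \<partial>gaussian w) = w * (\<integral>y. divergence (x + y) \<partial>gaussian w)" .
qed

end

text \<open>The Donsker--Varadhan dual form of the statement that the divergence of \<open>\<nu>\<close> from \<open>\<pi>\<close> is at
  most \<open>B\<close>.\<close>

definition dv_bound :: "'a::euclidean_space measure \<Rightarrow> 'a measure \<Rightarrow> real \<Rightarrow> bool" where
  "dv_bound \<pi> \<nu> B \<longleftrightarrow> (\<forall>\<phi>. continuous_on UNIV \<phi> \<longrightarrow> bounded (range \<phi>) \<longrightarrow>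
    (\<integral>x. \<phi> x \<partial>\<nu>) \<le> B + ln (\<integral>x. exp (\<phi> x) \<partial>\<pi>))"

section \<open>Relative entropy in one step\<close>

context monotone_field
begin

lemma integrable_energy:
  assumes w: "w > 0"
  shows "integrable (gaussian w) (\<lambda>y. divergence (x + y))"
    and "integrable (gaussian w) (\<lambda>y. (norm (V (x + y)))\<^sup>2)"
proof -
  show "integrable (gaussian w) (\<lambda>y. divergence (x + y))"
    using divergence_nonneg divergence_le by (intro integrable_gaussian_bounded[OF w, of _ "K * DIM('a)"]) auto
  show "integrable (gaussian w) (\<lambda>y. (norm (V (x + y)))\<^sup>2)"
  proof (rule integrable_gaussian_bound_power[OF w, where K = "(norm (V x) + K)\<^sup>2" and k = 2])
    fix y
    have "(norm (V (x + y)))\<^sup>2 \<le> ((norm (V x) + K) * (1 + norm y))\<^sup>2"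
      by (intro power_mono V_growth) auto
    then show "norm ((norm (V (x + y)))\<^sup>2) \<le> (norm (V x) + K)\<^sup>2 * (1 + norm y)\<^sup>2"
      by (simp add: power_mult_distrib)
  qed auto
qed

text \<open>With the state \<open>x\<close> frozen, the law of \<open>y + V (x + y)\<close> is
  compared with that of \<open>y\<close>. The map is expanding, so a change of variables only loses
  mass; Jensen produces the logarithm, and Stein's identity turns
  \<open>y \<bullet> V (x + y)\<close> into the divergence. The scale \<open>C\<close> is left free
  so that \<open>entropy_step\<close> can match it to hypercontractivity.\<close>

lemma entropy_step_pointwise:
  assumes w: "w > 0" and C: "C > 0" and cont: "continuous_on UNIV \<phi>" and B: "\<And>x. \<bar>\<phi> x\<bar> \<le> B"
  shows "(\<integral>y. \<phi> (a - \<alpha> *\<^sub>R (y + V (x + y))) \<partial>gaussian w)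
    \<le> C * ln (\<integral>y. exp (\<phi> (a - \<alpha> *\<^sub>R y) / C) \<partial>gaussian w)
      + C * (\<integral>y. divergence (x + y) + (norm (V (x + y)))\<^sup>2 / (2 * w) \<partial>gaussian w)"
proof -
  interpret prob_space "gaussian w :: 'a measure" by (rule prob_space_gaussian[OF w])
  have [measurable]: "\<phi> \<in> borel_measurable borel"
    using cont by (rule borel_measurable_continuous_onI)
  define T where "T y = y + V (x + y)" for y
  have contT: "continuous_on UNIV T"
    unfolding T_def by (intro continuous_intros continuous_on_compose2[OF continuous_V]) auto
  have [measurable]: "T \<in> borel_measurable borel"
    using contT by (rule borel_measurable_continuous_onI)
  \<comment> \<open>The last two terms are the logarithm of the ratio of the densities at
    \<open>T y\<close> and \<open>y\<close>, so that the weight \<open>exp (\<psi> y)\<close> turns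
    the density at \<open>y\<close> into the tilted density at \<open>T y\<close>.\<close>
  define \<psi> where "\<psi> y = \<phi> (a - \<alpha> *\<^sub>R T y) / C - (y \<bullet> V (x + y)) / w - (norm (V (x + y)))\<^sup>2 / (2 * w)" for y
  define Z where "Z = (\<integral>y. exp (\<phi> (a - \<alpha> *\<^sub>R y) / C) \<partial>gaussian w)"
  have i1: "integrable (gaussian w) (\<lambda>y. \<phi> (a - \<alpha> *\<^sub>R T y))"
    using B by (intro integrable_gaussian_bounded[OF w, of _ B]) auto
  have i\<psi>: "integrable (gaussian w) \<psi>"
    unfolding \<psi>_def using i1 stein(1)[OF w] integrable_energy[OF w]
    by (intro Bochner_Integration.integrable_diff) auto
  have eb: "exp (\<phi> z / C) \<le> exp (B / C)" "exp (- B / C) \<le> exp (\<phi> z / C)" for z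
    using B[of z] C divide_right_mono[of "\<phi> z" B C] divide_right_mono[of "- B" "\<phi> z" C] by auto
  have iZ: "integrable (gaussian w) (\<lambda>y. exp (\<phi> (a - \<alpha> *\<^sub>R y) / C))"
    using eb by (intro integrable_gaussian_bounded[OF w, of _ "exp (B / C)"]) auto
  have Z: "Z > 0"
  proof -
    have "exp (- B / C) \<le> Z" unfolding Z_def using eb(2) iZ by (intro integral_ge_const) auto
    then show ?thesis using exp_gt_zero[of "- B / C"] by linarith
  qed
  have change: "gaussian_density w y * exp (\<psi> y) = gaussian_density w (T y) * exp (\<phi> (a - \<alpha> *\<^sub>R T y) / C)" for y
  proof -
    have "(norm (T y))\<^sup>2 = (norm y)\<^sup>2 + 2 * (y \<bullet> V (x + y)) + (norm (V (x + y)))\<^sup>2"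
      unfolding T_def power2_norm_eq_inner by (simp add: inner_simps inner_commute)
    then have "- (norm (T y))\<^sup>2 / (2 * w) + \<phi> (a - \<alpha> *\<^sub>R T y) / C = - (norm y)\<^sup>2 / (2 * w) + \<psi> y"
      using w by (simp add: \<psi>_def add_divide_distrib diff_divide_distrib)
    then show ?thesis unfolding gaussian_density_def by (simp add: exp_add[symmetric] mult.assoc)
  qed
  have "(\<integral>\<^sup>+y. ennreal (exp (\<psi> y)) \<partial>gaussian w) = (\<integral>\<^sup>+y. ennreal (gaussian_density w y * exp (\<psi> y)) \<partial>lborel)"
    using gaussian_density_nonneg[OF w, where 'a = 'a] by (subst nn_integral_gaussian[OF w]) (auto simp: ennreal_mult'[symmetric] \<psi>_def)
  also have "\<dots> = (\<integral>\<^sup>+y. (\<lambda>z. ennreal (gaussian_density w z * exp (\<phi> (a - \<alpha> *\<^sub>R z) / C))) (T y) \<partial>lborel)"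
    by (simp add: change)
  also have "\<dots> \<le> (\<integral>\<^sup>+z. ennreal (gaussian_density w z * exp (\<phi> (a - \<alpha> *\<^sub>R z) / C)) \<partial>lborel)"
    using expanding by (intro nn_integral_expanding_le contT) (auto simp: T_def)
  also have "\<dots> = (\<integral>\<^sup>+z. ennreal (exp (\<phi> (a - \<alpha> *\<^sub>R z) / C)) \<partial>gaussian w)"
    using gaussian_density_nonneg[OF w, where 'a = 'a] by (subst nn_integral_gaussian[OF w]) (auto simp: ennreal_mult'[symmetric])
  also have "\<dots> = ennreal Z"
    unfolding Z_def using iZ by (intro nn_integral_eq_integral) auto
  finally have "(\<integral>y. \<psi> y \<partial>gaussian w) \<le> ln Z"
    by (rule integral_le_ln[OF i\<psi> _ Z])
  moreover have "(\<integral>y. \<psi> y \<partial>gaussian w) = (\<integral>y. \<phi> (a - \<alpha> *\<^sub>R T y) \<partial>gaussian w) / C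
      - (\<integral>y. divergence (x + y) + (norm (V (x + y)))\<^sup>2 / (2 * w) \<partial>gaussian w)"
    unfolding \<psi>_def using i1 stein[OF w, of x] integrable_energy[OF w, of x] w by simp
  ultimately show ?thesis using C by (simp add: Z_def T_def field_simps)
qed

text \<open>The noise is compared first, at a fixed state, which leaves
  \<open>C * ln (Pf x)\<close>, a function of the state alone. The bound for \<open>\<nu>\<close> is
  then applied to \<open>(C / r) * ln (Pf x)\<close>, whose exponential is the power of
  \<open>Pf\<close> that hypercontractivity controls. The factor \<open>r\<close> taken out is the
  contraction.\<close>

lemma entropy_step:
  fixes \<nu> :: "'a measure" and \<alpha> w v B J :: real
  assumes w: "w > 0" and \<alpha>: "0 < \<alpha>" "\<alpha> < 1" and v: "v = \<alpha> * w / (2 - \<alpha>)"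
    and \<nu>: "prob_space \<nu>" "sets \<nu> = sets borel" and dv: "dv_bound (gaussian v) \<nu> B"
    and J: "J \<ge> 0" "(\<integral>\<^sup>+x. \<integral>\<^sup>+y. ennreal (2 * divergence (x + y) + 1 / w * (norm (V (x + y)))\<^sup>2) \<partial>gaussian w \<partial>\<nu>) = ennreal J"
    and cont: "continuous_on UNIV \<phi>" and bnd: "bounded (range \<phi>)"
  shows "(\<integral>x. (\<integral>y. \<phi> (x - \<alpha> *\<^sub>R (x + y + V (x + y))) \<partial>gaussian w) \<partial>\<nu>)
    \<le> (1 - \<alpha>) * B + J + ln (\<integral>x. exp (\<phi> x) \<partial>gaussian v)"
proof -
  interpret g: prob_space "gaussian w :: 'a measure" by (rule prob_space_gaussian[OF w])
  interpret \<nu>: prob_space \<nu> by (rule \<nu>(1))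
  note [measurable_cong] = \<nu>(2)
  have sp[simp]: "space \<nu> = UNIV" using sets_eq_imp_space_eq[OF \<nu>(2)] by simp
  have [measurable]: "\<phi> \<in> borel_measurable borel"
    using cont by (rule borel_measurable_continuous_onI)
  obtain b where b: "\<And>x. \<bar>\<phi> x\<bar> \<le> b" using bnd by (auto simp: bounded_iff)
  have v0: "v > 0" using v w \<alpha> by simp
  define r where "r = 1 - \<alpha>"
  have r: "0 < r" "r < 1" using \<alpha> by (auto simp: r_def)
  \<comment> \<open>\<open>C\<close> and \<open>C / r\<close> are conjugate exponents, as
    \<open>hypercontractive\<close> requires.\<close>
  define C where "C = 1 + r"
  have C: "0 < C" "C \<le> 2" using r by (auto simp: C_def)
  define f where "f x = exp (\<phi> x / C)" for x
  define Pf where "Pf x = (\<integral>y. f (r *\<^sub>R x - \<alpha> *\<^sub>R y) \<partial>gaussian w)" for x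
  have contf: "continuous_on UNIV f" unfolding f_def using C by (intro continuous_intros cont) auto
  have [measurable]: "f \<in> borel_measurable borel" using contf by (rule borel_measurable_continuous_onI)
  have fb: "exp (- b / C) \<le> f x \<and> f x \<le> exp (b / C)" for x
    using b[of x] C divide_right_mono[of "\<phi> x" b C] divide_right_mono[of "- b" "\<phi> x" C] by (auto simp: f_def)
  have fb': "\<bar>f x\<bar> \<le> exp (b / C)" for x using fb[of x] by (simp add: f_def)
  have Pf: "Pf x = (\<integral>z. f (r *\<^sub>R x + z) \<partial>gaussian ((1 - r\<^sup>2) * v))" for x
  proof -
    \<comment> \<open>Stationarity of \<open>gaussian v\<close>: each step adds noise of variance
      \<open>\<alpha>\<^sup>2 * w\<close>, which replaces what the contraction by \<open>r\<close>
      removes.\<close>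
    have "(1 - r\<^sup>2) * v = (- \<alpha>)\<^sup>2 * w"
      unfolding v r_def using \<alpha> by (simp add: field_simps power2_eq_square)
    then have "gaussian ((1 - r\<^sup>2) * v) = distr (gaussian w) borel (\<lambda>x::'a. (- \<alpha>) *\<^sub>R x)"
      using gaussian_scale[OF w, of "- \<alpha>", where 'a = 'a] \<alpha> by simp
    then show ?thesis unfolding Pf_def by (simp add: integral_distr)
  qed
  have iPf: "integrable (gaussian w) (\<lambda>y. f (r *\<^sub>R x - \<alpha> *\<^sub>R y))" for x
    using fb' by (intro integrable_gaussian_bounded[OF w]) auto
  have Pfb: "exp (- b / C) \<le> Pf x" "Pf x \<le> exp (b / C)" for x
    unfolding Pf_def using fb iPf by (auto intro!: g.integral_ge_const g.integral_le_const)
  have Pfpos: "Pf x > 0" for x using Pfb(1)[of x] exp_gt_zero[of "- b / C"] by linarith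
  have contP: "continuous_on UNIV Pf"
    unfolding Pf_def using fb'
    by (intro continuous_on_param_integral[OF g.prob_space_axioms, of _ "exp (b / C)"]
        continuous_on_compose2[OF contf] continuous_intros) auto
  have [measurable]: "Pf \<in> borel_measurable borel" using contP by (rule borel_measurable_continuous_onI)
  have contlnP: "continuous_on UNIV (\<lambda>x. ln (Pf x))"
    using Pfpos contP by (intro continuous_on_ln) (auto simp: less_imp_neq[THEN not_sym])
  have lnPb: "\<bar>ln (Pf x)\<bar> \<le> b / C" for x
  proof -
    have "ln (exp (- b / C)) \<le> ln (Pf x)" "ln (Pf x) \<le> ln (exp (b / C))"
      using Pfb[of x] Pfpos[of x] by (subst ln_le_cancel_iff; simp)+
    then show ?thesis by (simp add: abs_le_iff)
  qed
  define j where "j x = (\<integral>y. divergence (x + y) + (norm (V (x + y)))\<^sup>2 / (2 * w) \<partial>gaussian w)" for x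
  have [measurable]: "j \<in> borel_measurable borel" unfolding j_def by measurable
  have j0: "j x \<ge> 0" for x
    unfolding j_def using divergence_nonneg w by (intro Bochner_Integration.integral_nonneg) auto
  have nnj: "(\<integral>\<^sup>+y. ennreal (2 * divergence (x + y) + 1 / w * (norm (V (x + y)))\<^sup>2) \<partial>gaussian w) = ennreal (2 * j x)" for x
  proof -
    have "(\<integral>\<^sup>+y. ennreal (2 * divergence (x + y) + 1 / w * (norm (V (x + y)))\<^sup>2) \<partial>gaussian w)
        = ennreal (\<integral>y. 2 * divergence (x + y) + 1 / w * (norm (V (x + y)))\<^sup>2 \<partial>gaussian w)"
      using integrable_energy[OF w, of x] divergence_nonneg w by (intro nn_integral_eq_integral) auto
    also have "(\<integral>y. 2 * divergence (x + y) + 1 / w * (norm (V (x + y)))\<^sup>2 \<partial>gaussian w)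
        = (\<integral>y. 2 * (divergence (x + y) + (norm (V (x + y)))\<^sup>2 / (2 * w)) \<partial>gaussian w)"
      using w by (intro Bochner_Integration.integral_cong) (auto simp: field_simps)
    also have "\<dots> = 2 * j x" unfolding j_def by (rule integral_mult_right_zero)
    finally show ?thesis .
  qed
  have nn2j: "(\<integral>\<^sup>+x. ennreal (2 * j x) \<partial>\<nu>) = ennreal J" using J(2) unfolding nnj .
  have i2j: "integrable \<nu> (\<lambda>x. 2 * j x)"
    using nn2j j0 by (intro integrableI_nonneg) auto
  have I2j: "(\<integral>x. 2 * j x \<partial>\<nu>) = J"
  proof -
    have "ennreal (\<integral>x. 2 * j x \<partial>\<nu>) = ennreal J"
      using nn_integral_eq_integral[OF i2j] j0 nn2j by simp
    then show ?thesis using J(1) j0 by (subst (asm) ennreal_inj) (auto intro!: Bochner_Integration.integral_nonneg)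
  qed
  have pt: "(\<integral>y. \<phi> (x - \<alpha> *\<^sub>R (x + y + V (x + y))) \<partial>gaussian w) \<le> C * ln (Pf x) + 2 * j x" for x
  proof -
    have "x - \<alpha> *\<^sub>R (x + y + V (x + y)) = r *\<^sub>R x - \<alpha> *\<^sub>R (y + V (x + y))" for y
      by (simp add: r_def algebra_simps)
    then have "(\<integral>y. \<phi> (x - \<alpha> *\<^sub>R (x + y + V (x + y))) \<partial>gaussian w) \<le> C * ln (Pf x) + C * j x"
      using entropy_step_pointwise[OF w C(1) cont b, of "r *\<^sub>R x" \<alpha> x] by (simp add: Pf_def f_def j_def)
    \<comment> \<open>The weight \<open>1 + r\<close> of the noise entropy is rounded up to 2, which
      yields the integrand of the theorem.\<close>
    also have "C * j x \<le> 2 * j x" using C j0 by (intro mult_right_mono) auto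
    finally show ?thesis by simp
  qed
  have ilnP: "integrable \<nu> (\<lambda>x. ln (Pf x))"
    using lnPb by (intro \<nu>.integrable_const_bound[of _ "b / C"]) auto
  have iL: "integrable \<nu> (\<lambda>x. \<integral>y. \<phi> (x - \<alpha> *\<^sub>R (x + y + V (x + y))) \<partial>gaussian w)"
  proof (rule \<nu>.integrable_const_bound[of _ b])
    have "\<bar>\<integral>y. \<phi> (x - \<alpha> *\<^sub>R (x + y + V (x + y))) \<partial>gaussian w\<bar> \<le> b" for x
    proof -
      have i: "integrable (gaussian w) (\<lambda>y. \<phi> (x - \<alpha> *\<^sub>R (x + y + V (x + y))))"
        using b by (intro integrable_gaussian_bounded[OF w]) auto
      have "- b \<le> \<phi> z" "\<phi> z \<le> b" for z using b[of z] by auto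
      then show ?thesis
        using g.integral_ge_const[OF i, of "- b"] g.integral_le_const[OF i, of b] by auto
    qed
    then show "AE x in \<nu>. norm (\<integral>y. \<phi> (x - \<alpha> *\<^sub>R (x + y + V (x + y))) \<partial>gaussian w) \<le> b" by simp
  qed measurable
  have "(\<integral>x. (\<integral>y. \<phi> (x - \<alpha> *\<^sub>R (x + y + V (x + y))) \<partial>gaussian w) \<partial>\<nu>) \<le> (\<integral>x. C * ln (Pf x) + 2 * j x \<partial>\<nu>)"
    using iL ilnP i2j pt by (intro Bochner_Integration.integral_mono) auto
  also have "\<dots> = r * (\<integral>x. (C / r) * ln (Pf x) \<partial>\<nu>) + J"
    using ilnP i2j I2j r by simp
  also have "\<dots> \<le> r * (B + ln (\<integral>x. exp ((C / r) * ln (Pf x)) \<partial>gaussian v)) + J"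
  proof (intro add_right_mono mult_left_mono)
    have "bounded (range (\<lambda>x. (C / r) * ln (Pf x)))"
    proof (rule boundedI)
      fix u assume "u \<in> range (\<lambda>x. (C / r) * ln (Pf x))"
      then obtain x where "u = (C / r) * ln (Pf x)" by auto
      then show "norm u \<le> \<bar>C / r\<bar> * (b / C)" using lnPb[of x] by (simp only: real_norm_def abs_mult) (intro mult_left_mono, auto)
    qed
    moreover have "continuous_on UNIV (\<lambda>x. (C / r) * ln (Pf x))" by (intro continuous_intros contlnP)
    ultimately show "(\<integral>x. (C / r) * ln (Pf x) \<partial>\<nu>) \<le> B + ln (\<integral>x. exp ((C / r) * ln (Pf x)) \<partial>gaussian v)"
      using dv unfolding dv_bound_def by blast
  qed (use r in auto)
  also have "(\<integral>x. exp ((C / r) * ln (Pf x)) \<partial>gaussian v) = (\<integral>x. Pf x powr ((1 + r) / r) \<partial>gaussian v)"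
    using Pfpos by (intro Bochner_Integration.integral_cong) (auto simp: powr_def C_def less_imp_neq[THEN not_sym])
  also have "r * (B + ln (\<integral>x. Pf x powr ((1 + r) / r) \<partial>gaussian v)) + J
      \<le> r * B + ln (\<integral>x. f x powr (1 + r) \<partial>gaussian v) + J"
    using hypercontractive[OF exp_gt_zero r v0 contf fb Pf] by (simp add: distrib_left)
  also have "(\<integral>x. f x powr (1 + r) \<partial>gaussian v) = (\<integral>x. exp (\<phi> x) \<partial>gaussian v)"
    using C by (intro Bochner_Integration.integral_cong) (auto simp: f_def powr_def C_def[symmetric])
  finally show ?thesis by (simp add: r_def algebra_simps)
qed

end

text \<open>The Gibbs variational principle: Jensen under \<open>\<mu>\<close> for
  \<open>\<phi> x - ln (h x)\<close>, where \<open>h\<close> is the density of \<open>\<mu>\<close>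
  with respect to \<open>\<pi>\<close>.\<close>

lemma dv_bound_kl:
  fixes \<mu> \<pi> :: "'a::euclidean_space measure"
  assumes "prob_space \<mu>" "prob_space \<pi>" and sets: "sets \<mu> = sets borel" "sets \<pi> = sets borel"
    and kl: "kl \<mu> \<pi> = ereal \<kappa>"
  shows "dv_bound \<pi> \<mu> \<kappa>"
  unfolding dv_bound_def
proof (intro allI impI)
  interpret \<mu>: prob_space \<mu> by fact
  interpret \<pi>: prob_space \<pi> by fact
  note [measurable_cong] = sets
  fix \<phi> :: "'a \<Rightarrow> real" assume cont: "continuous_on UNIV \<phi>" and bnd: "bounded (range \<phi>)"
  have [measurable]: "\<phi> \<in> borel_measurable borel"
    using cont by (rule borel_measurable_continuous_onI)
  obtain b where b: "\<And>x. \<bar>\<phi> x\<bar> \<le> b" using bnd by (auto simp: bounded_iff)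
  define h where "h x = enn2real (RN_deriv \<pi> \<mu> x)" for x
  have ac: "absolutely_continuous \<pi> \<mu>" and "integrable \<mu> (entropy_density (exp 1) \<pi> \<mu>)"
    and \<kappa>: "\<kappa> = KL_divergence (exp 1) \<pi> \<mu>"
    using kl unfolding kl_def by (auto split: if_splits)
  moreover have ent: "entropy_density (exp 1) \<pi> \<mu> = (\<lambda>x. ln (h x))"
    by (auto simp: entropy_density_def h_def log_ln[symmetric] fun_eq_iff)
  ultimately have ih: "integrable \<mu> (\<lambda>x. ln (h x))" and \<kappa>h: "\<kappa> = (\<integral>x. ln (h x) \<partial>\<mu>)"
    by (auto simp: KL_divergence_def)
  have dens: "density \<pi> (RN_deriv \<pi> \<mu>) = \<mu>"
    using ac sets by (intro \<pi>.density_RN_deriv) auto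
  have fin: "AE x in \<pi>. RN_deriv \<pi> \<mu> x \<noteq> \<infinity>"
    using \<pi>.RN_deriv_finite[OF \<mu>.sigma_finite_measure_axioms ac] sets by simp
  define Z where "Z = (\<integral>x. exp (\<phi> x) \<partial>\<pi>)"
  have eb: "exp (\<phi> x) \<le> exp b" "exp (- b) \<le> exp (\<phi> x)" for x using b[of x] by auto
  have iZ: "integrable \<pi> (\<lambda>x. exp (\<phi> x))"
    using eb by (intro \<pi>.integrable_const_bound[of _ "exp b"]) auto
  have Z: "Z > 0"
  proof -
    have "exp (- b) \<le> Z" unfolding Z_def using eb(2) iZ by (intro \<pi>.integral_ge_const) auto
    then show ?thesis using exp_gt_zero[of "- b"] by linarith
  qed
  have i\<phi>: "integrable \<mu> \<phi>" using b by (intro \<mu>.integrable_const_bound[of _ b]) auto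
  have [measurable]: "h \<in> borel_measurable borel"
  proof -
    have "h \<in> borel_measurable \<pi>" unfolding h_def by measurable
    then show ?thesis using measurable_cong_sets[OF sets(2) refl] by blast
  qed
  have "(\<integral>\<^sup>+x. ennreal (exp (\<phi> x - ln (h x))) \<partial>\<mu>) = (\<integral>\<^sup>+x. RN_deriv \<pi> \<mu> x * ennreal (exp (\<phi> x - ln (h x))) \<partial>\<pi>)"
    by (subst dens[symmetric], subst nn_integral_density) auto
  \<comment> \<open>Only an inequality, because the left integrand vanishes where \<open>h\<close>
    does.\<close>
  also have "\<dots> \<le> (\<integral>\<^sup>+x. ennreal (exp (\<phi> x)) \<partial>\<pi>)"
  proof (rule nn_integral_mono_AE)
    show "AE x in \<pi>. RN_deriv \<pi> \<mu> x * ennreal (exp (\<phi> x - ln (h x))) \<le> ennreal (exp (\<phi> x))"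
      using fin
    proof eventually_elim
      case (elim x)
      have h: "RN_deriv \<pi> \<mu> x = ennreal (h x)" "h x \<ge> 0" using elim by (auto simp: h_def less_top)
      show ?case
      proof (cases "h x = 0")
        case False
        then have "h x * exp (\<phi> x - ln (h x)) = exp (\<phi> x)" using h(2) by (simp add: exp_diff)
        then show ?thesis using h by (simp add: ennreal_mult'[symmetric])
      qed (simp add: h)
    qed
  qed
  also have "\<dots> = ennreal Z" unfolding Z_def using iZ by (intro nn_integral_eq_integral) auto
  finally have "(\<integral>x. \<phi> x - ln (h x) \<partial>\<mu>) \<le> ln Z"
    using i\<phi> ih Z by (intro \<mu>.integral_le_ln) auto
  then show "(\<integral>x. \<phi> x \<partial>\<mu>) \<le> \<kappa> + ln (\<integral>x. exp (\<phi> x) \<partial>\<pi>)"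
    using i\<phi> ih by (simp add: \<kappa>h Z_def)
qed

lemma dv_bound_nonneg: "prob_space \<pi> \<Longrightarrow> dv_bound \<pi> \<mu> B \<Longrightarrow> B \<ge> 0"
  unfolding dv_bound_def by (auto dest!: spec[of _ "\<lambda>_. 0"] simp: prob_space.prob_space)

section \<open>Poisson averages of a geometric recursion\<close>

text \<open>The Beta integral. Integration by parts trades a power of \<open>T - t\<close> for one
  of \<open>t\<close>, so the induction on \<open>m\<close> has to leave \<open>j\<close>
  arbitrary.\<close>

lemma beta_integral:
  assumes T: "T \<ge> 0"
  shows "((\<lambda>t. (T - t) ^ m / fact m * (t ^ j / fact j)) has_integral T ^ (m + j + 1) / fact (m + j + 1)) {0..T::real}"
proof (induction m arbitrary: j)
  case 0
  have "((\<lambda>t. t ^ j / fact j) has_integral T ^ Suc j / fact (Suc j) - 0 ^ Suc j / fact (Suc j)) {0..T}"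
  proof (rule fundamental_theorem_of_calculus)
    fix t :: real assume "t \<in> {0..T}"
    have "((\<lambda>t. t ^ Suc j / fact (Suc j)) has_real_derivative (real (Suc j) * t ^ j) / fact (Suc j)) (at t within {0..T})"
      by (rule DERIV_cdivide, rule DERIV_cong[OF DERIV_power[OF DERIV_ident]]) simp
    then show "((\<lambda>t. t ^ Suc j / fact (Suc j)) has_vector_derivative t ^ j / fact j) (at t within {0..T})"
      by (simp add: has_real_derivative_iff_has_vector_derivative[symmetric] del: of_nat_Suc)
  qed (use T in simp)
  then show ?case by simp
next
  case (Suc m)
  let ?F = "\<lambda>t. (T - t) ^ Suc m / fact (Suc m) * (t ^ Suc j / fact (Suc j))"
  let ?F' = "\<lambda>t. (T - t) ^ Suc m / fact (Suc m) * (t ^ j / fact j) - (T - t) ^ m / fact m * (t ^ Suc j / fact (Suc j))"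
  have "(?F' has_integral ?F T - ?F 0) {0..T}"
  proof (rule fundamental_theorem_of_calculus)
    fix t :: real assume "t \<in> {0..T}"
    have 1: "((\<lambda>t. t ^ Suc j / fact (Suc j)) has_real_derivative t ^ j / fact j) (at t within {0..T})"
    proof -
      have "((\<lambda>t. t ^ Suc j / fact (Suc j)) has_real_derivative (real (Suc j) * t ^ j) / fact (Suc j)) (at t within {0..T})"
        by (rule DERIV_cdivide, rule DERIV_cong[OF DERIV_power[OF DERIV_ident]]) simp
      then show ?thesis by (simp del: of_nat_Suc)
    qed
    have 2: "((\<lambda>t. (T - t) ^ Suc m / fact (Suc m)) has_real_derivative - ((T - t) ^ m / fact m)) (at t within {0..T})"
    proof -
      have "((\<lambda>t. T - t) has_real_derivative - 1) (at t within {0..T})"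
        by (auto intro!: derivative_eq_intros)
      then have "((\<lambda>t. (T - t) ^ Suc m) has_real_derivative real (Suc m) * (T - t) ^ m * (- 1)) (at t within {0..T})"
        by (rule DERIV_cong[OF DERIV_power]) simp
      then have "((\<lambda>t. (T - t) ^ Suc m / fact (Suc m)) has_real_derivative (real (Suc m) * (T - t) ^ m * (- 1)) / fact (Suc m)) (at t within {0..T})"
        by (rule DERIV_cdivide)
      then show ?thesis by (simp del: of_nat_Suc)
    qed
    show "(?F has_vector_derivative ?F' t) (at t within {0..T})"
      unfolding has_real_derivative_iff_has_vector_derivative[symmetric]
      by (rule DERIV_cong[OF DERIV_mult[OF 2 1]]) (simp add: algebra_simps)
  qed (use T in simp)
  \<comment> \<open>At each end of the interval one factor of \<open>?F\<close> is a positive power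
    of zero.\<close>
  then have "(?F' has_integral 0) {0..T}" by simp
  from has_integral_add[OF this Suc[of "Suc j"]] show ?case by simp
qed

definition pois :: "real \<Rightarrow> nat \<Rightarrow> real" where
  "pois t k = t ^ k / fact k * exp (- t)"

lemma pois_nonneg: "t \<ge> 0 \<Longrightarrow> pois t k \<ge> 0"
  by (simp add: pois_def)

lemma borel_measurable_pois [measurable]: "(\<lambda>t. pois t k) \<in> borel_measurable borel"
  unfolding pois_def by measurable

lemma exp_sums: "(\<lambda>m. x ^ m / fact m) sums exp x" for x :: real
  using exp_converges[of x] by (simp add: divide_inverse mult.commute)

text \<open>Up to the factor \<open>exp (- T)\<close> the integrand is
  \<open>t ^ j / fact j * exp ((1 - \<alpha>) * (T - t))\<close>; expand the exponential and
  integrate term by term. In the recursion, the index \<open>j + 1 + m\<close> says that the energy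
  of step \<open>j\<close> is first felt at step \<open>j + 1\<close>.\<close>

lemma pois_convolution:
  assumes T: "T \<ge> 0" and \<alpha>: "0 \<le> \<alpha>" "\<alpha> \<le> 1"
  shows "(\<integral>\<^sup>+t\<in>{0..T}. ennreal (exp (- \<alpha> * (T - t))) * ennreal (pois t j) \<partial>lborel)
    = (\<Sum>m. ennreal ((1 - \<alpha>) ^ m * pois T (j + 1 + m)))"
proof -
  let ?g = "\<lambda>m t. (T - t) ^ m / fact m * (t ^ j / fact j)"
  have nn: "(\<integral>\<^sup>+t. ennreal (?g m t * indicator {0..T} t) \<partial>lborel) = ennreal (T ^ (m + j + 1) / fact (m + j + 1))" for m
    using nn_integral_has_integral_lebesgue'[OF _ beta_integral[OF T, of m j]]
    by (simp add: indicator_mult_ennreal mult.commute)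
  have e: "ennreal (exp (- \<alpha> * (T - t))) * ennreal (pois t j) * indicator {0..T} t
      = (\<Sum>m. ennreal (exp (- T) * (1 - \<alpha>) ^ m) * ennreal (?g m t * indicator {0..T} t))" for t
  proof (cases "t \<in> {0..T}")
    case True
    have "(\<lambda>m. exp (- T) * (t ^ j / fact j) * (((1 - \<alpha>) * (T - t)) ^ m / fact m))
        sums (exp (- T) * (t ^ j / fact j) * exp ((1 - \<alpha>) * (T - t)))"
      by (intro sums_mult exp_sums)
    moreover have "exp (- T) * (t ^ j / fact j) * exp ((1 - \<alpha>) * (T - t)) = exp (- \<alpha> * (T - t)) * pois t j"
      unfolding pois_def by (simp add: mult_ac exp_add[symmetric] algebra_simps)
    ultimately have "(\<lambda>m. exp (- T) * (1 - \<alpha>) ^ m * ?g m t) sums (exp (- \<alpha> * (T - t)) * pois t j)"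
      by (simp add: power_mult_distrib mult_ac)
    then have "(\<Sum>m. ennreal (exp (- T) * (1 - \<alpha>) ^ m * ?g m t)) = ennreal (exp (- \<alpha> * (T - t)) * pois t j)"
      using True \<alpha> by (intro suminf_ennreal_eq) auto
    then show ?thesis using True \<alpha> pois_nonneg[of t j] by (simp add: ennreal_mult'[symmetric])
  qed simp
  have "(\<integral>\<^sup>+t\<in>{0..T}. ennreal (exp (- \<alpha> * (T - t))) * ennreal (pois t j) \<partial>lborel)
      = (\<Sum>m. \<integral>\<^sup>+t. ennreal (exp (- T) * (1 - \<alpha>) ^ m) * ennreal (?g m t * indicator {0..T} t) \<partial>lborel)"
    unfolding e by (rule nn_integral_suminf) measurable
  also have "\<dots> = (\<Sum>m. ennreal ((1 - \<alpha>) ^ m * pois T (j + 1 + m)))"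
  proof (rule suminf_cong)
    fix m
    have "(\<integral>\<^sup>+t. ennreal (exp (- T) * (1 - \<alpha>) ^ m) * ennreal (?g m t * indicator {0..T} t) \<partial>lborel)
        = ennreal (exp (- T) * (1 - \<alpha>) ^ m) * ennreal (T ^ (m + j + 1) / fact (m + j + 1))"
      by (subst nn_integral_cmult) (simp_all only: nn, measurable)
    also have "\<dots> = ennreal ((1 - \<alpha>) ^ m * pois T (j + 1 + m))"
      using T \<alpha> by (subst ennreal_mult'[symmetric]) (auto simp: pois_def add_ac mult_ac)
    finally show "(\<integral>\<^sup>+t. ennreal (exp (- T) * (1 - \<alpha>) ^ m) * ennreal (?g m t * indicator {0..T} t) \<partial>lborel)
        = ennreal ((1 - \<alpha>) ^ m * pois T (j + 1 + m))" .
  qed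
  finally show ?thesis .
qed

text \<open>The generating function of the Poisson law at \<open>1 - \<alpha>\<close>: a contraction
  per step becomes a decay in time.\<close>

lemma pois_geometric:
  assumes "T \<ge> 0" "0 \<le> \<alpha>" "\<alpha> \<le> 1"
  shows "(\<Sum>k. ennreal (pois T k * (1 - \<alpha>) ^ k)) = ennreal (exp (- \<alpha> * T))"
proof (rule suminf_ennreal_eq)
  have "(\<lambda>k. exp (- T) * (((1 - \<alpha>) * T) ^ k / fact k)) sums (exp (- T) * exp ((1 - \<alpha>) * T))"
    by (intro sums_mult exp_sums)
  moreover have "exp (- T) * exp ((1 - \<alpha>) * T) = exp (- \<alpha> * T)"
    by (simp add: exp_add[symmetric] algebra_simps)
  ultimately show "(\<lambda>k. pois T k * (1 - \<alpha>) ^ k) sums exp (- \<alpha> * T)"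
    by (simp add: pois_def power_mult_distrib mult_ac)
qed (use assms pois_nonneg in auto)

lemma suminf_triangle_ennreal:
  fixes f :: "nat \<Rightarrow> nat \<Rightarrow> ennreal"
  shows "(\<Sum>k. \<Sum>j<k. f k j) = (\<Sum>j. \<Sum>m. f (j + 1 + m) j)"
proof -
  have "(\<Sum>k. \<Sum>j<k. f k j) = (\<Sum>k. \<Sum>j. f k j * indicator {..<k} j)"
  proof (rule suminf_cong)
    fix k
    have "(\<Sum>j. f k j * indicator {..<k} j) = (\<Sum>j\<in>{..<k}. f k j * indicator {..<k} j)"
      by (rule suminf_finite) auto
    then show "(\<Sum>j<k. f k j) = (\<Sum>j. f k j * indicator {..<k} j)" by simp
  qed
  also have "\<dots> = (\<integral>\<^sup>+k. (\<Sum>j. f k j * indicator {..<k} j) \<partial>count_space UNIV)"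
    by (rule nn_integral_count_space_nat[symmetric])
  also have "\<dots> = (\<Sum>j. \<integral>\<^sup>+k. f k j * indicator {..<k} j \<partial>count_space UNIV)"
    by (rule nn_integral_suminf) auto
  also have "\<dots> = (\<Sum>j. \<Sum>m. f (j + 1 + m) j)"
  proof (rule suminf_cong)
    fix j :: nat
    have inj: "inj_on (\<lambda>m. j + 1 + m) UNIV" by (auto simp: inj_on_def)
    have rng: "range (\<lambda>m. j + 1 + m) = {j<..}"
      by (auto simp: image_iff) presburger
    have "(\<Sum>m. f (j + 1 + m) j) = (\<integral>\<^sup>+m. f (j + 1 + m) j \<partial>count_space UNIV)"
      by (rule nn_integral_count_space_nat[symmetric])
    also have "\<dots> = (\<integral>\<^sup>+k. f k j \<partial>count_space (range (\<lambda>m. j + 1 + m)))"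
      by (rule nn_integral_bij_count_space[OF inj_on_imp_bij_betw[OF inj]])
    also have "\<dots> = (\<integral>\<^sup>+k. f k j * indicator {j<..} k \<partial>count_space UNIV)"
      unfolding rng by (subst nn_integral_count_space_indicator) auto
    finally show "(\<integral>\<^sup>+k. f k j * indicator {..<k} j \<partial>count_space UNIV) = (\<Sum>m. f (j + 1 + m) j)"
      by (simp add: indicator_def)
  qed
  finally show ?thesis .
qed

text \<open>Formally the Poisson average \<open>b\<close> of \<open>B\<close> solves
  \<open>b' = - \<alpha> * b\<close> plus the average of \<open>J\<close>, and the claim is the
  variation-of-constants formula. The proof sums the explicit solution instead, because the values
  may be infinite.\<close>

lemma pois_average_recursion:
  fixes B J :: "nat \<Rightarrow> ennreal"
  assumes T: "T \<ge> 0" and \<alpha>: "0 \<le> \<alpha>" "\<alpha> \<le> 1"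
    and rec: "\<And>k. B (Suc k) = ennreal (1 - \<alpha>) * B k + J k"
  shows "(\<Sum>k. ennreal (pois T k) * B k) = ennreal (exp (- \<alpha> * T)) * B 0
    + (\<integral>\<^sup>+t\<in>{0..T}. ennreal (exp (- \<alpha> * (T - t))) * (\<Sum>j. ennreal (pois t j) * J j) \<partial>lborel)"
proof -
  let ?r = "ennreal (1 - \<alpha>)"
  \<comment> \<open>The recursion unrolled: what enters at step \<open>j\<close> is contracted
    \<open>k - 1 - j\<close> times before step \<open>k\<close>.\<close>
  have B: "B k = ?r ^ k * B 0 + (\<Sum>j<k. ?r ^ (k - 1 - j) * J j)" for k
  proof (induction k)
    case (Suc k)
    have "?r * (\<Sum>j<k. ?r ^ (k - 1 - j) * J j) = (\<Sum>j<k. ?r ^ (k - j) * J j)"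
      unfolding sum_distrib_left
    proof (rule sum.cong[OF refl])
      fix j assume "j \<in> {..<k}"
      then have "k - j = Suc (k - 1 - j)" by auto
      then show "?r * (?r ^ (k - 1 - j) * J j) = ?r ^ (k - j) * J j" by (simp add: mult.assoc)
    qed
    then show ?case unfolding rec using Suc by (simp add: distrib_left mult.assoc add.assoc)
  qed simp
  have "(\<Sum>k. ennreal (pois T k) * B k) = (\<Sum>k. ennreal (pois T k) * ?r ^ k * B 0 + (\<Sum>j<k. ennreal (pois T k) * (?r ^ (k - 1 - j) * J j)))"
    by (subst B) (simp add: distrib_left sum_distrib_left mult.assoc)
  also have "\<dots> = (\<Sum>k. ennreal (pois T k) * ?r ^ k) * B 0 + (\<Sum>k. \<Sum>j<k. ennreal (pois T k) * (?r ^ (k - 1 - j) * J j))"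
    by (subst suminf_add[symmetric]) (auto simp: ennreal_suminf_multc)
  also have "(\<Sum>k. ennreal (pois T k) * ?r ^ k) = ennreal (exp (- \<alpha> * T))"
    using pois_geometric[OF T \<alpha>] T \<alpha> by (simp add: ennreal_power ennreal_mult'[symmetric] pois_nonneg)
  also have "(\<Sum>k. \<Sum>j<k. ennreal (pois T k) * (?r ^ (k - 1 - j) * J j))
      = (\<Sum>j. \<Sum>m. ennreal (pois T (j + 1 + m)) * (?r ^ m * J j))"
    by (subst suminf_triangle_ennreal) simp
  also have "\<dots> = (\<Sum>j. (\<integral>\<^sup>+t\<in>{0..T}. ennreal (exp (- \<alpha> * (T - t))) * ennreal (pois t j) \<partial>lborel) * J j)"
  proof (rule suminf_cong)
    fix j
    have "(\<Sum>m. ennreal (pois T (j + 1 + m)) * (?r ^ m * J j)) = (\<Sum>m. ennreal ((1 - \<alpha>) ^ m * pois T (j + 1 + m)) * J j)"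
      using T \<alpha> by (intro suminf_cong) (simp add: ennreal_mult ennreal_power pois_nonneg mult_ac)
    then show "(\<Sum>m. ennreal (pois T (j + 1 + m)) * (?r ^ m * J j)) = (\<integral>\<^sup>+t\<in>{0..T}. ennreal (exp (- \<alpha> * (T - t))) * ennreal (pois t j) \<partial>lborel) * J j"
      unfolding pois_convolution[OF T \<alpha>] by (simp add: ennreal_suminf_multc)
  qed
  also have "\<dots> = (\<integral>\<^sup>+t\<in>{0..T}. ennreal (exp (- \<alpha> * (T - t))) * (\<Sum>j. ennreal (pois t j) * J j) \<partial>lborel)"
  proof -
    have "(\<integral>\<^sup>+t\<in>{0..T}. ennreal (exp (- \<alpha> * (T - t))) * (\<Sum>j. ennreal (pois t j) * J j) \<partial>lborel)
        = (\<integral>\<^sup>+t. (\<Sum>j. ennreal (exp (- \<alpha> * (T - t))) * ennreal (pois t j) * indicator {0..T} t * J j) \<partial>lborel)"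
      by (intro nn_integral_cong) (simp add: ennreal_suminf_cmult[symmetric] ennreal_suminf_multc[symmetric] mult_ac)
    also have "\<dots> = (\<Sum>j. \<integral>\<^sup>+t. ennreal (exp (- \<alpha> * (T - t))) * ennreal (pois t j) * indicator {0..T} t * J j \<partial>lborel)"
      by (rule nn_integral_suminf) measurable
    also have "\<dots> = (\<Sum>j. (\<integral>\<^sup>+t\<in>{0..T}. ennreal (exp (- \<alpha> * (T - t))) * ennreal (pois t j) \<partial>lborel) * J j)"
      by (intro suminf_cong nn_integral_multc) measurable
    finally show ?thesis ..
  qed
  finally show ?thesis .
qed

section \<open>Poissonized iterations\<close>

text \<open>Independence of the current noise from the current state is enough to express the law of
  the next state by that of the current one; the earlier history does not enter.\<close>

lemma (in prob_space) expectation_noisy_step: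
  fixes X \<xi> :: "'a \<Rightarrow> 'b::euclidean_space" and \<phi> :: "'b \<Rightarrow> real"
  assumes ind: "indep_var borel \<xi> borel X" and law: "distr M borel \<xi> = gaussian 1" and \<sigma>: "\<sigma> > 0"
    and [measurable]: "D \<in> borel_measurable borel" "\<phi> \<in> borel_measurable borel" and b: "\<And>x. \<bar>\<phi> x\<bar> \<le> b"
  shows "expectation (\<lambda>\<omega>. \<phi> (X \<omega> - D (X \<omega> + \<sigma> *\<^sub>R \<xi> \<omega>)))
    = (\<integral>x. (\<integral>y. \<phi> (x - D (x + y)) \<partial>gaussian (\<sigma>\<^sup>2)) \<partial>distr M borel X)"
proof -
  have rv[measurable]: "random_variable borel \<xi>" "random_variable borel X"
    and joint: "distr M borel \<xi> \<Otimes>\<^sub>M distr M borel X = distr M (borel \<Otimes>\<^sub>M borel) (\<lambda>\<omega>. (\<xi> \<omega>, X \<omega>))"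
    using ind unfolding indep_var_distribution_eq by auto
  define \<nu> where "\<nu> = distr M borel X"
  interpret g: prob_space "gaussian 1 :: 'b measure" by (rule prob_space_gaussian) simp
  interpret n: prob_space \<nu> unfolding \<nu>_def by (rule prob_space_distr) simp
  interpret pp: pair_prob_space "gaussian 1 :: 'b measure" \<nu> ..
  have [measurable_cong]: "sets \<nu> = sets borel" by (simp add: \<nu>_def)
  let ?F = "\<lambda>z x. \<phi> (x - D (x + \<sigma> *\<^sub>R z))"
  have "expectation (\<lambda>\<omega>. \<phi> (X \<omega> - D (X \<omega> + \<sigma> *\<^sub>R \<xi> \<omega>))) = (\<integral>p. ?F (fst p) (snd p) \<partial>distr M (borel \<Otimes>\<^sub>M borel) (\<lambda>\<omega>. (\<xi> \<omega>, X \<omega>)))"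
    by (subst integral_distr) auto
  also have "\<dots> = (\<integral>p. ?F (fst p) (snd p) \<partial>(gaussian 1 \<Otimes>\<^sub>M \<nu>))"
    unfolding joint[symmetric] law \<nu>_def ..
  also have "\<dots> = (\<integral>x. (\<integral>z. ?F z x \<partial>gaussian 1) \<partial>\<nu>)"
  proof -
    have "integrable (gaussian 1 \<Otimes>\<^sub>M \<nu>) (\<lambda>p. ?F (fst p) (snd p))"
      using b by (intro pp.integrable_const_bound[of _ b]) auto
    then show ?thesis using pp.integral_snd[of ?F] by (simp add: case_prod_beta')
  qed
  also have "\<dots> = (\<integral>x. (\<integral>y. \<phi> (x - D (x + y)) \<partial>gaussian (\<sigma>\<^sup>2)) \<partial>\<nu>)"
  proof (rule Bochner_Integration.integral_cong[OF refl])
    fix x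
    have "gaussian (\<sigma>\<^sup>2) = distr (gaussian 1) borel (\<lambda>z::'b. \<sigma> *\<^sub>R z)"
      using gaussian_scale[of 1 \<sigma>, where 'a = 'b] \<sigma> by simp
    then show "(\<integral>z. ?F z x \<partial>gaussian 1) = (\<integral>y. \<phi> (x - D (x + y)) \<partial>gaussian (\<sigma>\<^sup>2))"
      by (simp add: integral_distr)
  qed
  finally show ?thesis by (simp add: \<nu>_def)
qed

text \<open>Independence is assumed for whole paths. Mixing over the number of steps takes it for
  one time and one measurable function of the other variable.\<close>

lemma (in prob_space) indep_rvs_coordinate:
  assumes ind: "indep_rvs (PiM {0..} (\<lambda>_. count_space UNIV)) (\<lambda>\<omega>. \<lambda>t\<in>{0..}. N t \<omega>) B Z"
    and t: "(0::real) \<le> t" and \<Phi>: "\<Phi> \<in> measurable B borel" and A: "A \<in> sets borel"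
  shows "prob ({\<omega>\<in>space M. N t \<omega> = (k::nat)} \<inter> {\<omega>\<in>space M. \<Phi> (Z \<omega>) \<in> A})
    = prob {\<omega>\<in>space M. N t \<omega> = k} * prob {\<omega>\<in>space M. \<Phi> (Z \<omega>) \<in> A}"
proof -
  let ?P = "PiM {0..} (\<lambda>_. count_space UNIV) :: (real \<Rightarrow> nat) measure"
  let ?N = "\<lambda>\<omega>. \<lambda>t\<in>{0..}. N t \<omega>"
  have rvN: "?N \<in> measurable M ?P" and rvZ: "Z \<in> measurable M B"
    and ind_sets: "indep_set {?N -` U \<inter> space M | U. U \<in> sets ?P} {Z -` V \<inter> space M | V. V \<in> sets B}"
    using ind unfolding indep_rvs_def by auto
  define U where "U = (\<lambda>f. f t) -` {k} \<inter> space ?P"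
  have U: "U \<in> sets ?P" unfolding U_def using t by (intro measurable_sets[OF measurable_component_singleton]) auto
  have Ueq: "?N -` U \<inter> space M = {\<omega>\<in>space M. N t \<omega> = k}"
    using measurable_space[OF rvN] t by (auto simp: U_def)
  define V where "V = \<Phi> -` A \<inter> space B"
  have V: "V \<in> sets B" unfolding V_def by (rule measurable_sets[OF \<Phi> A])
  have Veq: "Z -` V \<inter> space M = {\<omega>\<in>space M. \<Phi> (Z \<omega>) \<in> A}"
    using measurable_space[OF rvZ] by (auto simp: V_def)
  have "prob ((?N -` U \<inter> space M) \<inter> (Z -` V \<inter> space M)) = prob (?N -` U \<inter> space M) * prob (Z -` V \<inter> space M)"
    by (rule indep_setD[OF ind_sets]) (use U V in auto)
  then show ?thesis unfolding Ueq Veq .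
qed

text \<open>Split the integral according to the value of \<open>N\<close>; on each piece
  independence factors out the probability of that value.\<close>

lemma (in prob_space) nn_integral_mixture:
  fixes X :: "nat \<Rightarrow> 'a \<Rightarrow> 'b::topological_space" and N :: "'a \<Rightarrow> nat"
  assumes [measurable]: "N \<in> measurable M (count_space UNIV)" "\<And>k. X k \<in> borel_measurable M" "\<psi> \<in> borel_measurable borel"
    and ind: "\<And>k A. A \<in> sets borel \<Longrightarrow> prob ({\<omega>\<in>space M. N \<omega> = k} \<inter> {\<omega>\<in>space M. X k \<omega> \<in> A})
      = prob {\<omega>\<in>space M. N \<omega> = k} * prob {\<omega>\<in>space M. X k \<omega> \<in> A}"
  shows "(\<integral>\<^sup>+\<omega>. \<psi> (X (N \<omega>) \<omega>) \<partial>M) = (\<Sum>k. ennreal (prob {\<omega>\<in>space M. N \<omega> = k}) * (\<integral>\<^sup>+\<omega>. \<psi> (X k \<omega>) \<partial>M))"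
proof -
  have eq: "\<psi> (X (N \<omega>) \<omega>) = (\<Sum>k. indicator {N \<omega>} k * \<psi> (X k \<omega>))" for \<omega>
    by (subst suminf_finite[of "{N \<omega>}"]) (auto simp: indicator_def)
  have "(\<integral>\<^sup>+\<omega>. \<psi> (X (N \<omega>) \<omega>) \<partial>M) = (\<Sum>k. \<integral>\<^sup>+\<omega>. indicator {\<omega>\<in>space M. N \<omega> = k} \<omega> * \<psi> (X k \<omega>) \<partial>M)"
    unfolding eq by (subst nn_integral_suminf[symmetric]) (auto intro!: nn_integral_cong suminf_cong simp: indicator_def)
  also have "\<dots> = (\<Sum>k. ennreal (prob {\<omega>\<in>space M. N \<omega> = k}) * (\<integral>\<^sup>+\<omega>. \<psi> (X k \<omega>) \<partial>M))"
  proof (rule suminf_cong)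
    fix k
    let ?E = "{\<omega>\<in>space M. N \<omega> = k}" and ?D = "\<lambda>\<omega>. indicator {\<omega>\<in>space M. N \<omega> = k} \<omega> :: ennreal"
    \<comment> \<open>Independence is available for events; equality of these two measures carries
      it over to every nonnegative \<open>\<psi>\<close>.\<close>
    have meq: "distr (density M ?D) borel (X k) = density (distr M borel (X k)) (\<lambda>_. ennreal (prob ?E))"
    proof (rule measure_eqI)
      fix A assume "A \<in> sets (distr (density M ?D) borel (X k))"
      then have [measurable]: "A \<in> sets borel" by simp
      have "emeasure (distr (density M ?D) borel (X k)) A = emeasure (density M ?D) (X k -` A \<inter> space M)"
        by (simp add: emeasure_distr)
      also have "\<dots> = (\<integral>\<^sup>+\<omega>. ?D \<omega> * indicator (X k -` A \<inter> space M) \<omega> \<partial>M)"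
        by (simp add: emeasure_density)
      also have "\<dots> = (\<integral>\<^sup>+\<omega>. indicator (?E \<inter> {\<omega>\<in>space M. X k \<omega> \<in> A}) \<omega> \<partial>M)"
        by (intro nn_integral_cong) (auto simp: indicator_def)
      also have "\<dots> = ennreal (prob (?E \<inter> {\<omega>\<in>space M. X k \<omega> \<in> A}))"
        by (simp add: emeasure_eq_measure)
      also have "\<dots> = ennreal (prob ?E) * emeasure M {\<omega>\<in>space M. X k \<omega> \<in> A}"
        by (simp add: ind emeasure_eq_measure ennreal_mult)
      also have "{\<omega>\<in>space M. X k \<omega> \<in> A} = X k -` A \<inter> space M" by auto
      also have "ennreal (prob ?E) * emeasure M (X k -` A \<inter> space M) = emeasure (density (distr M borel (X k)) (\<lambda>_. ennreal (prob ?E))) A"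
        by (simp add: emeasure_density emeasure_distr nn_integral_cmult)
      finally show "emeasure (distr (density M ?D) borel (X k)) A = emeasure (density (distr M borel (X k)) (\<lambda>_. ennreal (prob ?E))) A" .
    qed simp
    have "(\<integral>\<^sup>+\<omega>. ?D \<omega> * \<psi> (X k \<omega>) \<partial>M) = (\<integral>\<^sup>+x. \<psi> x \<partial>distr (density M ?D) borel (X k))"
      by (simp add: nn_integral_distr nn_integral_density)
    also have "\<dots> = ennreal (prob ?E) * (\<integral>\<^sup>+\<omega>. \<psi> (X k \<omega>) \<partial>M)"
      unfolding meq by (simp add: nn_integral_distr nn_integral_density nn_integral_cmult)
    finally show "(\<integral>\<^sup>+\<omega>. ?D \<omega> * \<psi> (X k \<omega>) \<partial>M) = ennreal (prob ?E) * (\<integral>\<^sup>+\<omega>. \<psi> (X k \<omega>) \<partial>M)" .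
  qed
  finally show ?thesis .
qed

lemma (in prob_space) poisson_process_prob:
  assumes N: "poisson_process 1 N" and t: "t > 0"
  shows "prob {\<omega>\<in>space M. N t \<omega> = k} = pois t k"
proof -
  have [measurable]: "random_variable (count_space UNIV) (N t)" "random_variable (count_space UNIV) (N 0)"
    and AE0: "AE \<omega> in M. N 0 \<omega> = 0"
    and law: "distr M (count_space UNIV) (\<lambda>\<omega>. N t \<omega> - N 0 \<omega>) = measure_pmf (poisson_pmf (1 * (t - 0)))"
    using N t unfolding poisson_process_def by (auto elim: AE_mp)
  \<comment> \<open>\<open>N 0\<close> vanishes almost surely, so that \<open>N t\<close> may be
    replaced by an increment, whose law is prescribed.\<close>
  have "prob {\<omega>\<in>space M. N t \<omega> = k} = prob {\<omega>\<in>space M. N t \<omega> - N 0 \<omega> = k}"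
    using AE0 by (intro finite_measure_eq_AE) auto
  also have "\<dots> = measure (distr M (count_space UNIV) (\<lambda>\<omega>. N t \<omega> - N 0 \<omega>)) {k}"
    by (subst measure_distr) (auto intro!: arg_cong[where f = prob])
  also have "\<dots> = pmf (poisson_pmf t) k" unfolding law by (simp add: measure_pmf_single)
  also have "\<dots> = pois t k" using t by (simp add: pois_def)
  finally show ?thesis .
qed

section \<open>Subgaussian losses\<close>

text \<open>Joint measurability comes from continuity in \<open>w\<close>: replace \<open>w\<close>
  by the first point of a countable dense sequence within distance \<open>1 / real (Suc n)\<close>,
  a measurable choice with countably many values, and let \<open>n\<close> grow.\<close>

lemma borel_measurable_caratheodory:
  fixes f :: "'a::euclidean_space \<Rightarrow> 'z \<Rightarrow> real"
  assumes meas: "\<And>w. f w \<in> borel_measurable \<mu>"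
    and cont: "\<And>z. z \<in> space \<mu> \<Longrightarrow> continuous_on UNIV (\<lambda>w. f w z)"
  shows "(\<lambda>p. f (fst p) (snd p)) \<in> borel_measurable (borel \<Otimes>\<^sub>M \<mu>)"
proof -
  obtain D :: "'a set" where D: "countable D" "\<And>X. open X \<Longrightarrow> X \<noteq> {} \<Longrightarrow> \<exists>d\<in>D. d \<in> X"
    by (rule countable_dense_setE) blast
  have Dne: "D \<noteq> {}" using D(2)[of UNIV] by auto
  define d where "d = from_nat_into D"
  define k where "k n w = (LEAST i. dist (d i) w < 1 / real (Suc n))" for n w
  have [measurable]: "k n \<in> measurable borel (count_space UNIV)" for n
    unfolding k_def by measurable
  have near: "dist (d (k n w)) w < 1 / real (Suc n)" for n w
  proof -
    obtain x where "x \<in> D" "x \<in> ball w (1 / real (Suc n))" using D(2)[of "ball w (1 / real (Suc n))"] by auto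
    moreover obtain i where "x = d i" using \<open>x \<in> D\<close> D(1) unfolding d_def by (metis from_nat_into_surj)
    ultimately have "dist (d i) w < 1 / real (Suc n)" by (simp add: dist_commute)
    then show ?thesis unfolding k_def by (rule LeastI)
  qed
  show ?thesis
  proof (rule borel_measurable_LIMSEQ_real)
    show "(\<lambda>p. f (d (k n (fst p))) (snd p)) \<in> borel_measurable (borel \<Otimes>\<^sub>M \<mu>)" for n
    proof (rule measurable_compose_countable[where f = "\<lambda>i p. f (d i) (snd p)" and g = "\<lambda>p. k n (fst p)"])
      show "(\<lambda>p. f (d i) (snd p)) \<in> borel_measurable (borel \<Otimes>\<^sub>M \<mu>)" for i
        using meas by (rule measurable_compose[OF measurable_snd])
      show "(\<lambda>p. k n (fst p)) \<in> measurable (borel \<Otimes>\<^sub>M \<mu>) (count_space UNIV)"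
        by (rule measurable_compose[OF measurable_fst]) measurable
    qed
    fix p assume "p \<in> space (borel \<Otimes>\<^sub>M \<mu> :: ('a \<times> 'z) measure)"
    then have z: "snd p \<in> space \<mu>" by (auto simp: space_pair_measure)
    have "(\<lambda>n. d (k n (fst p))) \<longlonglongrightarrow> fst p"
    proof (rule metric_LIMSEQ_I)
      fix r :: real assume "r > 0"
      then obtain n0 where n0: "1 / real (Suc n0) < r" using nat_approx_posE by blast
      have "dist (d (k n (fst p))) (fst p) < r" if "n \<ge> n0" for n
      proof -
        have "1 / real (Suc n) \<le> 1 / real (Suc n0)" using that by (intro divide_left_mono) auto
        then show ?thesis using near[of n "fst p"] n0 by linarith
      qed
      then show "\<exists>no. \<forall>n\<ge>no. dist (d (k n (fst p))) (fst p) < r" by blast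
    qed
    then show "(\<lambda>n. f (d (k n (fst p))) (snd p)) \<longlonglongrightarrow> f (fst p) (snd p)"
      using continuous_on_tendsto_compose[OF cont[OF z]] by auto
  qed
qed

section \<open>Exponential moments of the squared generalization gap\<close>

lemma normal_exp_moment:
  "(\<integral>\<^sup>+g. ennreal (std_normal_density g * exp (g * a)) \<partial>lborel) = ennreal (exp (a\<^sup>2 / 2))"
proof -
  have "std_normal_density g * exp (g * a) = exp (a\<^sup>2 / 2) * normal_density a 1 g" for g
  proof -
    have "- g\<^sup>2 / 2 + g * a = a\<^sup>2 / 2 + - (g - a)\<^sup>2 / 2" by (simp add: power2_eq_square field_simps)
    then have "exp (- g\<^sup>2 / 2) * exp (g * a) = exp (a\<^sup>2 / 2) * exp (- (g - a)\<^sup>2 / 2)" by (simp only: exp_add[symmetric])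
    then show ?thesis by (simp add: normal_density_def)
  qed
  then have "(\<integral>\<^sup>+g. ennreal (std_normal_density g * exp (g * a)) \<partial>lborel) = (\<integral>\<^sup>+g. ennreal (exp (a\<^sup>2 / 2)) * ennreal (normal_density a 1 g) \<partial>lborel)"
    by (simp add: ennreal_mult')
  also have "\<dots> = ennreal (exp (a\<^sup>2 / 2)) * (\<integral>\<^sup>+g. ennreal (normal_density a 1 g) \<partial>lborel)"
    by (rule nn_integral_cmult) simp
  also have "(\<integral>\<^sup>+g. ennreal (normal_density a 1 g) \<partial>lborel) = 1"
    using prob_space.emeasure_space_1[OF prob_space_normal_density[of 1 a]] by (simp add: emeasure_density)
  finally show ?thesis by simp
qed

text \<open>The factor halves the exponent of the density, turning it into that of variance 2;
  \<open>sqrt 2\<close> is the ratio of the normalising constants.\<close>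

lemma normal_square_exp_moment:
  "(\<integral>\<^sup>+g. ennreal (std_normal_density g * exp (g\<^sup>2 / 4)) \<partial>lborel) = ennreal (sqrt 2)"
proof -
  have "std_normal_density g * exp (g\<^sup>2 / 4) = sqrt 2 * normal_density 0 (sqrt 2) g" for g
  proof -
    have "exp (- g\<^sup>2 / 2) * exp (g\<^sup>2 / 4) = exp (- g\<^sup>2 / 4)" by (simp add: exp_add[symmetric])
    moreover have "sqrt (4 * pi) = sqrt 2 * sqrt (2 * pi)" by (simp add: real_sqrt_mult[symmetric])
    ultimately show ?thesis by (simp add: normal_density_def)
  qed
  then have "(\<integral>\<^sup>+g. ennreal (std_normal_density g * exp (g\<^sup>2 / 4)) \<partial>lborel) = (\<integral>\<^sup>+g. ennreal (sqrt 2) * ennreal (normal_density 0 (sqrt 2) g) \<partial>lborel)"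
    by (simp add: ennreal_mult')
  also have "\<dots> = ennreal (sqrt 2) * (\<integral>\<^sup>+g. ennreal (normal_density 0 (sqrt 2) g) \<partial>lborel)"
    by (rule nn_integral_cmult) simp
  also have "(\<integral>\<^sup>+g. ennreal (normal_density 0 (sqrt 2) g) \<partial>lborel) = 1"
    using prob_space.emeasure_space_1[OF prob_space_normal_density[of "sqrt 2" 0]] by (simp add: emeasure_density)
  finally show ?thesis by simp
qed

text \<open>The square is linearised by an auxiliary standard Gaussian variable.\<close>

lemma subgaussian_square_moment:
  fixes f :: "'z \<Rightarrow> real"
  assumes "prob_space \<mu>" and [measurable]: "f \<in> borel_measurable \<mu>" and v: "v > 0" and n: "n \<ge> 1"
    and sub: "\<And>s. (\<integral>\<^sup>+z. ennreal (exp (s * f z)) \<partial>\<mu>) \<le> ennreal (exp (s\<^sup>2 * v / 2))"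
  shows "(\<integral>\<^sup>+S. ennreal (exp (real n * ((\<Sum>i<n. f (S i)) / n)\<^sup>2 / (4 * v))) \<partial>PiM {..<n} (\<lambda>_. \<mu>)) \<le> ennreal (sqrt 2)"
proof -
  interpret prob_space \<mu> by fact
  interpret PF: product_prob_space "\<lambda>_. \<mu>" "{..<n}" ..
  interpret P: prob_space "PiM {..<n} (\<lambda>_. \<mu>)" by (rule prob_space_PiM) (rule prob_space_axioms)
  interpret pp: pair_sigma_finite "PiM {..<n} (\<lambda>_. \<mu>)" "lborel :: real measure" ..
  \<comment> \<open>Chosen so that the exponent is \<open>(c * x)\<^sup>2 / 2\<close>, the form that
    \<open>normal_exp_moment\<close> linearises. The \<open>n\<close> subgaussian factors then
    multiply to \<open>exp (g\<^sup>2 / 4)\<close>, which is still integrable against the normal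
    density.\<close>
  define c where "c = sqrt (n / (2 * v)) / n"
  have c2: "c\<^sup>2 = 1 / (2 * v * n)" using v n by (simp add: c_def power_divide power2_eq_square)
  have eq: "real n * (x / n)\<^sup>2 / (4 * v) = (c * x)\<^sup>2 / 2" for x
    unfolding power_mult_distrib c2 using n v by (simp add: power2_eq_square field_simps)
  have "(\<integral>\<^sup>+S. ennreal (exp (real n * ((\<Sum>i<n. f (S i)) / n)\<^sup>2 / (4 * v))) \<partial>PiM {..<n} (\<lambda>_. \<mu>))
      = (\<integral>\<^sup>+S. (\<integral>\<^sup>+g. ennreal (std_normal_density g * exp (g * (c * (\<Sum>i<n. f (S i))))) \<partial>lborel) \<partial>PiM {..<n} (\<lambda>_. \<mu>))"
    unfolding eq normal_exp_moment ..
  also have "\<dots> = (\<integral>\<^sup>+g. (\<integral>\<^sup>+S. ennreal (std_normal_density g * exp (g * (c * (\<Sum>i<n. f (S i))))) \<partial>PiM {..<n} (\<lambda>_. \<mu>)) \<partial>lborel)"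
    by (rule pp.Fubini'[symmetric]) measurable
  also have "\<dots> \<le> (\<integral>\<^sup>+g. ennreal (std_normal_density g * exp (g\<^sup>2 / 4)) \<partial>lborel)"
  proof (rule nn_integral_mono)
    fix g
    have "(\<integral>\<^sup>+S. ennreal (std_normal_density g * exp (g * (c * (\<Sum>i<n. f (S i))))) \<partial>PiM {..<n} (\<lambda>_. \<mu>))
        = ennreal (std_normal_density g) * (\<integral>\<^sup>+S. (\<Prod>i<n. ennreal (exp (g * c * f (S i)))) \<partial>PiM {..<n} (\<lambda>_. \<mu>))"
      by (subst nn_integral_cmult[symmetric])
        (auto simp: ennreal_mult' prod_ennreal exp_sum[symmetric] sum_distrib_left mult.assoc intro!: nn_integral_cong)
    also have "(\<integral>\<^sup>+S. (\<Prod>i<n. ennreal (exp (g * c * f (S i)))) \<partial>PiM {..<n} (\<lambda>_. \<mu>))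
        = (\<Prod>i<n. \<integral>\<^sup>+z. ennreal (exp (g * c * f z)) \<partial>\<mu>)"
      by (rule PF.product_nn_integral_prod) auto
    also have "\<dots> \<le> (\<Prod>i<n. ennreal (exp ((g * c)\<^sup>2 * v / 2)))"
      by (intro prod_mono_ennreal sub)
    also have "\<dots> = ennreal (exp (real n * ((g * c)\<^sup>2 * v / 2)))"
      by (simp add: ennreal_power exp_of_nat_mult[symmetric])
    also have "real n * ((g * c)\<^sup>2 * v / 2) = g\<^sup>2 / 4"
      unfolding power_mult_distrib c2 using n v by (simp add: field_simps)
    finally show "(\<integral>\<^sup>+S. ennreal (std_normal_density g * exp (g * (c * (\<Sum>i<n. f (S i))))) \<partial>PiM {..<n} (\<lambda>_. \<mu>)) \<le> ennreal (std_normal_density g * exp (g\<^sup>2 / 4))"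
      by (simp add: ennreal_mult' mult_left_mono)
  qed
  also have "\<dots> = ennreal (sqrt 2)" by (rule normal_square_exp_moment)
  finally show ?thesis .
qed

text \<open>For a loss that is not integrable \<open>risk\<close> would have the default value 0, so
  integrability must be derived whatever the number \<open>risk\<close> is: the exponential moment
  at \<open>s = 1\<close> dominates the nonnegative loss up to a constant.\<close>

lemma subgaussian_integrable:
  assumes "prob_space \<mu>" and sub: "subgaussian \<mu> loss v" and [measurable]: "loss w \<in> borel_measurable \<mu>"
    and nonneg: "\<And>z. z \<in> space \<mu> \<Longrightarrow> loss w z \<ge> 0"
  shows "integrable \<mu> (loss w)"
proof -
  interpret prob_space \<mu> by fact
  let ?e = "\<lambda>z. exp (loss w z - risk \<mu> loss w)"
  have "(\<integral>\<^sup>+z. ennreal (exp (1 * (loss w z - risk \<mu> loss w))) \<partial>\<mu>) \<le> ennreal (exp (1\<^sup>2 * v / 2))"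
    using sub unfolding subgaussian_def by blast
  then have "integrable \<mu> ?e"
    by (intro integrableI_nonneg) (auto intro: le_less_trans)
  then have "integrable \<mu> (\<lambda>z. ?e z + \<bar>risk \<mu> loss w\<bar>)" by simp
  then show ?thesis
  proof (rule Bochner_Integration.integrable_bound)
    show "AE z in \<mu>. norm (loss w z) \<le> norm (?e z + \<bar>risk \<mu> loss w\<bar>)"
    proof (rule AE_I2)
      fix z assume "z \<in> space \<mu>"
      then have "0 \<le> loss w z" by (rule nonneg)
      moreover have "loss w z \<le> ?e z + \<bar>risk \<mu> loss w\<bar>"
        using exp_ge_add_one_self[of "loss w z - risk \<mu> loss w"] by linarith
      ultimately show "norm (loss w z) \<le> norm (?e z + \<bar>risk \<mu> loss w\<bar>)" by simp
    qed
  qed simp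
qed

text \<open>An average of convex functions is convex, and a finite convex function on the whole
  space is continuous. Dominated convergence would ask for bounds uniform in \<open>z\<close>,
  whereas the regularity of the loss is assumed for each \<open>z\<close> separately.\<close>

lemma continuous_risk:
  fixes loss :: "'a::euclidean_space \<Rightarrow> 'z \<Rightarrow> real"
  assumes int: "\<And>w. integrable \<mu> (loss w)" and \<gamma>: "\<gamma> > 0"
    and sc: "\<And>z. z \<in> space \<mu> \<Longrightarrow> strongly_convex \<gamma> (\<lambda>w. loss w z)"
  shows "continuous_on UNIV (risk \<mu> loss)"
proof (rule convex_on_continuous)
  show "convex_on UNIV (risk \<mu> loss)"
  proof (rule convex_onI)
    fix t :: real and x y :: 'a assume t: "0 < t" "t < 1"
    have "risk \<mu> loss ((1 - t) *\<^sub>R x + t *\<^sub>R y) \<le> (\<integral>z. (1 - t) * loss x z + t * loss y z \<partial>\<mu>)"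
      unfolding risk_def
    proof (rule integral_mono)
      fix z assume "z \<in> space \<mu>"
      then have "loss ((1 - t) *\<^sub>R x + t *\<^sub>R y) z \<le> (1 - t) * loss x z + t * loss y z - \<gamma> / 2 * t * (1 - t) * (norm (x - y))\<^sup>2"
        using sc[unfolded strongly_convex_def] t by auto
      also have "\<dots> \<le> (1 - t) * loss x z + t * loss y z" using t \<gamma> by simp
      finally show "loss ((1 - t) *\<^sub>R x + t *\<^sub>R y) z \<le> (1 - t) * loss x z + t * loss y z" .
    qed (use int in auto)
    also have "\<dots> = (1 - t) * risk \<mu> loss x + t * risk \<mu> loss y"
      unfolding risk_def using int by simp
    finally show "risk \<mu> loss ((1 - t) *\<^sub>R x + t *\<^sub>R y) \<le> (1 - t) * risk \<mu> loss x + t * risk \<mu> loss y" .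
  qed simp
qed simp

text \<open>The moment bound holds for each fixed \<open>w\<close>; Fubini averages it over
  \<open>\<pi>\<close>, and Markov's inequality gives the event. No iterate and no time occur in its
  definition, hence it can be used for all of them at once.\<close>

lemma pac_bayes_event:
  fixes loss :: "'a::euclidean_space \<Rightarrow> 'z \<Rightarrow> real"
  assumes "prob_space \<mu>" "prob_space \<pi>" and sets\<pi>: "sets \<pi> = sets borel" and n: "n \<ge> 1" and v: "v > 0"
    and \<zeta>: "0 < \<zeta>" and meas: "\<And>w. loss w \<in> borel_measurable \<mu>"
    and cont: "\<And>z. z \<in> space \<mu> \<Longrightarrow> continuous_on UNIV (\<lambda>w. loss w z)"
    and contr: "continuous_on UNIV (risk \<mu> loss)" and sub: "subgaussian \<mu> loss v"
  shows "\<exists>A\<in>sets (PiM {..<n} (\<lambda>_. \<mu>)). measure (PiM {..<n} (\<lambda>_. \<mu>)) A \<ge> 1 - \<zeta> \<and>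
    (\<forall>S\<in>A. (\<integral>\<^sup>+w. ennreal (exp (real n * (gen_gap \<mu> loss n S w)\<^sup>2 / (4 * v))) \<partial>\<pi>) \<le> ennreal (3 / \<zeta>))"
proof -
  interpret \<mu>: prob_space \<mu> by fact
  interpret \<pi>: prob_space \<pi> by fact
  let ?P = "PiM {..<n} (\<lambda>_. \<mu>)"
  interpret P: prob_space ?P by (rule prob_space_PiM) (rule \<mu>.prob_space_axioms)
  interpret pp: pair_sigma_finite ?P \<pi> ..
  note [measurable_cong] = sets\<pi>
  have [measurable]: "risk \<mu> loss \<in> borel_measurable borel" using contr by (rule borel_measurable_continuous_onI)
  note car = borel_measurable_caratheodory[OF meas cont]
  have gap_eq: "gen_gap \<mu> loss n S w = (\<Sum>i<n. risk \<mu> loss w - loss w (S i)) / n" for S w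
    using n by (simp add: gen_gap_def emp_risk_def sum_subtractf diff_divide_distrib)
  have gap_meas: "(\<lambda>p. gen_gap \<mu> loss n (fst p) (snd p)) \<in> borel_measurable (?P \<Otimes>\<^sub>M \<pi>)"
  proof -
    have "(\<lambda>p. loss (snd p) (fst p i)) \<in> borel_measurable (?P \<Otimes>\<^sub>M \<pi>)" if "i < n" for i
    proof -
      have "(\<lambda>p. (snd p, fst p i)) \<in> measurable (?P \<Otimes>\<^sub>M \<pi>) (borel \<Otimes>\<^sub>M \<mu>)"
      proof (rule measurable_Pair)
        have "(\<lambda>S. S i) \<in> measurable ?P \<mu>"
          using that by (intro measurable_component_singleton) simp
        then show "(\<lambda>p. fst p i) \<in> measurable (?P \<Otimes>\<^sub>M \<pi>) \<mu>"
          by (rule measurable_compose[OF measurable_fst])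
      qed measurable
      from measurable_compose[OF this car] show ?thesis by simp
    qed
    then show ?thesis unfolding gap_eq
      by (intro borel_measurable_divide borel_measurable_sum borel_measurable_diff) auto
  qed
  define E where "E S w = ennreal (exp (real n * (gen_gap \<mu> loss n S w)\<^sup>2 / (4 * v)))" for S w
  have E_meas[measurable]: "(\<lambda>p. E (fst p) (snd p)) \<in> borel_measurable (?P \<Otimes>\<^sub>M \<pi>)"
    unfolding E_def using gap_meas by measurable
  define Z where "Z S = (\<integral>\<^sup>+w. E S w \<partial>\<pi>)" for S
  have Z_meas[measurable]: "Z \<in> borel_measurable ?P"
    unfolding Z_def using E_meas by (intro \<pi>.borel_measurable_nn_integral) (simp add: case_prod_beta')
  have "(\<integral>\<^sup>+S. Z S \<partial>?P) = (\<integral>\<^sup>+w. (\<integral>\<^sup>+S. E S w \<partial>?P) \<partial>\<pi>)"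
    unfolding Z_def using E_meas by (intro pp.Fubini'[symmetric]) (simp add: case_prod_beta')
  also have "\<dots> \<le> (\<integral>\<^sup>+w. ennreal (sqrt 2) \<partial>\<pi>)"
  proof (rule nn_integral_mono)
    fix w
    show "(\<integral>\<^sup>+S. E S w \<partial>?P) \<le> ennreal (sqrt 2)"
      unfolding E_def gap_eq
    proof (rule subgaussian_square_moment)
      show "(\<lambda>z. risk \<mu> loss w - loss w z) \<in> borel_measurable \<mu>" using meas by measurable
      fix s
      have "s * (risk \<mu> loss w - loss w z) = (- s) * (loss w z - risk \<mu> loss w)" for z by (simp add: algebra_simps)
      then show "(\<integral>\<^sup>+z. ennreal (exp (s * (risk \<mu> loss w - loss w z))) \<partial>\<mu>) \<le> ennreal (exp (s\<^sup>2 * v / 2))"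
        using sub[unfolded subgaussian_def, rule_format, where s = "- s" and w = w] by (simp only: power2_minus)
    qed (use n v \<mu>.prob_space_axioms in auto)
  qed
  \<comment> \<open>The moment bound \<open>sqrt 2\<close> is rounded up to 3, the numerator in the
    logarithm of the theorem.\<close>
  also have "\<dots> \<le> ennreal 3"
  proof -
    have "sqrt 2 \<le> 3" by (rule real_le_lsqrt) auto
    then have "ennreal (sqrt 2) \<le> ennreal 3" by (rule ennreal_leI)
    then show ?thesis by (simp add: \<pi>.emeasure_space_1)
  qed
  finally have IZ: "(\<integral>\<^sup>+S. Z S \<partial>?P) \<le> ennreal 3" .
  define A where "A = {S \<in> space ?P. Z S \<le> ennreal (3 / \<zeta>)}"
  have A[measurable]: "A \<in> sets ?P" unfolding A_def by measurable
  let ?C = "{S \<in> space ?P. 1 \<le> ennreal (\<zeta> / 3) * Z S}"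
  have "space ?P - A \<subseteq> ?C"
  proof
    fix S assume "S \<in> space ?P - A"
    then have S: "S \<in> space ?P" "ennreal (3 / \<zeta>) < Z S" by (auto simp: A_def not_le)
    have "1 = ennreal (\<zeta> / 3) * ennreal (3 / \<zeta>)" using \<zeta> by (simp add: ennreal_mult'[symmetric])
    also have "\<dots> \<le> ennreal (\<zeta> / 3) * Z S" using S by (intro mult_left_mono) auto
    finally show "S \<in> ?C" using S by auto
  qed
  then have "emeasure ?P (space ?P - A) \<le> emeasure ?P ?C" by (intro emeasure_mono) auto
  also have "\<dots> \<le> ennreal (\<zeta> / 3) * (\<integral>\<^sup>+S. Z S \<partial>?P)"
  proof -
    have "emeasure ?P ?C \<le> ennreal (\<zeta> / 3) * (\<integral>\<^sup>+S. Z S * indicator (space ?P) S \<partial>?P)"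
      by (rule nn_integral_Markov_inequality) measurable
    also have "(\<integral>\<^sup>+S. Z S * indicator (space ?P) S \<partial>?P) = (\<integral>\<^sup>+S. Z S \<partial>?P)"
      by (intro nn_integral_cong) simp
    finally show ?thesis .
  qed
  also have "\<dots> \<le> ennreal (\<zeta> / 3) * ennreal 3" using IZ by (intro mult_left_mono) auto
  also have "\<dots> = ennreal \<zeta>" using \<zeta> by (subst ennreal_mult'[symmetric]) auto
  finally have "P.prob (space ?P - A) \<le> \<zeta>" using \<zeta> by (simp add: P.emeasure_eq_measure)
  then have "P.prob A \<ge> 1 - \<zeta>" by (simp add: P.prob_compl)
  then show ?thesis using A by (auto simp: A_def Z_def E_def)
qed

text \<open>A centred variable whose exponential has mean at most 1 vanishes almost surely, since
  \<open>exp x - 1 - x\<close> is nonnegative and zero only at 0. The null set depends on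
  \<open>w\<close>; a countable dense set of \<open>w\<close> and continuity yield a single
  one.\<close>

lemma subgaussian_zero_event:
  fixes loss :: "'a::euclidean_space \<Rightarrow> 'z \<Rightarrow> real"
  assumes "prob_space \<mu>" and n: "n \<ge> 1"
    and int: "\<And>w. integrable \<mu> (loss w)"
    and cont: "\<And>z. z \<in> space \<mu> \<Longrightarrow> continuous_on UNIV (\<lambda>w. loss w z)"
    and contr: "continuous_on UNIV (risk \<mu> loss)" and sub: "subgaussian \<mu> loss 0"
  shows "\<exists>A\<in>sets (PiM {..<n} (\<lambda>_. \<mu>)). measure (PiM {..<n} (\<lambda>_. \<mu>)) A = 1 \<and> (\<forall>S\<in>A. \<forall>w. gen_gap \<mu> loss n S w = 0)"
proof -
  interpret \<mu>: prob_space \<mu> by fact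
  let ?P = "PiM {..<n} (\<lambda>_. \<mu>)"
  interpret P: prob_space ?P by (rule prob_space_PiM) (rule \<mu>.prob_space_axioms)
  have const: "AE z in \<mu>. loss w z = risk \<mu> loss w" for w
  proof -
    let ?X = "\<lambda>z. loss w z - risk \<mu> loss w"
    have [measurable]: "loss w \<in> borel_measurable \<mu>" using int[of w] by simp
    have nn: "(\<integral>\<^sup>+z. ennreal (exp (?X z)) \<partial>\<mu>) \<le> 1"
      using sub[unfolded subgaussian_def, rule_format, where s = 1 and w = w] by simp
    have ie: "integrable \<mu> (\<lambda>z. exp (?X z))"
      using nn by (intro integrableI_nonneg) (use le_less_trans[OF nn ennreal_one_less_top] in auto)
    have "ennreal (\<integral>z. exp (?X z) \<partial>\<mu>) \<le> 1" using nn ie by (subst nn_integral_eq_integral[symmetric]) auto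
    then have le: "(\<integral>z. exp (?X z) \<partial>\<mu>) \<le> 1" by (simp add: ennreal_le_1)
    have iX: "integrable \<mu> ?X" "(\<integral>z. ?X z \<partial>\<mu>) = 0" using int[of w] \<mu>.prob_space by (auto simp: risk_def)
    have i: "integrable \<mu> (\<lambda>z. exp (?X z) - (1 + ?X z))" using ie iX by auto
    have nonneg: "0 \<le> exp (?X z) - (1 + ?X z)" for z using exp_ge_add_one_self[of "?X z"] by simp
    have "(\<integral>z. exp (?X z) - (1 + ?X z) \<partial>\<mu>) = (\<integral>z. exp (?X z) \<partial>\<mu>) - (1 + 0)"
      using ie iX \<mu>.prob_space by simp
    then have "(\<integral>z. exp (?X z) - (1 + ?X z) \<partial>\<mu>) = 0"
      using le Bochner_Integration.integral_nonneg[of \<mu> "\<lambda>z. exp (?X z) - (1 + ?X z)"] nonneg by simp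
    then have "AE z in \<mu>. exp (?X z) - (1 + ?X z) = 0"
      using integral_nonneg_eq_0_iff_AE[OF i] nonneg by simp
    then show ?thesis
    proof eventually_elim
      case (elim z)
      then have "ln (exp (?X z)) = exp (?X z) - 1" unfolding ln_exp by linarith
      then have "exp (?X z) = 1" by (rule ln_eq_minus_one[OF exp_gt_zero])
      then have "?X z = 0" by simp
      then show ?case by simp
    qed
  qed
  obtain D :: "'a set" where D: "countable D" "\<And>X. open X \<Longrightarrow> X \<noteq> {} \<Longrightarrow> \<exists>d\<in>D. d \<in> X"
    by (rule countable_dense_setE) blast
  have dense: "closure D = UNIV"
  proof -
    have "x \<in> closure D" for x
      unfolding closure_approachable using D(2)[of "ball x e" for e] by (auto simp: dist_commute)
    then show ?thesis by auto
  qed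
  have "AE S in ?P. \<forall>d\<in>D. gen_gap \<mu> loss n S d = 0"
  proof (rule AE_ball_countable'[OF _ D(1)])
    fix d
    have "AE S in ?P. \<forall>i\<in>{..<n}. loss d (S i) = risk \<mu> loss d"
    proof (rule AE_finite_allI)
      fix i assume i: "i \<in> {..<n}"
      show "AE S in ?P. loss d (S i) = risk \<mu> loss d"
        by (rule AE_PiM_component[OF _ i const]) (rule \<mu>.prob_space_axioms)
    qed simp
    then show "AE S in ?P. gen_gap \<mu> loss n S d = 0"
      using n by (auto elim!: eventually_mono simp: gen_gap_def emp_risk_def)
  qed
  then obtain N where N: "{S \<in> space ?P. \<not> (\<forall>d\<in>D. gen_gap \<mu> loss n S d = 0)} \<subseteq> N" "N \<in> sets ?P" "emeasure ?P N = 0"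
    by (auto elim!: AE_E)
  define A where "A = space ?P - N"
  have "gen_gap \<mu> loss n S w = 0" if S: "S \<in> A" for S w
  proof -
    have Si: "S i \<in> space \<mu>" if "i < n" for i using S that by (auto simp: A_def space_PiM PiE_iff)
    have "continuous_on UNIV (\<lambda>w. gen_gap \<mu> loss n S w)"
      unfolding gen_gap_def emp_risk_def using Si by (intro continuous_intros contr cont) auto
    moreover have "\<forall>d\<in>D. gen_gap \<mu> loss n S d = 0" using S N(1) by (auto simp: A_def)
    ultimately have "gen_gap \<mu> loss n S w = 0" if "w \<in> closure D" for w
      using continuous_constant_on_closure[of D "\<lambda>w. gen_gap \<mu> loss n S w" 0 w] dense that by auto
    then show ?thesis using dense by auto
  qed
  moreover have "P.prob A = 1"
  proof -
    have "P.prob N = 0" using N(3) by (simp add: measure_def)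
    then show ?thesis using P.prob_compl[OF N(2)] by (simp add: A_def)
  qed
  ultimately show ?thesis using N(2) by (intro bexI[of _ A]) (auto simp: A_def)
qed

section \<open>Strongly convex losses\<close>

lemma grad_eqI:
  fixes f :: "'a::euclidean_space \<Rightarrow> real"
  assumes "GDERIV f x :> D"
  shows "grad f x = D"
proof -
  have "f differentiable (at x)" using assms unfolding gderiv_def differentiable_def by blast
  from has_derivative_unique[OF GDERIV_grad[OF this, unfolded gderiv_def] assms[unfolded gderiv_def]]
  have "(grad f x - D) \<bullet> grad f x = (grad f x - D) \<bullet> D" by (rule fun_cong)
  then have "(grad f x - D) \<bullet> (grad f x - D) = 0" by (simp only: inner_diff_right)
  then show ?thesis by simp
qed

text \<open>Divide the inequality of strong convexity by \<open>t\<close> and let \<open>t\<close>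
  decrease to 0.\<close>

lemma strongly_convex_first_order:
  fixes f :: "'a::euclidean_space \<Rightarrow> real"
  assumes d: "f differentiable (at x)" and sc: "strongly_convex c f"
  shows "grad f x \<bullet> (y - x) \<le> f y - f x - c / 2 * (norm (x - y))\<^sup>2"
proof -
  have "(f has_derivative (\<lambda>h. h \<bullet> grad f x)) (at x)"
    using GDERIV_grad[OF d] by (simp add: gderiv_def)
  note lim = difference_quotient_limit[OF this, of "y - x"]
  have 1: "((\<lambda>t. (f (x + t *\<^sub>R (y - x)) - f x) /\<^sub>R t) \<longlongrightarrow> (y - x) \<bullet> grad f x) (at_right 0)"
    by (rule tendsto_mono[OF at_le[OF subset_UNIV] lim])
  have 2: "((\<lambda>t. f y - f x - c / 2 * (1 - t) * (norm (x - y))\<^sup>2) \<longlongrightarrow> f y - f x - c / 2 * (1 - 0) * (norm (x - y))\<^sup>2) (at_right (0::real))"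
    by (intro tendsto_intros)
  have "eventually (\<lambda>t. (f (x + t *\<^sub>R (y - x)) - f x) /\<^sub>R t \<le> f y - f x - c / 2 * (1 - t) * (norm (x - y))\<^sup>2) (at_right (0::real))"
  proof (rule eventually_mono)
    show "eventually (\<lambda>t. 0 < t \<and> t < 1) (at_right (0::real))"
      unfolding eventually_at_right_field by (auto intro!: exI[of _ 1])
    fix t :: real assume t: "0 < t \<and> t < 1"
    have eq: "(1 - t) *\<^sub>R x + t *\<^sub>R y = x + t *\<^sub>R (y - x)" by (simp add: algebra_simps)
    have arith: "u - p \<le> t * (q - p - c / 2 * (1 - t) * N)" if "u \<le> (1 - t) * p + t * q - c / 2 * t * (1 - t) * N" for u p q N
    proof -
      have "t * (q - p - c / 2 * (1 - t) * N) = (1 - t) * p + t * q - c / 2 * t * (1 - t) * N - p"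
        by (simp add: left_diff_distrib right_diff_distrib mult_ac)
      then show ?thesis using that by linarith
    qed
    have "f (x + t *\<^sub>R (y - x)) \<le> (1 - t) * f x + t * f y - c / 2 * t * (1 - t) * (norm (x - y))\<^sup>2"
      using sc[unfolded strongly_convex_def, rule_format, of t x y] t unfolding eq by simp
    then have "f (x + t *\<^sub>R (y - x)) - f x \<le> t * (f y - f x - c / 2 * (1 - t) * (norm (x - y))\<^sup>2)"
      by (rule arith)
    then have "(f (x + t *\<^sub>R (y - x)) - f x) / t \<le> f y - f x - c / 2 * (1 - t) * (norm (x - y))\<^sup>2"
      using t by (simp add: pos_divide_le_eq mult.commute)
    then show "(f (x + t *\<^sub>R (y - x)) - f x) /\<^sub>R t \<le> f y - f x - c / 2 * (1 - t) * (norm (x - y))\<^sup>2"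
      by (simp only: real_scaleR_def divide_inverse mult.commute)
  qed
  from tendsto_le[OF _ 2 1 this] show ?thesis by (simp add: inner_commute)
qed

lemma strongly_convex_monotone_grad:
  fixes f :: "'a::euclidean_space \<Rightarrow> real"
  assumes "\<And>x. f differentiable (at x)" and "strongly_convex c f"
  shows "c * (norm (x - y))\<^sup>2 \<le> (grad f x - grad f y) \<bullet> (x - y)"
  using strongly_convex_first_order[OF assms, of x y] strongly_convex_first_order[OF assms, of y x]
  unfolding norm_minus_commute[of y x] inner_diff_left inner_diff_right by linarith

text \<open>Subtracting half the squared norm from \<open>f / c\<close> uses up exactly the strong
  convexity, so the gradient of \<open>g\<close> is still monotone. The last identity splits the
  drift into the linear part of the autoregression and the field \<open>grad g\<close>.\<close>

lemma strongly_convex_monotone_field: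
  fixes f :: "'a::euclidean_space \<Rightarrow> real"
  assumes C2: "C2 f" and sc: "strongly_convex c f" and c: "c > 0" and lip: "L-lipschitz_on UNIV (grad f)"
    and g: "\<And>y. g y = f y / c - (norm y)\<^sup>2 / 2"
  obtains V' where "monotone_field (grad g) V' (L / c + 1)"
    "\<And>x. laplacian g x = monotone_field.divergence V' x" "\<And>x. grad f x = c *\<^sub>R (x + grad g x)"
proof -
  obtain H :: "'a \<Rightarrow> 'a \<Rightarrow>\<^sub>L 'a" where d: "\<And>x. f differentiable (at x)"
    and H: "\<And>x. (grad f has_derivative blinfun_apply (H x)) (at x)" and contH: "continuous_on UNIV H"
    using C2 unfolding C2_def by auto
  have Dg: "GDERIV g x :> grad f x /\<^sub>R c - x" for x
  proof -
    have df: "(f has_derivative (\<lambda>h. h \<bullet> grad f x)) (at x)"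
      using GDERIV_grad[OF d] by (simp add: gderiv_def)
    have dn: "((\<lambda>y. y \<bullet> y) has_derivative (\<lambda>h. x \<bullet> h + h \<bullet> x)) (at x)"
      by (rule has_derivative_inner[OF has_derivative_ident has_derivative_ident])
    have geq: "g = (\<lambda>y. (1 / c) * f y - (1 / 2) * (y \<bullet> y))"
      by (rule ext) (simp add: g power2_norm_eq_inner)
    have heq: "(\<lambda>h. (1 / c) * (h \<bullet> grad f x) - (1 / 2) * (x \<bullet> h + h \<bullet> x)) = (\<lambda>h. h \<bullet> (grad f x /\<^sub>R c - x))"
      by (rule ext) (simp add: inner_commute[of x] inner_diff_right inverse_eq_divide)
    have "(g has_derivative (\<lambda>h. (1 / c) * (h \<bullet> grad f x) - (1 / 2) * (x \<bullet> h + h \<bullet> x))) (at x)"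
      unfolding geq by (rule has_derivative_diff has_derivative_mult_right df dn)+
    then show ?thesis unfolding gderiv_def heq .
  qed
  have gg: "grad g x = grad f x /\<^sub>R c - x" for x by (rule grad_eqI[OF Dg])
  define V' where "V' x = H x /\<^sub>R c - id_blinfun" for x
  have V'a: "blinfun_apply (V' x) h = blinfun_apply (H x) h /\<^sub>R c - h" for x h
    by (simp add: V'_def blinfun.diff_left blinfun.scaleR_left)
  have mf: "monotone_field (grad g) V' (L / c + 1)"
  proof
    show "(grad g has_derivative blinfun_apply (V' x)) (at x)" for x
    proof -
      have "((\<lambda>x. grad f x /\<^sub>R c - x) has_derivative (\<lambda>h. blinfun_apply (H x) h /\<^sub>R c - h)) (at x)"
        by (intro has_derivative_diff has_derivative_scaleR_right H has_derivative_ident)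
      then show ?thesis by (simp add: gg[abs_def] V'a[abs_def])
    qed
    show "continuous_on UNIV V'" unfolding V'_def by (intro continuous_intros contH)
    fix x y
    have eq: "grad g x - grad g y = (grad f x - grad f y) /\<^sub>R c - (x - y)"
      by (simp add: gg algebra_simps)
    have "(norm (x - y))\<^sup>2 = c * (norm (x - y))\<^sup>2 / c" using c by simp
    also have "\<dots> \<le> ((grad f x - grad f y) \<bullet> (x - y)) / c"
      using strongly_convex_monotone_grad[OF d sc, of x y] c by (intro divide_right_mono) auto
    finally show "0 \<le> (grad g x - grad g y) \<bullet> (x - y)"
      unfolding eq by (simp add: inner_diff_left power2_norm_eq_inner[symmetric] divide_inverse mult.commute)
    have "norm (grad g x - grad g y) \<le> norm ((grad f x - grad f y) /\<^sub>R c) + norm (x - y)"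
      unfolding eq by (rule norm_triangle_ineq4)
    also have "norm ((grad f x - grad f y) /\<^sub>R c) = norm (grad f x - grad f y) / c"
      using c by (simp add: divide_inverse mult.commute)
    also have "\<dots> \<le> (L * norm (x - y)) / c"
      using lipschitz_onD[OF lip, of x y] c by (intro divide_right_mono) (auto simp: dist_norm)
    finally show "norm (grad g x - grad g y) \<le> (L / c + 1) * norm (x - y)" by (simp add: algebra_simps)
  qed
  have lap: "laplacian g x = monotone_field.divergence V' x" for x
    unfolding laplacian_def monotone_field.divergence_def[OF mf]
  proof (rule sum.cong[OF refl])
    fix b :: 'a
    have line: "((\<lambda>t. x + t *\<^sub>R b) has_derivative (\<lambda>h. h *\<^sub>R b)) (at t)" for t
      by (auto intro!: derivative_eq_intros)
    have 1: "((\<lambda>t. g (x + t *\<^sub>R b)) has_real_derivative b \<bullet> grad g (x + t *\<^sub>R b)) (at t)" for t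
      unfolding has_field_derivative_def
      by (rule has_derivative_eq_rhs[OF has_derivative_compose[OF line[of t] Dg[unfolded gderiv_def]]])
        (simp add: fun_eq_iff gg)
    have 2: "((\<lambda>t. b \<bullet> grad g (x + t *\<^sub>R b)) has_real_derivative b \<bullet> blinfun_apply (V' (x + t *\<^sub>R b)) b) (at t)" for t
      unfolding has_field_derivative_def
      by (rule has_derivative_eq_rhs
          [OF has_derivative_inner_right[OF has_derivative_compose[OF line[of t] monotone_field.deriv[OF mf]], of b]])
        (simp add: fun_eq_iff blinfun.scaleR_right)
    have "deriv (\<lambda>t. g (x + t *\<^sub>R b)) = (\<lambda>t. b \<bullet> grad g (x + t *\<^sub>R b))"
      using 1 by (auto intro!: DERIV_imp_deriv)
    moreover have "deriv (\<lambda>t. b \<bullet> grad g (x + t *\<^sub>R b)) 0 = b \<bullet> blinfun_apply (V' (x + 0 *\<^sub>R b)) b"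
      using 2 by (rule DERIV_imp_deriv)
    ultimately show "(deriv ^^ 2) (\<lambda>t. g (x + t *\<^sub>R b)) 0 = blinfun_apply (V' x) b \<bullet> b"
      by (simp add: numeral_2_eq_2 inner_commute)
  qed
  show ?thesis
  proof (rule that[OF mf lap])
    show "grad f x = c *\<^sub>R (x + grad g x)" for x using c by (simp add: gg scaleR_add_right)
  qed
qed

lemma emp_risk_regular:
  fixes loss :: "'a::euclidean_space \<Rightarrow> 'z \<Rightarrow> real"
  assumes n: "n \<ge> 1" and C2: "\<And>i. i < n \<Longrightarrow> C2 (\<lambda>w. loss w (S i))"
    and sc: "\<And>i. i < n \<Longrightarrow> strongly_convex c (\<lambda>w. loss w (S i))"
    and lip: "\<And>i. i < n \<Longrightarrow> \<exists>C. C-lipschitz_on UNIV (grad (\<lambda>w. loss w (S i)))"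
  shows "C2 (emp_risk loss n S)" "strongly_convex c (emp_risk loss n S)"
    "\<exists>C. C-lipschitz_on UNIV (grad (emp_risk loss n S))"
proof -
  let ?f = "\<lambda>i w. loss w (S i)"
  have d: "?f i differentiable (at x)" if "i < n" for i x using C2[OF that] unfolding C2_def by auto
  have "\<forall>i\<in>{..<n}. \<exists>H :: 'a \<Rightarrow> 'a \<Rightarrow>\<^sub>L 'a. (\<forall>x. (grad (?f i) has_derivative blinfun_apply (H x)) (at x)) \<and> continuous_on UNIV H"
    using C2 unfolding C2_def by blast
  from bchoice[OF this] obtain H :: "nat \<Rightarrow> 'a \<Rightarrow> 'a \<Rightarrow>\<^sub>L 'a"
    where H0: "\<forall>i\<in>{..<n}. (\<forall>x. (grad (?f i) has_derivative blinfun_apply (H i x)) (at x)) \<and> continuous_on UNIV (H i)" ..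
  have H: "(grad (?f i) has_derivative blinfun_apply (H i x)) (at x)" and contH: "continuous_on UNIV (H i)" if "i < n" for i x
    using H0 that by auto
  have D: "GDERIV (emp_risk loss n S) x :> (1 / real n) *\<^sub>R (\<Sum>i<n. grad (?f i) x)" for x
  proof -
    have "((\<lambda>w. 1 / real n * (\<Sum>i<n. ?f i w)) has_derivative (\<lambda>h. 1 / real n * (\<Sum>i<n. h \<bullet> grad (?f i) x))) (at x)"
      by (rule has_derivative_mult_right, rule has_derivative_sum, rule GDERIV_grad[OF d, unfolded gderiv_def]) simp
    then show ?thesis unfolding gderiv_def emp_risk_def[abs_def] by (simp add: inner_sum_right)
  qed
  have g: "grad (emp_risk loss n S) x = (1 / real n) *\<^sub>R (\<Sum>i<n. grad (?f i) x)" for x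
    by (rule grad_eqI[OF D])
  show "C2 (emp_risk loss n S)"
    unfolding C2_def
  proof (intro conjI allI exI[of _ "\<lambda>x. (1 / real n) *\<^sub>R (\<Sum>i<n. H i x)"])
    show "emp_risk loss n S differentiable (at x)" for x
      using D[of x] unfolding gderiv_def differentiable_def by blast
    show "(grad (emp_risk loss n S) has_derivative blinfun_apply ((1 / real n) *\<^sub>R (\<Sum>i<n. H i x))) (at x)" for x
    proof -
      have "((\<lambda>x. (1 / real n) *\<^sub>R (\<Sum>i<n. grad (?f i) x)) has_derivative (\<lambda>h. (1 / real n) *\<^sub>R (\<Sum>i<n. blinfun_apply (H i x) h))) (at x)"
        by (rule has_derivative_scaleR_right, rule has_derivative_sum, rule H) simp
      moreover have "blinfun_apply ((1 / real n) *\<^sub>R (\<Sum>i<n. H i x)) = (\<lambda>h. (1 / real n) *\<^sub>R (\<Sum>i<n. blinfun_apply (H i x) h))"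
        by (simp add: fun_eq_iff blinfun.scaleR_left blinfun.sum_left)
      ultimately show ?thesis by (simp add: g[abs_def])
    qed
    show "continuous_on UNIV (\<lambda>x. (1 / real n) *\<^sub>R (\<Sum>i<n. H i x))"
      using contH by (intro continuous_intros) auto
  qed
  show "strongly_convex c (emp_risk loss n S)"
    unfolding strongly_convex_def
  proof (intro allI ballI)
    fix x y and t :: real assume t: "t \<in> {0..1}"
    have "(\<Sum>i<n. ?f i ((1 - t) *\<^sub>R x + t *\<^sub>R y))
        \<le> (\<Sum>i<n. (1 - t) * ?f i x + t * ?f i y - c / 2 * t * (1 - t) * (norm (x - y))\<^sup>2)"
      using sc t unfolding strongly_convex_def by (intro sum_mono) auto
    also have "\<dots> = (1 - t) * (\<Sum>i<n. ?f i x) + t * (\<Sum>i<n. ?f i y) - n * (c / 2 * t * (1 - t) * (norm (x - y))\<^sup>2)"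
      by (simp add: sum.distrib sum_subtractf sum_distrib_left)
    finally have "1 / real n * (\<Sum>i<n. ?f i ((1 - t) *\<^sub>R x + t *\<^sub>R y))
        \<le> 1 / real n * ((1 - t) * (\<Sum>i<n. ?f i x) + t * (\<Sum>i<n. ?f i y) - n * (c / 2 * t * (1 - t) * (norm (x - y))\<^sup>2))"
      by (intro mult_left_mono) auto
    also have "\<dots> = (1 - t) * (1 / real n * (\<Sum>i<n. ?f i x)) + t * (1 / real n * (\<Sum>i<n. ?f i y)) - c / 2 * t * (1 - t) * (norm (x - y))\<^sup>2"
    proof -
      have "1 / real n * (p * a + q * b - real n * z) = p * (1 / real n * a) + q * (1 / real n * b) - z" for p q a b z :: real
      proof -
        have "1 / real n * (real n * z) = z" using n by simp
        then show ?thesis by (simp only: right_diff_distrib distrib_left mult.left_commute[of "1 / real n"])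
      qed
      then show ?thesis .
    qed
    finally show "emp_risk loss n S ((1 - t) *\<^sub>R x + t *\<^sub>R y)
        \<le> (1 - t) * emp_risk loss n S x + t * emp_risk loss n S y - c / 2 * t * (1 - t) * (norm (x - y))\<^sup>2"
      unfolding emp_risk_def .
  qed
  have "\<forall>i\<in>{..<n}. \<exists>C. C-lipschitz_on UNIV (grad (?f i))" using lip by simp
  from bchoice[OF this] obtain C :: "nat \<Rightarrow> real" where C0: "\<forall>i\<in>{..<n}. (C i)-lipschitz_on UNIV (grad (?f i))" ..
  have C: "(C i)-lipschitz_on UNIV (grad (?f i))" if "i < n" for i using C0 that by simp
  have "(1 / real n * (\<Sum>i<n. C i))-lipschitz_on UNIV (grad (emp_risk loss n S))"
  proof (rule lipschitz_onI)
    show "0 \<le> 1 / real n * (\<Sum>i<n. C i)" using lipschitz_on_nonneg[OF C] by (intro mult_nonneg_nonneg sum_nonneg) auto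
    fix x y
    have "dist (grad (emp_risk loss n S) x) (grad (emp_risk loss n S) y) = 1 / real n * norm (\<Sum>i<n. grad (?f i) x - grad (?f i) y)"
      unfolding dist_norm g scaleR_diff_right[symmetric] sum_subtractf by simp
    also have "\<dots> \<le> 1 / real n * (\<Sum>i<n. C i * dist x y)"
      using lipschitz_onD[OF C] by (intro mult_left_mono sum_norm_le) (auto simp: dist_norm)
    finally show "dist (grad (emp_risk loss n S) x) (grad (emp_risk loss n S) y) \<le> 1 / real n * (\<Sum>i<n. C i) * dist x y"
      by (simp add: sum_distrib_right)
  qed
  then show "\<exists>C. C-lipschitz_on UNIV (grad (emp_risk loss n S))" by blast
qed

section \<open>The entropy bound\<close>

text \<open>The iterates as functions of the initial state and the whole noise sequence, because the
  Poisson process is assumed independent of that pair. The map \<open>D\<close> includes the step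
  size.\<close>

primrec iterates :: "('a::real_vector \<Rightarrow> 'a) \<Rightarrow> real \<Rightarrow> nat \<Rightarrow> 'a \<times> (nat \<Rightarrow> 'a) \<Rightarrow> 'a" where
  "iterates D \<sigma> 0 p = fst p"
| "iterates D \<sigma> (Suc k) p = iterates D \<sigma> k p - D (iterates D \<sigma> k p + \<sigma> *\<^sub>R snd p k)"

lemma measurable_iterates:
  fixes D :: "'a::euclidean_space \<Rightarrow> 'a"
  assumes [measurable]: "D \<in> borel_measurable borel"
  shows "iterates D \<sigma> k \<in> borel_measurable (borel \<Otimes>\<^sub>M PiM UNIV (\<lambda>_. borel))"
proof (induction k)
  case (Suc k)
  note [measurable] = Suc
  have [measurable]: "(\<lambda>p::'a \<times> (nat \<Rightarrow> 'a). snd p k) \<in> borel_measurable (borel \<Otimes>\<^sub>M PiM UNIV (\<lambda>_. borel))"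
    by (rule measurable_compose[OF measurable_snd measurable_component_singleton]) simp
  have "iterates D \<sigma> (Suc k) = (\<lambda>p. iterates D \<sigma> k p - D (iterates D \<sigma> k p + \<sigma> *\<^sub>R snd p k))"
    by (rule ext) simp
  then show ?case by simp
qed simp

lemma (in prob_space) poisson_process_measurable:
  assumes "poisson_process r N" "0 \<le> t"
  shows "N t \<in> measurable M (count_space UNIV)"
  using assms(1)[unfolded poisson_process_def, THEN conjunct1, rule_format, OF assms(2)] .

text \<open>Each iterate is a measurable function of the pair that is independent of the Poisson
  process, so the state after a Poisson number of steps has a mixture of the laws of the
  iterates.\<close>

lemma (in prob_space) poissonized_mixture:
  fixes X \<xi> :: "nat \<Rightarrow> 'a \<Rightarrow> 'b::euclidean_space"
  assumes D: "D \<in> borel_measurable borel" and X: "\<And>k. X k \<in> borel_measurable M"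
    and step: "\<And>k \<omega>. \<omega> \<in> space M \<Longrightarrow> X (Suc k) \<omega> = X k \<omega> - D (X k \<omega> + \<sigma> *\<^sub>R \<xi> k \<omega>)"
    and N: "poisson_process 1 N"
    and ind: "indep_rvs (PiM {0..} (\<lambda>_. count_space UNIV)) (\<lambda>\<omega>. \<lambda>t\<in>{0..}. N t \<omega>)
        (borel \<Otimes>\<^sub>M PiM UNIV (\<lambda>_. borel)) (\<lambda>\<omega>. (X 0 \<omega>, \<lambda>k. \<xi> k \<omega>))"
    and t: "t > 0" and \<psi>: "\<psi> \<in> borel_measurable borel"
  shows "(\<integral>\<^sup>+\<omega>. \<psi> (X (N t \<omega>) \<omega>) \<partial>M) = (\<Sum>k. ennreal (pois t k) * (\<integral>\<^sup>+\<omega>. \<psi> (X k \<omega>) \<partial>M))"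
proof -
  have XI: "X k \<omega> = iterates D \<sigma> k (X 0 \<omega>, \<lambda>k. \<xi> k \<omega>)" if "\<omega> \<in> space M" for k \<omega>
  proof (induction k)
    case (Suc k)
    then show ?case by (simp only: step[OF that] iterates.simps snd_conv)
  qed simp
  have "(\<integral>\<^sup>+\<omega>. \<psi> (X (N t \<omega>) \<omega>) \<partial>M) = (\<Sum>k. ennreal (prob {\<omega>\<in>space M. N t \<omega> = k}) * (\<integral>\<^sup>+\<omega>. \<psi> (X k \<omega>) \<partial>M))"
  proof (rule nn_integral_mixture[OF _ X \<psi>])
    show "N t \<in> measurable M (count_space UNIV)" by (rule poisson_process_measurable[OF N]) (use t in simp)
    fix k and A :: "'b set" assume A: "A \<in> sets borel"
    have eq: "{\<omega>\<in>space M. X k \<omega> \<in> A} = {\<omega>\<in>space M. iterates D \<sigma> k (X 0 \<omega>, \<lambda>k. \<xi> k \<omega>) \<in> A}"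
    proof (intro Collect_cong conj_cong refl)
      fix \<omega> assume "\<omega> \<in> space M"
      from arg_cong[OF XI[OF this], of "\<lambda>x. x \<in> A"]
      show "X k \<omega> \<in> A \<longleftrightarrow> iterates D \<sigma> k (X 0 \<omega>, \<lambda>k. \<xi> k \<omega>) \<in> A" .
    qed
    show "prob ({\<omega>\<in>space M. N t \<omega> = k} \<inter> {\<omega>\<in>space M. X k \<omega> \<in> A}) = prob {\<omega>\<in>space M. N t \<omega> = k} * prob {\<omega>\<in>space M. X k \<omega> \<in> A}"
      unfolding eq using indep_rvs_coordinate[OF ind _ measurable_iterates[OF D] A, of t] t by simp
  qed
  then show ?thesis by (simp add: poisson_process_prob[OF N t])
qed

text \<open>All Poisson weights at \<open>T > 0\<close> are positive, so finiteness of
  \<open>Q\<close> and of the initial entropy forces every \<open>J k\<close> to be finite. Hence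
  \<open>entropy_step\<close> applies at every \<open>k\<close>, and averaging its recursion over
  the number of steps yields \<open>Q\<close> and the decayed initial entropy.\<close>

lemma (in prob_space) poissonized_entropy_bound:
  fixes X \<xi> :: "nat \<Rightarrow> 'a \<Rightarrow> real ^ 'd" and N :: "real \<Rightarrow> 'a \<Rightarrow> nat" and f g :: "real ^ 'd \<Rightarrow> real"
    and \<eta> \<gamma> \<sigma> \<kappa> T :: real
  assumes pos: "\<eta> > 0" "\<sigma> > 0" "\<gamma> > 0" "\<gamma> * \<eta> < 1"
    and C2: "C2 f" and sc: "strongly_convex \<gamma> f" and lip: "\<exists>C. C-lipschitz_on UNIV (grad f)"
    and g: "\<And>y. g y = f y / \<gamma> - (norm y)\<^sup>2 / 2"
    and \<pi>: "\<pi> = gaussian (\<sigma>\<^sup>2 * \<gamma> * \<eta> / (2 - \<gamma> * \<eta>))"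
    and noise_law: "\<And>k. distr M borel (\<xi> k) = gaussian 1"
    and init: "distr M borel (X 0) = \<mu>\<^sub>0"
    and step: "\<And>k \<omega>. \<omega> \<in> space M \<Longrightarrow> X (Suc k) \<omega> = X k \<omega> - \<eta> *\<^sub>R grad f (X k \<omega> + \<sigma> *\<^sub>R \<xi> k \<omega>)"
    and ind: "\<And>k. indep_var borel (\<xi> k) borel (X k)"
    and N: "poisson_process 1 N"
    and indN: "indep_rvs (PiM {0..} (\<lambda>_. count_space UNIV)) (\<lambda>\<omega>. \<lambda>t\<in>{0..}. N t \<omega>)
        (borel \<Otimes>\<^sub>M PiM UNIV (\<lambda>_. borel)) (\<lambda>\<omega>. (X 0 \<omega>, \<lambda>k. \<xi> k \<omega>))"
    and kl: "kl \<mu>\<^sub>0 \<pi> = ereal \<kappa>" and T: "T > 0"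
    and Q: "Q = (\<integral>\<^sup>+t\<in>{0..T}. ennreal (exp (- \<eta> * \<gamma> * (T - t))) *
      (\<integral>\<^sup>+y. ennreal (2 * laplacian g y + 1 / \<sigma>\<^sup>2 * (norm (grad g y))\<^sup>2)
        \<partial>convolution (distr M borel (\<lambda>\<omega>. X (N t \<omega>) \<omega>)) (gaussian (\<sigma>\<^sup>2))) \<partial>lborel)"
    and Qfin: "Q \<noteq> \<top>"
    and \<phi>: "continuous_on UNIV \<phi>" "bounded (range \<phi>)" "\<And>x. \<phi> x \<ge> 0"
  shows "(\<integral>\<^sup>+\<omega>. ennreal (\<phi> (X (N T \<omega>) \<omega>)) \<partial>M)
    \<le> Q + ennreal (exp (- \<gamma> * \<eta> * T) * \<kappa>) + ennreal (ln (\<integral>x. exp (\<phi> x) \<partial>\<pi>))"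
    and "\<kappa> \<ge> 0"
proof -
  define \<alpha> where "\<alpha> = \<gamma> * \<eta>"
  have \<alpha>: "0 < \<alpha>" "\<alpha> < 1" using pos by (auto simp: \<alpha>_def)
  define w where "w = \<sigma>\<^sup>2"
  have w: "w > 0" using pos by (simp add: w_def)
  define v where "v = \<alpha> * w / (2 - \<alpha>)"
  have v: "v > 0" using \<alpha> w by (simp add: v_def)
  have \<pi>v: "\<pi> = gaussian v" unfolding \<pi> v_def \<alpha>_def w_def by (simp add: mult_ac)
  interpret gw: prob_space "gaussian w :: (real ^ 'd) measure" by (rule prob_space_gaussian[OF w])
  interpret pi: prob_space \<pi> unfolding \<pi>v by (rule prob_space_gaussian[OF v])
  obtain C where "C-lipschitz_on UNIV (grad f)" using lip by blast
  then obtain V' where mf: "monotone_field (grad g) V' (C / \<gamma> + 1)"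
    and lap: "\<And>x. laplacian g x = monotone_field.divergence V' x" and gradf: "\<And>x. grad f x = \<gamma> *\<^sub>R (x + grad g x)"
    using strongly_convex_monotone_field[OF C2 sc pos(3) _ g] by blast
  interpret monotone_field "grad g" V' "C / \<gamma> + 1" by (rule mf)
  define D where "D u = \<alpha> *\<^sub>R (u + grad g u)" for u
  have D[measurable]: "D \<in> borel_measurable borel" unfolding D_def by measurable
  have step': "X (Suc k) \<omega> = X k \<omega> - D (X k \<omega> + \<sigma> *\<^sub>R \<xi> k \<omega>)" if "\<omega> \<in> space M" for k \<omega>
    unfolding step[OF that] gradf D_def \<alpha>_def by (simp add: mult.commute)
  have [measurable]: "\<xi> k \<in> borel_measurable M" for k
    using ind[of k] unfolding indep_var_distribution_eq by auto
  have X[measurable]: "X k \<in> borel_measurable M" for k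
    using ind[of k] unfolding indep_var_distribution_eq by auto
  define \<nu> where "\<nu> k = distr M borel (X k)" for k
  have \<nu>: "prob_space (\<nu> k)" "sets (\<nu> k) = sets borel" for k
    unfolding \<nu>_def by (auto intro: prob_space_distr)
  define e where "e y = ennreal (2 * laplacian g y + 1 / w * (norm (grad g y))\<^sup>2)" for y
  have [measurable]: "e \<in> borel_measurable borel" unfolding e_def lap by measurable
  define J where "J k = (\<integral>\<^sup>+x. \<integral>\<^sup>+y. e (x + y) \<partial>gaussian w \<partial>\<nu> k)" for k
  have mix: "(\<integral>\<^sup>+\<omega>. \<psi> (X (N t \<omega>) \<omega>) \<partial>M) = (\<Sum>k. ennreal (pois t k) * (\<integral>\<^sup>+\<omega>. \<psi> (X k \<omega>) \<partial>M))"
    if "t > 0" "\<psi> \<in> borel_measurable borel" for t \<psi>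
    using poissonized_mixture[OF D X step' N indN that] .
  have XN[measurable]: "(\<lambda>\<omega>. X (N t \<omega>) \<omega>) \<in> borel_measurable M" if "t > 0" for t
  proof (rule measurable_compose_countable)
    show "N t \<in> measurable M (count_space UNIV)" by (rule poisson_process_measurable[OF N]) (use that in simp)
  qed (rule X)
  have energy: "(\<integral>\<^sup>+y. e y \<partial>convolution (distr M borel (\<lambda>\<omega>. X (N t \<omega>) \<omega>)) (gaussian w)) = (\<Sum>j. ennreal (pois t j) * J j)"
    if t: "t > 0" for t
  proof -
    have "(\<integral>\<^sup>+y. e y \<partial>convolution (distr M borel (\<lambda>\<omega>. X (N t \<omega>) \<omega>)) (gaussian w))
        = (\<integral>\<^sup>+x. \<integral>\<^sup>+y. e (x + y) \<partial>gaussian w \<partial>distr M borel (\<lambda>\<omega>. X (N t \<omega>) \<omega>))"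
      using XN[OF t] by (intro nn_integral_convolution) (auto intro: finite_measure_distr gw.finite_measure_axioms)
    also have "\<dots> = (\<integral>\<^sup>+\<omega>. (\<lambda>x. \<integral>\<^sup>+y. e (x + y) \<partial>gaussian w) (X (N t \<omega>) \<omega>) \<partial>M)"
      using XN[OF t] by (subst nn_integral_distr) auto
    also have "\<dots> = (\<Sum>j. ennreal (pois t j) * (\<integral>\<^sup>+\<omega>. (\<lambda>x. \<integral>\<^sup>+y. e (x + y) \<partial>gaussian w) (X j \<omega>) \<partial>M))"
      by (rule mix[OF t]) measurable
    also have "\<dots> = (\<Sum>j. ennreal (pois t j) * J j)"
      unfolding J_def \<nu>_def by (simp add: nn_integral_distr)
    finally show ?thesis .
  qed
  have Q': "Q = (\<integral>\<^sup>+t\<in>{0..T}. ennreal (exp (- \<alpha> * (T - t))) * (\<Sum>j. ennreal (pois t j) * J j) \<partial>lborel)"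
    unfolding Q
  proof (rule nn_integral_cong_AE)
    \<comment> \<open>Time 0 is discarded as a null set, since the mixture formula is available for
      positive times.\<close>
    show "AE t in lborel. ennreal (exp (- \<eta> * \<gamma> * (T - t))) *
      (\<integral>\<^sup>+y. ennreal (2 * laplacian g y + 1 / \<sigma>\<^sup>2 * (norm (grad g y))\<^sup>2)
        \<partial>convolution (distr M borel (\<lambda>\<omega>. X (N t \<omega>) \<omega>)) (gaussian (\<sigma>\<^sup>2))) * indicator {0..T} t
      = ennreal (exp (- \<alpha> * (T - t))) * (\<Sum>j. ennreal (pois t j) * J j) * indicator {0..T} t"
      using AE_lborel_singleton[of "0::real"]
    proof eventually_elim
      case (elim t)
      have "- \<eta> * \<gamma> * (T - t) = - \<alpha> * (T - t)" by (simp add: \<alpha>_def)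
      then show ?case
        using elim energy[of t] unfolding e_def w_def by (cases "t \<in> {0..T}") auto
    qed
  qed
  have dv0: "dv_bound \<pi> (\<nu> 0) \<kappa>"
    unfolding \<nu>_def init using kl pi.prob_space_axioms \<nu>[of 0]
    by (intro dv_bound_kl) (auto simp: \<nu>_def init \<pi>v)
  show \<kappa>: "\<kappa> \<ge> 0" using dv_bound_nonneg[OF pi.prob_space_axioms dv0] .
  \<comment> \<open>The entropy bounds are built as extended numbers, for which the averaging
    formula holds unconditionally; their finiteness is read off from the average.\<close>
  define B where "B = rec_nat (ennreal \<kappa>) (\<lambda>k b. ennreal (1 - \<alpha>) * b + J k)"
  have B0: "B 0 = ennreal \<kappa>" and BS: "B (Suc k) = ennreal (1 - \<alpha>) * B k + J k" for k
    by (simp_all add: B_def)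
  have avg: "(\<Sum>k. ennreal (pois T k) * B k) = ennreal (exp (- \<alpha> * T)) * ennreal \<kappa> + Q"
    using pois_average_recursion[of T \<alpha> B J] T \<alpha> BS unfolding Q' B0[symmetric] by simp
  have Bfin: "B k \<noteq> \<top>" for k
  proof
    assume "B k = \<top>"
    moreover have "ennreal (pois T k) > 0" using T by (simp add: pois_def)
    ultimately have "ennreal (pois T k) * B k = \<top>" by (simp add: ennreal_mult_top)
    moreover have "ennreal (pois T k) * B k \<le> (\<Sum>k. ennreal (pois T k) * B k)"
      using sum_le_suminf[of "\<lambda>k. ennreal (pois T k) * B k" "{k}"] by simp
    ultimately have "(\<Sum>k. ennreal (pois T k) * B k) = \<top>" by (simp add: top_unique)
    then show False using avg Qfin by (simp add: ennreal_mult'[symmetric])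
  qed
  have Jfin: "J k \<noteq> \<top>" for k using Bfin[of "Suc k"] unfolding BS by auto
  define b where "b k = enn2real (B k)" for k
  define j where "j k = enn2real (J k)" for k
  have bB: "B k = ennreal (b k)" and jJ: "J k = ennreal (j k)" and nn: "b k \<ge> 0" "j k \<ge> 0" for k
    using Bfin[of k] Jfin[of k] by (auto simp: b_def j_def less_top)
  have bS: "b (Suc k) = (1 - \<alpha>) * b k + j k" for k
  proof -
    have "ennreal (b (Suc k)) = ennreal ((1 - \<alpha>) * b k + j k)"
      unfolding bB[symmetric] BS using \<alpha> nn by (simp add: bB jJ ennreal_mult' ennreal_plus)
    then show ?thesis using nn[of k] nn[of "Suc k"] \<alpha> by (subst (asm) ennreal_inj) auto
  qed
  have dv: "dv_bound \<pi> (\<nu> k) (b k)" for k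
  proof (induction k)
    case 0
    then show ?case using dv0 \<kappa> by (simp add: b_def B0)
  next
    case (Suc k)
    show ?case
      unfolding dv_bound_def
    proof (intro allI impI)
      fix \<psi> :: "real ^ 'd \<Rightarrow> real" assume cont: "continuous_on UNIV \<psi>" and bnd: "bounded (range \<psi>)"
      have [measurable]: "\<psi> \<in> borel_measurable borel" using cont by (rule borel_measurable_continuous_onI)
      obtain c where c: "\<And>x. \<bar>\<psi> x\<bar> \<le> c" using bnd by (auto simp: bounded_iff)
      have "(\<integral>x. \<psi> x \<partial>\<nu> (Suc k)) = expectation (\<lambda>\<omega>. \<psi> (X k \<omega> - D (X k \<omega> + \<sigma> *\<^sub>R \<xi> k \<omega>)))"
        unfolding \<nu>_def by (subst integral_distr) (auto intro!: Bochner_Integration.integral_cong simp: step')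
      also have "\<dots> = (\<integral>x. (\<integral>y. \<psi> (x - D (x + y)) \<partial>gaussian w) \<partial>\<nu> k)"
        unfolding \<nu>_def w_def by (rule expectation_noisy_step[OF ind noise_law pos(2) D _ c]) measurable
      also have "\<dots> \<le> (1 - \<alpha>) * b k + j k + ln (\<integral>x. exp (\<psi> x) \<partial>gaussian v)"
        unfolding D_def
      proof (rule entropy_step[OF w \<alpha> v_def \<nu> _ nn(2) _ cont bnd])
        show "dv_bound (gaussian v) (\<nu> k) (b k)" using Suc by (simp add: \<pi>v)
        show "(\<integral>\<^sup>+x. \<integral>\<^sup>+y. ennreal (2 * divergence (x + y) + 1 / w * (norm (grad g (x + y)))\<^sup>2) \<partial>gaussian w \<partial>\<nu> k) = ennreal (j k)"
          using jJ[of k] unfolding J_def e_def lap .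
      qed
      finally show "(\<integral>x. \<psi> x \<partial>\<nu> (Suc k)) \<le> b (Suc k) + ln (\<integral>x. exp (\<psi> x) \<partial>\<pi>)" by (simp add: bS \<pi>v)
    qed
  qed
  have [measurable]: "\<phi> \<in> borel_measurable borel" using \<phi>(1) by (rule borel_measurable_continuous_onI)
  obtain c where c: "\<And>x. \<bar>\<phi> x\<bar> \<le> c" using \<phi>(2) by (auto simp: bounded_iff)
  define l where "l = ln (\<integral>x. exp (\<phi> x) \<partial>\<pi>)"
  \<comment> \<open>As \<open>\<phi>\<close> is nonnegative this logarithm is nonnegative, and the
    conversion to \<open>ennreal\<close> does not truncate it.\<close>
  have l: "l \<ge> 0"
  proof -
    have m\<pi>: "(\<lambda>x. exp (\<phi> x)) \<in> borel_measurable \<pi>" unfolding \<pi>v by measurable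
    have "integrable \<pi> (\<lambda>x. exp (\<phi> x))"
      using c m\<pi> by (intro pi.integrable_const_bound[of _ "exp c"]) (auto simp: abs_le_iff)
    then have "1 \<le> (\<integral>x. exp (\<phi> x) \<partial>\<pi>)" using \<phi>(3) by (intro pi.integral_ge_const) auto
    then show ?thesis by (simp add: l_def)
  qed
  have "(\<integral>\<^sup>+\<omega>. ennreal (\<phi> (X (N T \<omega>) \<omega>)) \<partial>M) = (\<Sum>k. ennreal (pois T k) * (\<integral>\<^sup>+\<omega>. ennreal (\<phi> (X k \<omega>)) \<partial>M))"
    by (rule mix[OF T]) measurable
  also have "\<dots> \<le> (\<Sum>k. ennreal (pois T k) * (B k + ennreal l))"
  proof (intro suminf_le mult_left_mono)
    fix k
    have i: "integrable M (\<lambda>\<omega>. \<phi> (X k \<omega>))" using c by (intro integrable_const_bound[of _ c]) auto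
    have "(\<integral>\<^sup>+\<omega>. ennreal (\<phi> (X k \<omega>)) \<partial>M) = ennreal (\<integral>\<omega>. \<phi> (X k \<omega>) \<partial>M)"
      using i \<phi>(3) by (intro nn_integral_eq_integral) auto
    also have "(\<integral>\<omega>. \<phi> (X k \<omega>) \<partial>M) = (\<integral>x. \<phi> x \<partial>\<nu> k)" unfolding \<nu>_def by (simp add: integral_distr)
    also have "ennreal \<dots> \<le> ennreal (b k + l)"
      using dv[of k] \<phi> unfolding dv_bound_def l_def by (intro ennreal_leI) auto
    also have "\<dots> = B k + ennreal l" unfolding bB using nn l by (intro ennreal_plus) auto
    finally show "(\<integral>\<^sup>+\<omega>. ennreal (\<phi> (X k \<omega>)) \<partial>M) \<le> B k + ennreal l" .
  qed auto
  also have "\<dots> = (\<Sum>k. ennreal (pois T k) * B k) + (\<Sum>k. ennreal (pois T k)) * ennreal l"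
    unfolding distrib_left ennreal_suminf_multc[symmetric] by (rule suminf_add[symmetric]) auto
  also have "(\<Sum>k. ennreal (pois T k)) = 1" using pois_geometric[of T 0] T by simp
  finally show "(\<integral>\<^sup>+\<omega>. ennreal (\<phi> (X (N T \<omega>) \<omega>)) \<partial>M) \<le> Q + ennreal (exp (- \<gamma> * \<eta> * T) * \<kappa>) + ennreal (ln (\<integral>x. exp (\<phi> x) \<partial>\<pi>))"
    unfolding avg l_def[symmetric] using \<kappa> by (simp add: \<alpha>_def ennreal_mult' add.commute mult.commute)
qed

lemma C2_continuous:
  fixes f :: "'a::euclidean_space \<Rightarrow> real"
  assumes "C2 f" shows "continuous_on UNIV f"
  using assms unfolding C2_def by (auto simp: continuous_on_eq_continuous_at intro: differentiable_imp_continuous_within)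

text \<open>Entropy bounds admit bounded test functions, whence the truncation at \<open>m\<close>;
  monotone convergence removes it, and nonnegativity of the variance passes from the square to its
  root.\<close>

lemma (in prob_space) expectation_le_sqrt:
  assumes [measurable]: "G \<in> borel_measurable M" and a: "a > 0" and W: "W \<ge> 0"
    and bnd: "\<And>m::nat. (\<integral>\<^sup>+\<omega>. ennreal (min (a * (G \<omega>)\<^sup>2) m) \<partial>M) \<le> ennreal W"
  shows "expectation G \<le> sqrt (W / a)"
proof (cases "integrable M G")
  case True
  let ?h = "\<lambda>m::nat. \<lambda>\<omega>. ennreal (min (a * (G \<omega>)\<^sup>2) m)"
  have "(\<integral>\<^sup>+\<omega>. ennreal (a * (G \<omega>)\<^sup>2) \<partial>M) = (\<integral>\<^sup>+\<omega>. (SUP m. ?h m \<omega>) \<partial>M)"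
  proof (intro nn_integral_cong antisym SUP_least)
    fix \<omega>
    obtain m :: nat where "a * (G \<omega>)\<^sup>2 \<le> m" using real_arch_simple by blast
    then have "ennreal (a * (G \<omega>)\<^sup>2) = ?h m \<omega>" by simp
    also have "\<dots> \<le> (SUP m. ?h m \<omega>)" by (rule SUP_upper) simp
    finally show "ennreal (a * (G \<omega>)\<^sup>2) \<le> (SUP m. ?h m \<omega>)" .
    show "?h m \<omega> \<le> ennreal (a * (G \<omega>)\<^sup>2)" for m by (intro ennreal_leI) simp
  qed
  also have "\<dots> = (SUP m. \<integral>\<^sup>+\<omega>. ?h m \<omega> \<partial>M)"
    by (rule nn_integral_monotone_convergence_SUP) (auto simp: incseq_def le_fun_def intro!: ennreal_leI)
  also have "\<dots> \<le> ennreal W" by (intro SUP_least bnd)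
  finally have nn: "(\<integral>\<^sup>+\<omega>. ennreal (a * (G \<omega>)\<^sup>2) \<partial>M) \<le> ennreal W" .
  have ia: "integrable M (\<lambda>\<omega>. a * (G \<omega>)\<^sup>2)"
    using a by (intro integrableI_nonneg) (use le_less_trans[OF nn] in auto)
  then have i2: "integrable M (\<lambda>\<omega>. (G \<omega>)\<^sup>2)" using a by simp
  have "ennreal (expectation (\<lambda>\<omega>. a * (G \<omega>)\<^sup>2)) \<le> ennreal W"
    using nn_integral_eq_integral[OF ia] a nn by simp
  then have "a * expectation (\<lambda>\<omega>. (G \<omega>)\<^sup>2) \<le> W" using W by (simp add: ennreal_le_iff)
  then have "expectation (\<lambda>\<omega>. (G \<omega>)\<^sup>2) \<le> W / a" using a by (simp add: pos_le_divide_eq mult.commute)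
  moreover have "(expectation G)\<^sup>2 \<le> expectation (\<lambda>\<omega>. (G \<omega>)\<^sup>2)"
    using variance_eq[OF True i2] variance_positive[of G] by simp
  ultimately show ?thesis by (intro real_le_rsqrt) linarith
next
  \<comment> \<open>The expectation then has the default value 0, which is below any square root of
    a nonnegative number.\<close>
  case False
  then show ?thesis using W a by (simp add: not_integrable_integral_eq)
qed

theorem theorem20:
  fixes \<mu>z :: "'z measure"
    and loss :: "real ^ 'd \<Rightarrow> 'z \<Rightarrow> real"
    and n :: nat
    and \<gamma> \<eta> \<sigma> \<Sigma> \<zeta> :: real
    and M :: "'w measure"
    and \<mu>\<^sub>0 \<pi> :: "(real ^ 'd) measure"
    and \<xi> :: "nat \<Rightarrow> 'w \<Rightarrow> real ^ 'd"
    and X :: "(nat \<Rightarrow> 'z) \<Rightarrow> nat \<Rightarrow> 'w \<Rightarrow> real ^ 'd"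
    and N :: "real \<Rightarrow> 'w \<Rightarrow> nat"
    and Y :: "(nat \<Rightarrow> 'z) \<Rightarrow> real \<Rightarrow> 'w \<Rightarrow> real ^ 'd"
    and \<rho> \<rho>bar :: "(nat \<Rightarrow> 'z) \<Rightarrow> real \<Rightarrow> (real ^ 'd) measure"
    and K :: "real \<Rightarrow> ereal"
  assumes "prob_space \<mu>z" and "n \<ge> 1"
    and "\<eta> > 0" and "\<sigma> > 0" and "\<gamma> > 0" and "\<gamma> * \<eta> < 1" and "\<Sigma> \<ge> 0" and "0 < \<zeta>" and "\<zeta> < 1"
    and loss_nonneg: "\<And>w z. z \<in> space \<mu>z \<Longrightarrow> loss w z \<ge> 0"
    and loss_measurable: "\<And>w. loss w \<in> borel_measurable \<mu>z"
    and loss_C2: "\<And>z. z \<in> space \<mu>z \<Longrightarrow> C2 (\<lambda>w. loss w z)"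
    and loss_strongly_convex: "\<And>z. z \<in> space \<mu>z \<Longrightarrow> strongly_convex \<gamma> (\<lambda>w. loss w z)"
    and loss_grad_lipschitz: "\<And>z. z \<in> space \<mu>z \<Longrightarrow> \<exists>C. C-lipschitz_on UNIV (grad (\<lambda>w. loss w z))"
    and loss_subgaussian: "subgaussian \<mu>z loss (\<Sigma>\<^sup>2)"
    and \<pi>_def: "\<pi> = gaussian (\<sigma>\<^sup>2 * \<gamma> * \<eta> / (2 - \<gamma> * \<eta>))"
    and \<mu>\<^sub>0_ac: "absolutely_continuous \<pi> \<mu>\<^sub>0"
    and "prob_space M"
    and noise_indep: "prob_space.indep_vars M (\<lambda>_. borel) \<xi> UNIV"
    and noise_law: "\<And>k. distr M borel (\<xi> k) = gaussian 1"
    and init_measurable: "\<And>S. S \<in> space (PiM {..<n} (\<lambda>_. \<mu>z)) \<Longrightarrow> X S 0 \<in> borel_measurable M"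
    and init_law: "\<And>S. S \<in> space (PiM {..<n} (\<lambda>_. \<mu>z)) \<Longrightarrow> distr M borel (X S 0) = \<mu>\<^sub>0"
    and step: "\<And>S k \<omega>. S \<in> space (PiM {..<n} (\<lambda>_. \<mu>z)) \<Longrightarrow> \<omega> \<in> space M \<Longrightarrow>
      X S (Suc k) \<omega> = X S k \<omega> - \<eta> *\<^sub>R grad (emp_risk loss n S) (X S k \<omega> + \<sigma> *\<^sub>R \<xi> k \<omega>)"
    and noise_indep_state: "\<And>S k. S \<in> space (PiM {..<n} (\<lambda>_. \<mu>z)) \<Longrightarrow>
      prob_space.indep_var M borel (\<xi> k) borel (X S k)"
    and poisson: "prob_space.poisson_process M 1 N"
    and poisson_indep: "\<And>S. S \<in> space (PiM {..<n} (\<lambda>_. \<mu>z)) \<Longrightarrow>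
      prob_space.indep_rvs M
        (PiM {0..} (\<lambda>_. count_space UNIV)) (\<lambda>\<omega>. \<lambda>t\<in>{0..}. N t \<omega>)
        (borel \<Otimes>\<^sub>M PiM UNIV (\<lambda>_. borel)) (\<lambda>\<omega>. (X S 0 \<omega>, \<lambda>k. \<xi> k \<omega>))"
    and Y_def: "\<And>S t \<omega>. Y S t \<omega> = X S (N t \<omega>) \<omega>"
    and \<rho>_def: "\<And>S t. \<rho> S t = distr M borel (Y S t)"
    and \<rho>bar_def: "\<And>S t. \<rho>bar S t = convolution (\<rho> S t) (gaussian (\<sigma>\<^sup>2))"
    and K_def: "\<And>T. K T = ereal (exp (- \<gamma> * \<eta> * T)) * kl \<mu>\<^sub>0 \<pi>"
  shows "\<exists>A \<in> sets (PiM {..<n} (\<lambda>_. \<mu>z)). measure (PiM {..<n} (\<lambda>_. \<mu>z)) A \<ge> 1 - \<zeta> \<and>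
    (\<forall>S\<in>A. \<forall>T>0.
      ereal (\<integral>\<omega>. gen_gap \<mu>z loss n S (Y S T \<omega>) \<partial>M)
      \<le> ereal (2 * \<Sigma> / sqrt (real n)) * ereal_sqrt
          (enn2ereal (\<integral>\<^sup>+t\<in>{0..T}. ennreal (exp (- \<eta> * \<gamma> * (T - t))) *
              (\<integral>\<^sup>+y. ennreal (2 * laplacian (Lhat loss n \<gamma> S) y
                  + 1 / \<sigma>\<^sup>2 * (norm (grad (Lhat loss n \<gamma> S) y))\<^sup>2) \<partial>\<rho>bar S t) \<partial>lborel)
           + K T + ereal (ln (3 / \<zeta>))))"
proof -
  let ?P = "PiM {..<n} (\<lambda>_. \<mu>z)"
  interpret \<mu>z: prob_space \<mu>z by fact
  interpret prob_space M by fact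
  define v where "v = \<sigma>\<^sup>2 * \<gamma> * \<eta> / (2 - \<gamma> * \<eta>)"
  have v: "v > 0" using \<open>\<eta> > 0\<close> \<open>\<sigma> > 0\<close> \<open>\<gamma> > 0\<close> \<open>\<gamma> * \<eta> < 1\<close> by (simp add: v_def)
  have \<pi>v: "\<pi> = gaussian v" by (simp add: \<pi>_def v_def)
  interpret pi: prob_space \<pi> unfolding \<pi>v by (rule prob_space_gaussian[OF v])
  have sets\<pi>: "sets \<pi> = sets borel" by (simp add: \<pi>v)
  note cont = C2_continuous[OF loss_C2]
  note int = subgaussian_integrable[OF \<open>prob_space \<mu>z\<close> loss_subgaussian loss_measurable loss_nonneg]
  note contr = continuous_risk[OF int \<open>\<gamma> > 0\<close> loss_strongly_convex]
  show ?thesis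
  \<comment> \<open>For \<open>\<Sigma> = 0\<close> the exponent of the moment bound would have
    denominator 0. The factor in front of the root is then 0, and in the extended reals it
    annihilates even an infinite root, so the gap itself has to vanish.\<close>
  proof (cases "\<Sigma> = 0")
    case True
    obtain A where A: "A \<in> sets ?P" "measure ?P A = 1" "\<And>S w. S \<in> A \<Longrightarrow> gen_gap \<mu>z loss n S w = 0"
      using subgaussian_zero_event[OF \<open>prob_space \<mu>z\<close> \<open>n \<ge> 1\<close> int cont contr] loss_subgaussian True by auto
    show ?thesis
      by (rule bexI[OF _ A(1)]) (use A(2,3) True \<open>0 < \<zeta>\<close> in \<open>auto simp flip: zero_ereal_def\<close>)
  next
    case False
    then have \<Sigma>: "\<Sigma> > 0" using \<open>\<Sigma> \<ge> 0\<close> by simp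
    \<comment> \<open>The coefficient of the squared gap in the exponential moment; the root of
      \<open>W / a\<close> produces the factor \<open>2 * \<Sigma> / sqrt n\<close>.\<close>
    define a where "a = real n / (4 * \<Sigma>\<^sup>2)"
    have a: "a > 0" using \<Sigma> \<open>n \<ge> 1\<close> by (simp add: a_def)
    obtain A where A: "A \<in> sets ?P" "measure ?P A \<ge> 1 - \<zeta>"
      and E: "\<And>S. S \<in> A \<Longrightarrow> (\<integral>\<^sup>+w. ennreal (exp (real n * (gen_gap \<mu>z loss n S w)\<^sup>2 / (4 * \<Sigma>\<^sup>2))) \<partial>\<pi>) \<le> ennreal (3 / \<zeta>)"
      using pac_bayes_event[OF \<open>prob_space \<mu>z\<close> pi.prob_space_axioms sets\<pi> \<open>n \<ge> 1\<close> _ \<open>0 < \<zeta>\<close> loss_measurable cont contr loss_subgaussian] \<Sigma>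
      by auto
    show ?thesis
    proof (rule bexI[OF _ A(1)], intro conjI ballI allI impI A(2))
      fix S T assume SA: "S \<in> A" and T: "(T::real) > 0"
      have S: "S \<in> space ?P" using SA sets.sets_into_space[OF A(1)] by auto
      then have Si: "S i \<in> space \<mu>z" if "i < n" for i using that by (auto simp: space_PiM PiE_iff)
      have reg: "C2 (emp_risk loss n S)" "strongly_convex \<gamma> (emp_risk loss n S)"
        "\<exists>C. C-lipschitz_on UNIV (grad (emp_risk loss n S))"
        using emp_risk_regular[of n loss S \<gamma>, OF \<open>n \<ge> 1\<close> loss_C2[OF Si] loss_strongly_convex[OF Si] loss_grad_lipschitz[OF Si]]
        by simp_all
      let ?G = "gen_gap \<mu>z loss n S"
      define Q where "Q = (\<integral>\<^sup>+t\<in>{0..T}. ennreal (exp (- \<eta> * \<gamma> * (T - t))) *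
              (\<integral>\<^sup>+y. ennreal (2 * laplacian (Lhat loss n \<gamma> S) y
                  + 1 / \<sigma>\<^sup>2 * (norm (grad (Lhat loss n \<gamma> S) y))\<^sup>2) \<partial>\<rho>bar S t) \<partial>lborel)"
      have Yeq: "Y S t = (\<lambda>\<omega>. X S (N t \<omega>) \<omega>)" for t by (rule ext) (rule Y_def)
      have Q_eq: "Q = (\<integral>\<^sup>+t\<in>{0..T}. ennreal (exp (- \<eta> * \<gamma> * (T - t))) *
              (\<integral>\<^sup>+y. ennreal (2 * laplacian (Lhat loss n \<gamma> S) y
                  + 1 / \<sigma>\<^sup>2 * (norm (grad (Lhat loss n \<gamma> S) y))\<^sup>2)
                \<partial>convolution (distr M borel (\<lambda>\<omega>. X S (N t \<omega>) \<omega>)) (gaussian (\<sigma>\<^sup>2))) \<partial>lborel)"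
        unfolding Q_def \<rho>bar_def \<rho>_def Yeq ..
      have contG: "continuous_on UNIV ?G"
        unfolding gen_gap_def using C2_continuous[OF reg(1)] contr by (intro continuous_intros)
      have [measurable]: "?G \<in> borel_measurable borel" using contG by (rule borel_measurable_continuous_onI)
      let ?W = "enn2ereal Q + K T + ereal (ln (3 / \<zeta>))"
      have l3: "ln (3 / \<zeta>) > 0" using \<open>0 < \<zeta>\<close> \<open>\<zeta> < 1\<close> by simp
      show "ereal (\<integral>\<omega>. ?G (Y S T \<omega>) \<partial>M) \<le> ereal (2 * \<Sigma> / sqrt (real n)) * ereal_sqrt
          (enn2ereal (\<integral>\<^sup>+t\<in>{0..T}. ennreal (exp (- \<eta> * \<gamma> * (T - t))) *
              (\<integral>\<^sup>+y. ennreal (2 * laplacian (Lhat loss n \<gamma> S) y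
                  + 1 / \<sigma>\<^sup>2 * (norm (grad (Lhat loss n \<gamma> S) y))\<^sup>2) \<partial>\<rho>bar S t) \<partial>lborel)
           + K T + ereal (ln (3 / \<zeta>)))"
        unfolding Q_def[symmetric]
      \<comment> \<open>If a term of the bracket is infinite, so is the right-hand side; otherwise
        all quantities are real.\<close>
      proof (cases "Q = \<top> \<or> kl \<mu>\<^sub>0 \<pi> = \<infinity>")
        case True
        have "K T \<noteq> - \<infinity>" unfolding K_def kl_def by auto
        moreover have "enn2ereal Q = \<infinity> \<or> K T = \<infinity>" using True unfolding K_def by auto
        moreover have "enn2ereal Q \<noteq> - \<infinity>" by simp
        ultimately have "?W = \<infinity>" by (cases "enn2ereal Q"; cases "K T") auto
        then show "ereal (\<integral>\<omega>. ?G (Y S T \<omega>) \<partial>M) \<le> ereal (2 * \<Sigma> / sqrt (real n)) * ereal_sqrt ?W"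
          using \<Sigma> \<open>n \<ge> 1\<close> by (simp add: ereal_sqrt_def)
      next
        case False
        then obtain q where q: "Q = ennreal q" "q \<ge> 0" by (cases Q) auto
        obtain \<kappa> where \<kappa>: "kl \<mu>\<^sub>0 \<pi> = ereal \<kappa>" using False by (auto simp: kl_def split: if_splits)
        have Lhat: "Lhat loss n \<gamma> S y = emp_risk loss n S y / \<gamma> - (norm y)\<^sup>2 / 2" for y by (simp add: Lhat_def)
        note bound = poissonized_entropy_bound[OF \<open>\<eta> > 0\<close> \<open>\<sigma> > 0\<close> \<open>\<gamma> > 0\<close> \<open>\<gamma> * \<eta> < 1\<close> reg Lhat \<pi>_def noise_law
            init_law[OF S] step[OF S] noise_indep_state[OF S] poisson poisson_indep[OF S] \<kappa> T Q_eq]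
        have Qtop: "Q \<noteq> \<top>" using False by simp
        define k where "k = exp (- \<gamma> * \<eta> * T) * \<kappa>"
        have k: "k \<ge> 0"
        proof -
          have "\<kappa> \<ge> 0" by (rule bound(2)[OF _ Qtop, of "\<lambda>_. 0"]) auto
          then show ?thesis by (simp add: k_def)
        qed
        define W where "W = q + k + ln (3 / \<zeta>)"
        have W: "W > 0" "?W = ereal W"
          using q k l3 \<kappa> by (auto simp: W_def K_def k_def)
        \<comment> \<open>Truncation only decreases the exponential moment under
          \<open>\<pi>\<close>, so on the event its logarithm is at most
          \<open>ln (3 / \<zeta>)\<close> for every \<open>m\<close>.\<close>
        have "(\<integral>\<^sup>+\<omega>. ennreal (min (a * (?G (Y S T \<omega>))\<^sup>2) m) \<partial>M) \<le> ennreal W" for m :: nat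
        proof -
          define \<phi> where "\<phi> w = min (a * (?G w)\<^sup>2) m" for w
          have \<phi>: "continuous_on UNIV \<phi>" "bounded (range \<phi>)" "\<phi> w \<ge> 0" for w
          proof -
            show "continuous_on UNIV \<phi>" unfolding \<phi>_def by (intro continuous_intros contG)
            show "\<phi> w \<ge> 0" for w using a by (simp add: \<phi>_def)
            then have "norm (\<phi> w) \<le> m" for w by (simp add: \<phi>_def)
            then show "bounded (range \<phi>)" by (intro boundedI[of _ m]) auto
          qed
          have [measurable]: "\<phi> \<in> borel_measurable borel" using \<phi>(1) by (rule borel_measurable_continuous_onI)
          have m\<pi>: "(\<lambda>w. exp (\<phi> w)) \<in> borel_measurable \<pi>" unfolding \<pi>v by measurable
          have ie: "integrable \<pi> (\<lambda>w. exp (\<phi> w))"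
            using m\<pi> by (intro pi.integrable_const_bound[of _ "exp m"]) (auto simp: \<phi>_def)
          have "ennreal (\<integral>w. exp (\<phi> w) \<partial>\<pi>) = (\<integral>\<^sup>+w. ennreal (exp (\<phi> w)) \<partial>\<pi>)"
            using ie by (intro nn_integral_eq_integral[symmetric]) auto
          also have "\<dots> \<le> (\<integral>\<^sup>+w. ennreal (exp (real n * (?G w)\<^sup>2 / (4 * \<Sigma>\<^sup>2))) \<partial>\<pi>)"
            by (intro nn_integral_mono ennreal_leI) (simp add: \<phi>_def a_def)
          also have "\<dots> \<le> ennreal (3 / \<zeta>)" by (rule E[OF SA])
          finally have le: "(\<integral>w. exp (\<phi> w) \<partial>\<pi>) \<le> 3 / \<zeta>" using \<open>0 < \<zeta>\<close> by (subst (asm) ennreal_le_iff) auto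
          have ge: "1 \<le> (\<integral>w. exp (\<phi> w) \<partial>\<pi>)" using \<phi>(3) ie by (intro pi.integral_ge_const) auto
          have "(\<integral>\<^sup>+\<omega>. ennreal (\<phi> (Y S T \<omega>)) \<partial>M) \<le> ennreal q + ennreal k + ennreal (ln (\<integral>w. exp (\<phi> w) \<partial>\<pi>))"
            using bound(1)[OF _ Qtop \<phi>] unfolding Y_def q(1) k_def by simp
          also have "\<dots> \<le> ennreal q + ennreal k + ennreal (ln (3 / \<zeta>))"
            using le ge \<open>0 < \<zeta>\<close> by (intro add_left_mono ennreal_leI) (subst ln_le_cancel_iff, auto)
          also have "\<dots> = ennreal W" unfolding W_def using q k l3 by simp
          finally show ?thesis unfolding \<phi>_def .
        qed
        moreover have "(\<lambda>\<omega>. ?G (Y S T \<omega>)) \<in> borel_measurable M"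
        proof -
          have "Y S T \<in> borel_measurable M" unfolding Yeq
          proof (rule measurable_compose_countable)
            show "N T \<in> measurable M (count_space UNIV)" using T by (intro poisson_process_measurable[OF poisson]) simp
            show "X S i \<in> borel_measurable M" for i
              using noise_indep_state[OF S, of i] unfolding indep_var_distribution_eq by auto
          qed
          then show ?thesis by measurable
        qed
        ultimately have "(\<integral>\<omega>. ?G (Y S T \<omega>) \<partial>M) \<le> sqrt (W / a)"
          using a W(1) by (intro expectation_le_sqrt) auto
        also have "W / a = (2 * \<Sigma>)\<^sup>2 / n * W" using \<Sigma> \<open>n \<ge> 1\<close> by (simp add: a_def power_mult_distrib)
        also have "sqrt ((2 * \<Sigma>)\<^sup>2 / n * W) = 2 * \<Sigma> / sqrt n * sqrt W"
          using \<Sigma> by (simp add: real_sqrt_mult real_sqrt_divide)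
        finally show "ereal (\<integral>\<omega>. ?G (Y S T \<omega>) \<partial>M) \<le> ereal (2 * \<Sigma> / sqrt (real n)) * ereal_sqrt ?W"
          unfolding W(2) by (simp add: ereal_sqrt_def)
      qed
    qed
  qed
qed

end
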